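(* Let $\mathcal C\subseteq\mathbb R^n$ be a symmetric cone, and let $\langle\cdot,\cdot\rangle$ be an inner product on $\mathbb R^n$ under which $\mathcal C^\star=\mathcal C$. Let $\mathcal A\subseteq\mathcal C$ and $\mathcal B\subseteq\mathcal C^\star$ be finite sets and let $\Delta$ be a real number such that $$\langle a,b\rangle\le\Delta\quad\text{for all } a\in\mathcal A,\ b\in\mathcal B.$$ Assume further that $\operatorname{cone}(\mathcal A)$ intersects the interior of $\mathcal C$ and $\operatorname{cone}(\mathcal B)$ intersects the interior of $\mathcal C^\star$. Then there exists an automorphism $x\mapsto Lx$ of $\mathcal C$ which is self-adjoint (with respect to $\langle\cdot,\cdot\rangle$) such that $$\langle La,La\rangle\le\vartheta\Delta\quad\text{and}\quad\langle L^{-1}b,L^{-1}b\rangle\le\vartheta\Delta\qquad\text{for all } a\in\mathcal A,\ b\in\mathcal B,$$ where $\vartheta$ is the Carathéodory number of $\mathcal C$.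
   Context: A convex cone is regular if it is closed, pointed and has nonempty interior. The dual cone is $\mathcal C^\star=\{x\in\mathbb R^n:\langle x,y\rangle\ge0\text{ for all }y\in\mathcal C\}$. An automorphism of $\mathcal C$ is an invertible linear map $L$ on $\mathbb R^n$ with $L(\mathcal C)=\mathcal C$. A regular convex cone is homogeneous if its automorphism group acts transitively on its interior; it is self-dual if there is an inner product under which it equals its dual; it is symmetric if it is homogeneous and self-dual. $\operatorname{cone}(S)$ is the set of all finite nonnegative linear combinations of elements of $S$. The Carathéodory number of $\mathcal C$ is the smallest integer $k$ such that every element of $\mathcal C$ is a sum of at most $k$ vectors each lying on an extreme ray of $\mathcal C$. *)

theory Defs
  imports "HOL-Analysis.Analysis"
begin

text \<open>
  Inner products are explicit functions, since self-duality quantifies over all inner products on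
  the space and not only the canonical one of the type class. Topological notions (closedness,
  interior) do not depend on this choice, because all norms on a finite-dimensional space are
  equivalent.
\<close>

definition is_inner_product :: "('a::real_vector \<Rightarrow> 'a \<Rightarrow> real) \<Rightarrow> bool" where
  "is_inner_product ip \<longleftrightarrow>
     bilinear ip \<and> (\<forall>x y. ip x y = ip y x) \<and> (\<forall>x. x \<noteq> 0 \<longrightarrow> 0 < ip x x)"

definition dual_cone :: "('a::real_vector \<Rightarrow> 'a \<Rightarrow> real) \<Rightarrow> 'a set \<Rightarrow> 'a set" where
  "dual_cone ip C = {x. \<forall>y\<in>C. 0 \<le> ip x y}"

definition pointed :: "'a::real_vector set \<Rightarrow> bool" where
  "pointed C \<longleftrightarrow> (\<forall>x. x \<in> C \<and> - x \<in> C \<longrightarrow> x = 0)"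

definition regular_cone :: "'a::euclidean_space set \<Rightarrow> bool" where
  "regular_cone C \<longleftrightarrow> convex_cone C \<and> closed C \<and> pointed C \<and> interior C \<noteq> {}"

definition cone_automorphism :: "'a::real_vector set \<Rightarrow> ('a \<Rightarrow> 'a) \<Rightarrow> bool" where
  "cone_automorphism C L \<longleftrightarrow> linear L \<and> bij L \<and> L ` C = C"

definition homogeneous_cone :: "'a::euclidean_space set \<Rightarrow> bool" where
  "homogeneous_cone C \<longleftrightarrow> regular_cone C \<and>
     (\<forall>x\<in>interior C. \<forall>y\<in>interior C. \<exists>L. cone_automorphism C L \<and> L x = y)"

definition self_dual_cone :: "'a::real_vector set \<Rightarrow> bool" where
  "self_dual_cone C \<longleftrightarrow> (\<exists>ip. is_inner_product ip \<and> dual_cone ip C = C)"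

definition symmetric_cone :: "'a::euclidean_space set \<Rightarrow> bool" where
  "symmetric_cone C \<longleftrightarrow> homogeneous_cone C \<and> self_dual_cone C"

definition self_adjoint_wrt :: "('a \<Rightarrow> 'a \<Rightarrow> real) \<Rightarrow> ('a \<Rightarrow> 'a) \<Rightarrow> bool" where
  "self_adjoint_wrt ip L \<longleftrightarrow> (\<forall>x y. ip (L x) y = ip x (L y))"

text \<open>
  The set of finite nonnegative linear combinations. Unlike \<^term>\<open>cone hull S\<close> and
  \<^term>\<open>conic hull S\<close>, it is closed under addition, and it contains 0 even when \<open>S\<close> is empty.
\<close>

definition conical_combinations :: "'a::real_vector set \<Rightarrow> 'a set" where
  "conical_combinations S =
     {(\<Sum>s\<in>T. c s *\<^sub>R s) | T c. finite T \<and> T \<subseteq> S \<and> (\<forall>s\<in>T. 0 \<le> c s)}"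

text \<open>
  An extreme ray is a closed half-line from the origin that is a face of the cone;
  \<^term>\<open>conic hull {x}\<close> is the half-line of the nonnegative multiples of \<open>x\<close>.
\<close>

definition extreme_ray_of :: "'a::real_vector set \<Rightarrow> 'a set \<Rightarrow> bool" where
  "extreme_ray_of R C \<longleftrightarrow> (\<exists>x. x \<noteq> 0 \<and> R = conic hull {x}) \<and> R face_of C"

definition caratheodory_number :: "'a::real_vector set \<Rightarrow> nat" where
  "caratheodory_number C =
     (LEAST k. \<forall>x\<in>C. \<exists>vs. length vs \<le> k \<and>
        (\<forall>v\<in>set vs. \<exists>R. extreme_ray_of R C \<and> v \<in> R) \<and> x = sum_list vs)"

end

theory Submission
  imports Defs
begin

text \<open>
  Write \<open>|x|\<close> for the norm of the given inner product and \<open>g*\<close> for adjoints; automorphisms are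
  closed under adjoints by self-duality. The proof avoids Jordan algebras and Lie theory.

  (1) \<open>m(x) = \<integral>\<^sub>C h \<langle>x,z\<rangle> z dz\<close> with \<open>h(s) = max(0, 1-s)\<^sup>2\<close> satisfies \<open>m(gx) = c\<^sub>g (g*)\<^sup>-\<^sup>1 m(x)\<close>, and
  minimising \<open>|x|\<^sup>2/2 + \<Phi>(x)\<close>, where \<open>m = -grad \<Phi>\<close>, gives an interior point \<open>b\<close> with \<open>m(b) = b\<close>.
  Hence the stabiliser of \<open>b\<close> consists of orthogonal maps. If \<open>gb = b + tw\<close>, then \<open>P = c\<^sub>g\<^sup>-\<^sup>1 g g*\<close> maps
  \<open>m(gb)\<close> to \<open>gb\<close>, so as \<open>t\<close> tends to 0 the self-adjoint automorphisms near the identity move \<open>b\<close>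
  in every direction.

  (2) Minimising \<open>max \<langle>gx,e\<rangle> + max \<langle>(g*)\<^sup>-\<^sup>1y,e\<rangle>\<close>, with \<open>x\<close> in \<open>A\<close> and \<open>y\<close> in \<open>B\<close>, over all
  automorphisms \<open>g\<close> yields, by first-order optimality, a common point \<open>z\<close> of the convex hulls of the
  maximisers among the \<open>gx\<close> and among the \<open>(g*)\<^sup>-\<^sup>1y\<close>. For singletons this shows that self-adjoint
  automorphisms act transitively on the interior.

  (3) For an extremal vector \<open>v\<close>, self-adjoint automorphisms mapping \<open>b\<close> to points near \<open>v\<close> accumulate at
  the rank-one map \<open>x \<mapsto> \<langle>v,x\<rangle> v / \<langle>v,b\<rangle>\<close>. Thus \<open>|v|/\<langle>v,b\<rangle>\<close> is invariant under automorphisms and agrees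
  on non-orthogonal extremal vectors, which produces \<open>e\<close> with \<open>\<langle>v,e\<rangle> = |v|\<close> for all extremal \<open>v\<close>.
  Then \<open>|x| \<le> \<langle>x,e\<rangle>\<close> on the cone. In a shortest extremal decomposition of \<open>e\<close> every summand has norm at
  most 1, so \<open>\<langle>e,e\<rangle> \<le> \<theta>\<close>, the Caratheodory number.

  (4) With this \<open>e\<close> in (2), the common maximum \<open>M = \<langle>z,e\<rangle>\<close> satisfies
  \<open>M\<^sup>2 \<le> \<langle>z,z\<rangle>\<langle>e,e\<rangle> \<le> \<Delta>\<theta>\<close>, and \<open>|gx|, |(g*)\<^sup>-\<^sup>1y| \<le> M\<close>. The self-adjoint polar factor of \<open>g\<close>
  is an automorphism and has the same norms.
\<close>

section \<open>Inner products and adjoints\<close>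

locale ip_space =
  fixes ip :: "'a::euclidean_space \<Rightarrow> 'a \<Rightarrow> real"
  assumes inner_product: "is_inner_product ip"
begin

sublocale bounded_bilinear ip
  using inner_product bilinear_conv_bounded_bilinear unfolding is_inner_product_def by blast

lemma commute: "ip x y = ip y x"
  using inner_product unfolding is_inner_product_def by blast

lemma self_pos: "x \<noteq> 0 \<Longrightarrow> 0 < ip x x"
  using inner_product unfolding is_inner_product_def by blast

lemma self_nonneg: "0 \<le> ip x x"
  by (cases "x = 0") (use self_pos less_imp_le in \<open>auto simp: zero_left\<close>)

lemma self_eq_0_iff [simp]: "ip x x = 0 \<longleftrightarrow> x = 0"
  using self_pos by (metis less_irrefl zero_left)

lemma sum_list_left: "ip (sum_list vs) y = (\<Sum>v\<leftarrow>vs. ip v y)"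
  by (induction vs) (auto simp: zero_left add_left)

lemma sum_list_right: "ip y (sum_list vs) = (\<Sum>v\<leftarrow>vs. ip y v)"
  by (induction vs) (auto simp: zero_right add_right)

lemma eqI: "(\<And>y. ip y x = ip y x') \<Longrightarrow> x = x'"
  using self_eq_0_iff[of "x - x'"] by (simp add: diff_right)

lemma Cauchy_Schwarz: "(ip x y)\<^sup>2 \<le> ip x x * ip y y"
proof (cases "y = 0")
  case False
  let ?p = "ip y y" and ?q = "ip x y"
  have yx: "ip y x = ip x y" by (rule commute)
  have "0 \<le> ip (?p *\<^sub>R x - ?q *\<^sub>R y) (?p *\<^sub>R x - ?q *\<^sub>R y)"
    by (rule self_nonneg)
  also have "\<dots> = ?p * (ip x x * ?p - ?q\<^sup>2)"
    by (simp add: diff_left diff_right scaleR_left scaleR_right yx power2_eq_square right_diff_distrib)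
  finally show ?thesis
    using self_pos[OF False] by (simp add: zero_le_mult_iff)
qed (simp add: zero_right)

text \<open>The constant is the minimum of the quadratic form on the Euclidean unit sphere, attained
  by compactness; homogeneity extends the bound to all vectors.\<close>

lemma self_ge_norm: obtains c where "c > 0" "\<And>x. c * (norm x)\<^sup>2 \<le> ip x x"
proof -
  have "continuous_on (sphere 0 1) (\<lambda>x. ip x x)"
    by (intro continuous_on continuous_on_id)
  moreover obtain b :: 'a where "b \<in> Basis" using nonempty_Basis by blast
  then have "sphere (0::'a) 1 \<noteq> {}" using norm_Basis by fastforce
  ultimately obtain z where z: "norm z = 1" "\<And>x. norm x = 1 \<Longrightarrow> ip z z \<le> ip x x"
    using continuous_attains_inf[of "sphere 0 1" "\<lambda>x. ip x x"] by auto
  show ?thesis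
  proof
    show "0 < ip z z" using z(1) by (intro self_pos) auto
    fix x :: 'a
    show "ip z z * (norm x)\<^sup>2 \<le> ip x x"
    proof (cases "x = 0")
      case False
      then have "ip z z \<le> ip (x /\<^sub>R norm x) (x /\<^sub>R norm x)" by (intro z) simp
      also have "\<dots> = ip x x / (norm x)\<^sup>2"
        by (simp add: scaleR_left scaleR_right power2_eq_square divide_inverse mult_ac)
      finally show ?thesis using False by (simp add: pos_le_divide_eq)
    qed (simp add: zero_left)
  qed
qed

text \<open>\<open>R\<close> is the Gram operator of \<open>ip\<close> against the canonical inner
  product. Definiteness makes it injective, hence surjective, so it reaches the canonical
  representative of \<open>f\<close>.\<close>

lemma Riesz:
  fixes f :: "'a \<Rightarrow> real"
  assumes "linear f"
  obtains u where "\<And>x. ip u x = f x"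
proof -
  define R where "R y = (\<Sum>b\<in>Basis. ip y b *\<^sub>R b)" for y
  have R: "R y \<bullet> x = ip y x" for x y
  proof -
    have "x \<bullet> R y = (\<Sum>b\<in>Basis. ip y ((x \<bullet> b) *\<^sub>R b))"
      by (simp add: R_def inner_sum_right scaleR_right mult.commute)
    also have "\<dots> = ip y x" by (simp only: sum_right[symmetric] euclidean_representation)
    finally show ?thesis by (simp only: inner_commute)
  qed
  have "linear R"
    by (rule linearI) (simp_all add: R_def add_left scaleR_left algebra_simps sum.distrib scaleR_sum_right)
  moreover have "inj R"
    unfolding linear_injective_0[OF \<open>linear R\<close>] by (metis R inner_zero_left self_eq_0_iff)
  ultimately obtain u where "R u = (\<Sum>b\<in>Basis. f b *\<^sub>R b)"
    using linear_injective_imp_surjective by (metis surjD)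
  moreover have "(\<Sum>b\<in>Basis. f b *\<^sub>R b) \<bullet> x = f x" for x
  proof -
    have "f x = f (\<Sum>b\<in>Basis. (x \<bullet> b) *\<^sub>R b)" by (simp add: euclidean_representation)
    also have "\<dots> = (\<Sum>b\<in>Basis. (x \<bullet> b) * f b)"
      by (simp add: linear_sum[OF assms] linear_cmul[OF assms])
    finally show ?thesis
      by (simp add: inner_commute[of _ x] inner_sum_right mult.commute)
  qed
  ultimately show ?thesis using R that by metis
qed

text \<open>The adjoint for \<open>ip\<close> rather than for the canonical inner product. The
  description is meaningful for linear \<open>g\<close>: existence comes from \<open>Riesz\<close>,
  uniqueness from \<open>eqI\<close>.\<close>

definition adj :: "('a \<Rightarrow> 'a) \<Rightarrow> 'a \<Rightarrow> 'a" where
  "adj g y = (THE z. \<forall>x. ip (g x) y = ip x z)"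

lemma adj: assumes "linear g" shows "ip (g x) y = ip x (adj g y)"
proof -
  have "linear (\<lambda>x. ip (g x) y)"
    by (rule linearI) (simp_all add: linear_add[OF assms] linear_cmul[OF assms] add_left scaleR_left)
  from Riesz[OF this] obtain z where "\<And>x. ip z x = ip (g x) y" by blast
  then have z: "ip (g x) y = ip x z" for x using commute[of x z] by simp
  have "adj g y = z"
    unfolding adj_def
  proof (rule the_equality)
    show "z' = z" if "\<forall>x. ip (g x) y = ip x z'" for z'
      using that z by (intro eqI) simp
  qed (simp add: z)
  with z show ?thesis by simp
qed

lemma adj': "linear g \<Longrightarrow> ip (adj g y) x = ip y (g x)"
  by (metis adj commute)

lemma adj_unique: "(\<And>x. ip (g x) y = ip x z) \<Longrightarrow> linear g \<Longrightarrow> adj g y = z"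
  by (metis adj eqI)

lemma linear_adj: assumes "linear g" shows "linear (adj g)"
  by (rule linearI; rule adj_unique[OF _ assms])
    (simp_all add: add_right scaleR_right adj[OF assms])

text \<open>The pairings \<open>ip x (adj (g k) y) = ip (g k x) y\<close> converge for each
  \<open>x\<close>, and by \<open>Riesz\<close> every coordinate functional is such a
  pairing.\<close>

lemma tendsto_adj:
  assumes "\<And>k. linear (g k)" "\<And>x. (\<lambda>k. g k x) \<longlonglongrightarrow> h x" "linear h"
  shows "(\<lambda>k. adj (g k) y) \<longlonglongrightarrow> adj h y"
proof -
  have ip_lim: "(\<lambda>k. ip x (adj (g k) y)) \<longlonglongrightarrow> ip x (adj h y)" for x
    using tendsto[OF assms(2) tendsto_const, of x y] by (simp add: adj assms)
  have "(\<lambda>k. adj (g k) y \<bullet> b) \<longlonglongrightarrow> adj h y \<bullet> b" for b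
  proof -
    obtain u where "\<And>x. ip u x = b \<bullet> x"
      using Riesz[of "\<lambda>x. b \<bullet> x"] by (auto intro: bounded_linear.linear bounded_linear_inner_right)
    then show ?thesis using ip_lim[of u] by (simp add: inner_commute)
  qed
  then show ?thesis by (subst tendsto_componentwise_iff) blast
qed

end

section \<open>Limits of linear maps and minimizing sequences\<close>

lemma linear_seq_compact:
  fixes g :: "nat \<Rightarrow> real^'n \<Rightarrow> real^'n"
  assumes lin: "\<And>k. linear (g k)" and bdd: "\<And>k x. norm (g k x) \<le> B * norm x"
  obtains r h where "strict_mono r" "linear h" "\<And>x. (\<lambda>k. g (r k) x) \<longlonglongrightarrow> h x"
proof -
  \<comment> \<open>The columns are images of unit vectors, so all entries are at most
    \<open>B\<close> in modulus and Bolzano-Weierstrass applies to the matrices.\<close>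
  have "norm (matrix (g k)) \<le> real CARD('n) * (real CARD('n) * B)" for k
  proof -
    have "norm (matrix (g k) $ i) \<le> real CARD('n) * B" for i
    proof -
      have "norm (matrix (g k) $ i) \<le> (\<Sum>j\<in>UNIV. norm (matrix (g k) $ i $ j))"
        unfolding norm_vec_def by (rule L2_set_le_sum) simp
      also have "\<dots> \<le> (\<Sum>j\<in>(UNIV::'n set). B)"
      proof (rule sum_mono)
        fix j
        have "norm (g k (axis j 1) $ i) \<le> norm (g k (axis j 1))"
          by (simp add: component_le_norm_cart)
        also have "\<dots> \<le> B" using bdd[of k "axis j 1"] by (simp add: norm_axis_1)
        finally show "norm (matrix (g k) $ i $ j) \<le> B" by (simp add: matrix_def)
      qed
      finally show ?thesis by simp
    qed
    then have "(\<Sum>i\<in>UNIV. norm (matrix (g k) $ i)) \<le> (\<Sum>i\<in>(UNIV::'n set). real CARD('n) * B)"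
      by (intro sum_mono) auto
    moreover have "norm (matrix (g k)) \<le> (\<Sum>i\<in>UNIV. norm (matrix (g k) $ i))"
      unfolding norm_vec_def[of "matrix (g k)"] by (rule L2_set_le_sum) simp
    ultimately show ?thesis by simp
  qed
  then have "bounded (range (\<lambda>k. matrix (g k)))" by (auto simp: bounded_iff)
  then obtain M r where r: "strict_mono r" "(\<lambda>k. matrix (g (r k))) \<longlonglongrightarrow> M"
    using bounded_imp_convergent_subsequence[of "\<lambda>k. matrix (g k)"] by (auto simp: o_def)
  have "(\<lambda>k. g (r k) x) \<longlonglongrightarrow> M *v x" for x
  proof (rule vec_tendstoI)
    fix i
    have "(\<lambda>k. (matrix (g (r k)) *v x) $ i) \<longlonglongrightarrow> (M *v x) $ i"
      unfolding matrix_vector_mult_def vec_lambda_beta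
      by (intro tendsto_sum tendsto_mult tendsto_vec_nth r(2) tendsto_const)
    then show "(\<lambda>k. g (r k) x $ i) \<longlonglongrightarrow> (M *v x) $ i"
      by (simp add: matrix_works lin)
  qed
  then show ?thesis by (rule that[OF r(1) matrix_vector_mul_linear])
qed

text \<open>The error \<open>g k (x k - x0)\<close> is at most \<open>B * norm (x k - x0)\<close>,
  so a pointwise limit may be evaluated along a moving argument.\<close>

lemma tendsto_linear_seq:
  fixes g :: "nat \<Rightarrow> 'a::real_normed_vector \<Rightarrow> 'b::real_normed_vector"
  assumes lin: "\<And>k. linear (g k)" and bdd: "\<And>k x. norm (g k x) \<le> B * norm x"
    and g: "\<And>x. (\<lambda>k. g k x) \<longlonglongrightarrow> h x" and x: "x \<longlonglongrightarrow> x0"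
  shows "(\<lambda>k. g k (x k)) \<longlonglongrightarrow> h x0"
proof -
  have "(\<lambda>k. B * norm (x k - x0)) \<longlonglongrightarrow> B * norm (x0 - x0)"
    by (rule tendsto_mult_left[OF tendsto_norm[OF tendsto_diff[OF x tendsto_const]]])
  then have "(\<lambda>k. B * norm (x k - x0)) \<longlonglongrightarrow> 0" by simp
  then have "(\<lambda>k. g k (x k - x0)) \<longlonglongrightarrow> 0"
    by (rule Lim_null_comparison[OF always_eventually[OF allI[OF bdd]]])
  from tendsto_add[OF this g[of x0]] show ?thesis
    by (simp add: linear_diff[OF lin])
qed

text \<open>The slack \<open>1/(k+1)\<close> never exceeds 1, so \<open>f (s k) < l + 1\<close>
  holds at every index; compactness arguments use it as a uniform bound.\<close>

lemma minimizing_sequence: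
  fixes f :: "'a \<Rightarrow> real"
  assumes "S \<noteq> {}" and nonneg: "\<And>s. s \<in> S \<Longrightarrow> 0 \<le> f s"
  obtains s l where "\<And>k. s k \<in> S" "(\<lambda>k. f (s k)) \<longlonglongrightarrow> l" "\<And>k. f (s k) < l + 1" "\<And>t. t \<in> S \<Longrightarrow> l \<le> f t"
proof -
  let ?l = "Inf (f ` S)"
  have bdd: "bdd_below (f ` S)" using nonneg by (meson bdd_belowI2)
  have "\<exists>s\<in>S. f s < ?l + inverse (real (Suc k))" for k
    using cInf_lessD[of "f ` S" "?l + inverse (real (Suc k))"] \<open>S \<noteq> {}\<close> by auto
  then obtain s where s: "\<And>k. s k \<in> S" "\<And>k. f (s k) < ?l + inverse (real (Suc k))"
    by metis
  have lower: "?l \<le> f t" if "t \<in> S" for t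
    using that bdd by (simp add: cInf_lower)
  show ?thesis
  proof
    show "(\<lambda>k. f (s k)) \<longlonglongrightarrow> ?l"
    proof (rule tendsto_sandwich)
      show "\<forall>\<^sub>F k in sequentially. ?l \<le> f (s k)"
        using s(1) lower by simp
      show "\<forall>\<^sub>F k in sequentially. f (s k) \<le> ?l + inverse (real (Suc k))"
        using s(2) less_imp_le by (intro always_eventually allI) blast
      show "(\<lambda>k. ?l + inverse (real (Suc k))) \<longlonglongrightarrow> ?l"
        using tendsto_add[OF tendsto_const LIMSEQ_inverse_real_of_nat] by simp
    qed simp
    show "f (s k) < ?l + 1" for k
    proof -
      have "inverse (real (Suc k)) \<le> 1" by (simp add: field_simps)
      with s(2)[of k] show ?thesis by linarith
    qed
  qed (use s lower in auto)
qed

section \<open>Linear change of variables\<close>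

text \<open>
  The library states the transformation behaviour of Lebesgue measure under linear maps only for
  index types of class \<open>wellorder\<close>, so we pass through a well-ordered copy of the index type.
\<close>

typedef 'n wo = "UNIV :: 'n set" by simp

definition wo_rank :: "'n::finite \<Rightarrow> nat" where
  "wo_rank = (SOME f. inj f)"

lemma inj_wo_rank: "inj (wo_rank :: 'n::finite \<Rightarrow> nat)"
proof -
  have "\<exists>f :: 'n \<Rightarrow> nat. inj f" using finite_imp_inj_to_nat_seg[of "UNIV :: 'n set"] by auto
  then show ?thesis unfolding wo_rank_def by (rule someI_ex)
qed

instance wo :: (finite) finite
proof
  have "(UNIV :: 'a wo set) = range Abs_wo" by (metis Rep_wo_inverse surj_def)
  then show "finite (UNIV :: 'a wo set)" by (metis finite finite_imageI)
qed

instantiation wo :: (finite) wellorder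
begin

definition "x \<le> y \<longleftrightarrow> wo_rank (Rep_wo x) \<le> wo_rank (Rep_wo y)"
definition "x < y \<longleftrightarrow> wo_rank (Rep_wo x) < wo_rank (Rep_wo y)"

instance
proof
  fix x y :: "'a wo"
  show "x \<le> y \<Longrightarrow> y \<le> x \<Longrightarrow> x = y"
    by (metis less_eq_wo_def Rep_wo_inject injD[OF inj_wo_rank] order_antisym)
next
  fix P :: "'a wo \<Rightarrow> bool" and a
  assume step: "\<And>x. (\<And>y. y < x \<Longrightarrow> P y) \<Longrightarrow> P x"
  show "P a"
    by (rule measure_induct_rule[of "\<lambda>x. wo_rank (Rep_wo x)"]) (use step in \<open>auto simp: less_wo_def\<close>)
qed (auto simp: less_eq_wo_def less_wo_def)

end

definition to_wo :: "real^'n::finite \<Rightarrow> real^('n wo)" where "to_wo x = (\<chi> i. x $ Rep_wo i)"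
definition of_wo :: "real^('n wo) \<Rightarrow> real^'n::finite" where "of_wo x = (\<chi> i. x $ Abs_wo i)"

lemma to_wo_of_wo [simp]: "to_wo (of_wo x) = x" and of_wo_to_wo [simp]: "of_wo (to_wo y) = y"
  by (simp_all add: to_wo_def of_wo_def vec_eq_iff Rep_wo_inverse Abs_wo_inverse)

lemma linear_to_wo: "linear to_wo" and linear_of_wo: "linear of_wo"
  by (auto intro!: linearI simp: to_wo_def of_wo_def vec_eq_iff)

lemma continuous_of_wo: "continuous_on UNIV of_wo"
  using linear_of_wo linear_continuous_on linear_linear by blast

lemma of_wo_measurable [measurable]: "of_wo \<in> borel_measurable borel"
  by (rule borel_measurable_continuous_onI[OF continuous_of_wo])

lemma bij_Rep_wo: "bij_betw Rep_wo UNIV UNIV"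
  by (metis UNIV_I Abs_wo_inverse Rep_wo_inject bijI bij_betw_def inj_def surj_def)

text \<open>Lebesgue measure is determined by its values on boxes, and \<open>of_wo\<close> only
  relabels coordinates, so preimages of boxes are boxes with the same side lengths.\<close>

lemma lborel_of_wo: "(lborel :: (real^'n::finite) measure) = distr lborel borel of_wo"
proof (rule lborel_eqI)
  fix l u :: "real^'n" assume le: "\<And>b. b \<in> Basis \<Longrightarrow> l \<bullet> b \<le> u \<bullet> b"
  have le': "l $ i \<le> u $ i" for i using le[of "axis i 1"] by (simp add: cart_eq_inner_axis)
  have "of_wo -` box l u = box (to_wo l) (to_wo u)"
    unfolding set_eq_iff vimage_eq mem_box_cart
    by (auto simp: of_wo_def to_wo_def) (metis Rep_wo_inverse Abs_wo_inverse UNIV_I)+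
  then have "emeasure (distr lborel borel of_wo) (box l u) = emeasure lborel (box (to_wo l) (to_wo u))"
    by (simp add: emeasure_distr)
  also have "\<dots> = ennreal (\<Prod>b\<in>Basis. (to_wo u - to_wo l) \<bullet> b)"
    by (subst emeasure_lborel_box) (auto simp: Basis_vec_def cart_eq_inner_axis[symmetric] to_wo_def le')
  also have "(\<Prod>b\<in>Basis. (to_wo u - to_wo l) \<bullet> b) = (\<Prod>i\<in>UNIV. (u - l) $ Rep_wo i)"
    by (subst prod.reindex_bij_betw[symmetric, of "\<lambda>i. axis i 1"])
      (auto simp: bij_betw_def inj_on_def Basis_vec_def axis_eq_axis cart_eq_inner_axis[symmetric] to_wo_def)
  also have "\<dots> = (\<Prod>i\<in>UNIV. (u - l) $ i)"
    by (rule prod.reindex_bij_betw[OF bij_Rep_wo])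
  also have "\<dots> = (\<Prod>b\<in>Basis. (u - l) \<bullet> b)"
    by (subst prod.reindex_bij_betw[symmetric, of "\<lambda>i. axis i 1"])
      (auto simp: bij_betw_def inj_on_def Basis_vec_def axis_eq_axis cart_eq_inner_axis[symmetric])
  finally show "emeasure (distr lborel borel of_wo) (box l u) = ennreal (\<Prod>b\<in>Basis. (u - l) \<bullet> b)" .
qed simp

text \<open>The modulus of the determinant of \<open>g\<close>, taken after relabelling the
  coordinates, the form in which \<open>integral_vol_factor_wo\<close> yields it.\<close>

definition vol_factor :: "(real^'n::finite \<Rightarrow> real^'n) \<Rightarrow> real" where
  "vol_factor g = \<bar>det (matrix (to_wo \<circ> g \<circ> of_wo))\<bar>"

lemma linear_conj_wo: "linear g \<Longrightarrow> linear (to_wo \<circ> g \<circ> of_wo)"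
  by (intro linear_compose linear_to_wo linear_of_wo)

lemma vol_factor_comp:
  assumes "linear f" "linear g" shows "vol_factor (f \<circ> g) = vol_factor f * vol_factor g"
proof -
  have "to_wo \<circ> (f \<circ> g) \<circ> of_wo = (to_wo \<circ> f \<circ> of_wo) \<circ> (to_wo \<circ> g \<circ> of_wo)"
    by (auto simp: fun_eq_iff)
  then show ?thesis
    unfolding vol_factor_def
    by (simp add: matrix_compose[OF linear_conj_wo linear_conj_wo] det_mul abs_mult assms)
qed

lemma vol_factor_id: "vol_factor (\<lambda>x. x) = 1"
  by (simp add: vol_factor_def o_def matrix_id[unfolded id_def])

lemma vol_factor_eq_0_iff: "linear g \<Longrightarrow> vol_factor g = 0 \<longleftrightarrow> \<not> inj g"
proof -
  assume g: "linear g"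
  have "inj (to_wo \<circ> g \<circ> of_wo) \<longleftrightarrow> inj g"
    unfolding inj_def o_def by (metis to_wo_of_wo of_wo_to_wo)
  then show ?thesis
    unfolding vol_factor_def using det_nz_iff_inj[OF linear_conj_wo[OF g]] by auto
qed

lemma tendsto_vol_factor:
  assumes "\<And>x. (\<lambda>k. g k x) \<longlonglongrightarrow> h x"
  shows "(\<lambda>k. vol_factor (g k)) \<longlonglongrightarrow> vol_factor h"
proof -
  have "(\<lambda>k. (to_wo \<circ> g k \<circ> of_wo) x $ i) \<longlonglongrightarrow> (to_wo \<circ> h \<circ> of_wo) x $ i" for x i
    by (simp add: to_wo_def tendsto_vec_nth assms)
  then show ?thesis
    unfolding vol_factor_def det_def matrix_def vec_lambda_beta
    by (intro tendsto_rabs tendsto_sum tendsto_mult tendsto_prod tendsto_const)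
qed

text \<open>The image of Lebesgue measure under \<open>g\<close>, multiplied by the modulus of the
  determinant, has the right value on boxes: the preimage of a box is its image under
  \<open>inv g\<close>, whose volume factor is the reciprocal.\<close>

lemma integral_vol_factor_wo:
  fixes g :: "real^'m::{finite,wellorder} \<Rightarrow> real^'m::_" and f :: "real^'m::_ \<Rightarrow> 'b::euclidean_space"
  assumes g: "linear g" "inj g" and f[measurable]: "f \<in> borel_measurable borel"
  shows "(LINT x|lborel. f x) = \<bar>det (matrix g)\<bar> *\<^sub>R (LINT x|lborel. f (g x))"
proof -
  let ?d = "\<bar>det (matrix g)\<bar>"
  have gm[measurable]: "g \<in> borel_measurable borel"
    using g linear_continuous_on linear_linear by (blast intro: borel_measurable_continuous_onI)
  have d: "?d > 0" using g det_nz_iff_inj by auto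
  have surj: "surj g" using g linear_injective_imp_surjective by blast
  have linv: "linear (inv g)" using g inj_linear_imp_inv_linear by blast
  have dinv: "\<bar>det (matrix (inv g))\<bar> = 1 / ?d"
  proof -
    have "matrix g ** matrix (inv g) = matrix (g \<circ> inv g)"
      by (rule matrix_compose[OF linv g(1), symmetric])
    also have "g \<circ> inv g = id" using surj by (simp add: fun_eq_iff surj_f_inv_f)
    finally have "det (matrix g) * det (matrix (inv g)) = 1"
      by (metis det_I det_mul matrix_id_mat_1)
    then have "?d * \<bar>det (matrix (inv g))\<bar> = 1" by (metis abs_mult abs_one)
    then show ?thesis using d by (simp add: field_simps)
  qed
  have "lborel = density (distr lborel borel g) (\<lambda>_. ennreal ?d)"
  proof (rule lborel_eqI)
    fix l u :: "real^'m::_" assume le: "\<And>b. b \<in> Basis \<Longrightarrow> l \<bullet> b \<le> u \<bullet> b"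
    have box: "box l u \<in> lmeasurable" by simp
    have im: "g -` box l u = inv g ` box l u"
      using bij_vimage_eq_inv_image[OF bijI[OF g(2) surj]] .
    have "emeasure (density (distr lborel borel g) (\<lambda>_. ennreal ?d)) (box l u)
        = ennreal ?d * emeasure lborel (g -` box l u)"
      by (simp add: emeasure_density nn_integral_cmult emeasure_distr)
    also have "emeasure lborel (g -` box l u) = emeasure lebesgue (inv g ` box l u)"
      unfolding im[symmetric] using measurable_sets_borel[OF gm, of "box l u"]
      by (simp)
    also have "\<dots> = ennreal (measure lebesgue (inv g ` box l u))"
      using measurable_linear_image[OF linv box] by (rule emeasure_eq_measure2)
    also have "ennreal ?d * \<dots> = ennreal (measure lebesgue (box l u))"
      using d by (simp add: measure_linear_image[OF linv box] dinv ennreal_mult'[symmetric])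
    also have "\<dots> = ennreal (\<Prod>b\<in>Basis. (u - l) \<bullet> b)"
      using le by simp
    finally show "emeasure (density (distr lborel borel g) (\<lambda>_. ennreal ?d)) (box l u) = ennreal (\<Prod>b\<in>Basis. (u - l) \<bullet> b)" .
  qed simp
  then have "(LINT x|lborel. f x) = (LINT x|density (distr lborel borel g) (\<lambda>_. ennreal ?d). f x)"
    by (rule arg_cong)
  also have "\<dots> = (LINT x|distr lborel borel g. ?d *\<^sub>R f x)"
    by (rule integral_density) auto
  also have "\<dots> = ?d *\<^sub>R (LINT x|lborel. f (g x))"
    by (simp add: integral_distr)
  finally show ?thesis .
qed

lemma integral_vol_factor:
  fixes g :: "real^'n \<Rightarrow> real^'n" and f :: "real^'n \<Rightarrow> 'b::euclidean_space"
  assumes g: "linear g" "inj g" and f[measurable]: "f \<in> borel_measurable borel"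
  shows "(LINT x|lborel. f x) = vol_factor g *\<^sub>R (LINT x|lborel. f (g x))"
proof -
  have [measurable]: "g \<in> borel_measurable borel"
    using g linear_continuous_on linear_linear by (blast intro: borel_measurable_continuous_onI)
  have "inj (to_wo \<circ> g \<circ> of_wo)"
    using g(2) unfolding inj_def o_def by (metis to_wo_of_wo of_wo_to_wo)
  then have "(LINT y|lborel. f (of_wo y)) =
    vol_factor g *\<^sub>R (LINT y|lborel. f (of_wo ((to_wo \<circ> g \<circ> of_wo) y)))"
    unfolding vol_factor_def
    by (intro integral_vol_factor_wo linear_conj_wo g) measurable
  then show ?thesis
    by (subst (1 2) lborel_of_wo) (simp add: integral_distr)
qed

section \<open>Automorphisms of self-dual homogeneous cones\<close>

locale self_dual_homogeneous_cone = ip_space ip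
  for ip :: "real^'n \<Rightarrow> real^'n \<Rightarrow> real" +
  fixes C :: "(real^'n) set"
  assumes homogeneous: "homogeneous_cone C" and self_dual: "dual_cone ip C = C"
begin

abbreviation aut :: "(real^'n \<Rightarrow> real^'n) \<Rightarrow> bool" where "aut \<equiv> cone_automorphism C"

section \<open>Order geometry of the cone and its interior\<close>

lemma convex_cone: "convex_cone C" and closed: "closed C" and interior_nonempty: "interior C \<noteq> {}"
  using homogeneous unfolding homogeneous_cone_def regular_cone_def by auto

lemmas add_mem = convex_cone_add[OF convex_cone]
  and scale_mem = convex_cone_scaleR[OF convex_cone]
  and zero_mem = convex_cone_contains_0[OF convex_cone]

lemma convex: "convex C"
  using convex_cone by (simp add: convex_cone_def)

lemma pointedD: "x \<in> C \<Longrightarrow> - x \<in> C \<Longrightarrow> x = 0"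
  using homogeneous unfolding homogeneous_cone_def regular_cone_def pointed_def by blast

lemma ip_nonneg: "x \<in> C \<Longrightarrow> y \<in> C \<Longrightarrow> 0 \<le> ip x y"
  using self_dual unfolding dual_cone_def by blast

lemma memI: "(\<And>y. y \<in> C \<Longrightarrow> 0 \<le> ip x y) \<Longrightarrow> x \<in> C"
  using self_dual unfolding dual_cone_def by blast

lemma interior_mem: "x \<in> interior C \<Longrightarrow> x \<in> C"
  using interior_subset by blast

text \<open>Interior points are order units: a ball around \<open>e\<close> inside \<open>C\<close>,
  scaled by \<open>s\<close>, turns norm bounds into order bounds.\<close>

lemma absorb:
  assumes "e \<in> interior C"
  obtains \<epsilon> where "\<epsilon> > 0" "\<And>x s. norm x \<le> \<epsilon> * s \<Longrightarrow> s *\<^sub>R e + x \<in> C" "\<And>x s. norm x \<le> \<epsilon> * s \<Longrightarrow> s *\<^sub>R e - x \<in> C"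
proof -
  obtain \<epsilon> where \<epsilon>: "\<epsilon> > 0" "cball e \<epsilon> \<subseteq> C"
    using assms by (meson mem_interior_cball)
  have *: "s *\<^sub>R e + x \<in> C" if x: "norm x \<le> \<epsilon> * s" for x s
  proof (cases "s > 0")
    case True
    have "norm (x /\<^sub>R s) \<le> \<epsilon>" using True x by (simp add: field_simps)
    then have "e + x /\<^sub>R s \<in> C" using \<epsilon>(2) by (auto simp: dist_norm subset_eq)
    then have "s *\<^sub>R (e + x /\<^sub>R s) \<in> C" using True by (intro scale_mem) auto
    then show ?thesis using True by (simp add: scaleR_add_right)
  next
    \<comment> \<open>A nonpositive \<open>s\<close> satisfies the premise only if
      \<open>s = 0\<close> and \<open>x = 0\<close>.\<close>
    case False
    then have "\<epsilon> * s \<le> 0" using \<epsilon>(1) by (simp add: mult_nonneg_nonpos)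
    then have "norm x = 0" "\<epsilon> * s = 0" using x norm_ge_zero[of x] by linarith+
    then have "x = 0" "s = 0" using \<epsilon>(1) by auto
    then show ?thesis by (simp add: zero_mem)
  qed
  show ?thesis
    by (rule that[OF \<epsilon>(1) *]) (use *[of "- _"] in auto)
qed

text \<open>Pair \<open>x\<close> with \<open>norm x *\<^sub>R e - \<epsilon> *\<^sub>R x\<close>,
  which lies in \<open>C\<close> by \<open>absorb\<close>, and bound \<open>ip x x\<close> below by
  \<open>self_ge_norm\<close>.\<close>

lemma ip_interior_lower:
  assumes "e \<in> interior C"
  obtains \<kappa> where "\<kappa> > 0" "\<And>x. x \<in> C \<Longrightarrow> \<kappa> * norm x \<le> ip x e"
proof -
  obtain \<epsilon> where \<epsilon>: "\<epsilon> > 0" "\<And>x s. norm x \<le> \<epsilon> * s \<Longrightarrow> s *\<^sub>R e - x \<in> C"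
    using absorb[OF assms] by metis
  obtain c where c: "c > 0" "\<And>x. c * (norm x)\<^sup>2 \<le> ip x x" by (rule self_ge_norm) blast
  show ?thesis
  proof
    show "\<epsilon> * c > 0" using \<epsilon> c by simp
    fix x assume x: "x \<in> C"
    show "\<epsilon> * c * norm x \<le> ip x e"
    proof (cases "x = 0")
      case False
      have "norm x *\<^sub>R e - \<epsilon> *\<^sub>R x \<in> C" using \<epsilon> by simp
      from ip_nonneg[OF x this] have "\<epsilon> * ip x x \<le> norm x * ip x e"
        by (simp add: diff_right scaleR_right)
      moreover have "\<epsilon> * (c * (norm x)\<^sup>2) \<le> \<epsilon> * ip x x" using c(2) \<epsilon>(1) by simp
      ultimately have "norm x * (\<epsilon> * c * norm x) \<le> norm x * ip x e"
        by (simp add: power2_eq_square algebra_simps)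
      then show ?thesis using False by simp
    qed (simp add: zero_left)
  qed
qed

text \<open>Converse of \<open>ip_interior_lower\<close>: a point close to \<open>e\<close> still
  pairs nonnegatively with all of \<open>C\<close>, hence lies in \<open>C\<close> by
  self-duality.\<close>

lemma interiorI:
  assumes "\<kappa> > 0" and "\<And>x. x \<in> C \<Longrightarrow> \<kappa> * norm x \<le> ip x e"
  shows "e \<in> interior C"
proof -
  obtain K where K: "K > 0" "\<And>x y. norm (ip x y) \<le> norm x * norm y * K"
    using pos_bounded by blast
  have "ball e (\<kappa> / K) \<subseteq> C"
  proof
    fix w assume "w \<in> ball e (\<kappa> / K)"
    then have w: "norm (w - e) * K \<le> \<kappa>"
      using K(1) by (simp add: dist_norm norm_minus_commute field_simps)
    show "w \<in> C"
    proof (rule memI)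
      fix y assume y: "y \<in> C"
      have "\<bar>ip (w - e) y\<bar> \<le> norm y * (norm (w - e) * K)"
        using K(2)[of "w - e" y] by (simp add: algebra_simps)
      also have "\<dots> \<le> norm y * \<kappa>" using w by (intro mult_left_mono) auto
      also have "\<dots> \<le> ip e y" using assms(2)[OF y] commute[of e y] by (simp add: mult.commute)
      finally show "0 \<le> ip w y" by (simp add: diff_left)
    qed
  qed
  then show ?thesis using assms(1) K(1) by (meson mem_interior zero_less_divide_iff)
qed

lemma interior_pos: "e \<in> interior C \<Longrightarrow> x \<in> C \<Longrightarrow> x \<noteq> 0 \<Longrightarrow> 0 < ip x e"
  by (metis ip_interior_lower mult_pos_pos order_less_le_trans zero_less_norm_iff)

lemma interior_nonzero: "e \<in> interior C \<Longrightarrow> e \<noteq> 0"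
proof
  assume e: "e \<in> interior C" and "e = 0"
  then obtain \<epsilon> where "\<epsilon> > 0" "cball 0 \<epsilon> \<subseteq> C" by (meson mem_interior_cball)
  moreover obtain x :: "real^'n" where "norm x = \<epsilon>" by (rule vector_choose_size[of \<epsilon>]) (use \<open>\<epsilon> > 0\<close> in auto)
  ultimately have "x \<in> C" "- x \<in> C" by (auto simp: subset_eq)
  then have "x = 0" by (rule pointedD)
  with \<open>\<epsilon> > 0\<close> \<open>norm x = \<epsilon>\<close> show False by simp
qed

lemma interior_add: "e \<in> interior C \<Longrightarrow> x \<in> C \<Longrightarrow> x + e \<in> interior C"
proof -
  assume e: "e \<in> interior C" and x: "x \<in> C"
  obtain \<kappa> where "\<kappa> > 0" "\<And>y. y \<in> C \<Longrightarrow> \<kappa> * norm y \<le> ip y e"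
    using ip_interior_lower[OF e] by metis
  then show ?thesis
    by (intro interiorI[of \<kappa>]) (use ip_nonneg[OF _ x] in \<open>fastforce simp: add_right\<close>)+
qed

lemma interior_scale: "e \<in> interior C \<Longrightarrow> 0 < c \<Longrightarrow> c *\<^sub>R e \<in> interior C"
proof -
  assume e: "e \<in> interior C" and c: "0 < c"
  obtain \<kappa> where "\<kappa> > 0" "\<And>y. y \<in> C \<Longrightarrow> \<kappa> * norm y \<le> ip y e"
    using ip_interior_lower[OF e] by metis
  then show ?thesis
    by (intro interiorI[of "c * \<kappa>"]) (use c in \<open>auto simp: scaleR_right mult.assoc\<close>)
qed

lemma interior_ge: "e \<in> interior C \<Longrightarrow> 0 < c \<Longrightarrow> x - c *\<^sub>R e \<in> C \<Longrightarrow> x \<in> interior C"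
  using interior_add[OF interior_scale] by fastforce

lemma diff_mem_C: obtains x' x'' where "x' \<in> C" "x'' \<in> C" "x = x' - x''"
proof -
  obtain e where e: "e \<in> interior C" using interior_nonempty by blast
  obtain \<epsilon> where \<epsilon>: "\<epsilon> > 0" "\<And>x s. norm x \<le> \<epsilon> * s \<Longrightarrow> s *\<^sub>R e + x \<in> C"
    using absorb[OF e] by metis
  have "(norm x / \<epsilon>) *\<^sub>R e + x \<in> C" "(norm x / \<epsilon>) *\<^sub>R e \<in> C"
    using \<epsilon> by (auto intro!: scale_mem interior_mem[OF e])
  then show ?thesis by (rule that) simp
qed

text \<open>Every \<open>x\<close> lies between \<open>- s *\<^sub>R a\<close> and
  \<open>s *\<^sub>R a\<close> for \<open>s = norm x / \<epsilon>\<close>, so \<open>g x\<close>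
  lies between the corresponding multiples of \<open>g a\<close>. A single number
  \<open>ip (g a) e\<close> thus controls the operator norm of a cone-preserving map.\<close>

lemma op_bound:
  assumes a: "a \<in> interior C" and e: "e \<in> interior C"
  obtains K where "K > 0"
    "\<And>g (x :: real^'n). linear g \<Longrightarrow> g ` C \<subseteq> C \<Longrightarrow> norm (g x) \<le> K * ip (g a) e * norm x"
proof -
  obtain \<epsilon> where \<epsilon>: "\<epsilon> > 0" "\<And>x s. norm x \<le> \<epsilon> * s \<Longrightarrow> s *\<^sub>R a + x \<in> C"
    "\<And>x s. norm x \<le> \<epsilon> * s \<Longrightarrow> s *\<^sub>R a - x \<in> C"
    using absorb[OF a] by metis
  obtain \<kappa> where \<kappa>: "\<kappa> > 0" "\<And>x. x \<in> C \<Longrightarrow> \<kappa> * norm x \<le> ip x e"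
    using ip_interior_lower[OF e] by metis
  show ?thesis
  proof
    show "1 / (\<epsilon> * \<kappa>) > 0" using \<epsilon> \<kappa> by simp
    fix g :: "real^'n \<Rightarrow> real^'n" and x :: "real^'n" assume g: "linear g" "g ` C \<subseteq> C"
    define s where "s = norm x / \<epsilon>"
    have "norm x \<le> \<epsilon> * s" using \<epsilon>(1) by (simp add: s_def)
    then have "g (s *\<^sub>R a + x) \<in> C" "g (s *\<^sub>R a - x) \<in> C" using \<epsilon> g(2) by blast+
    then have mem: "s *\<^sub>R g a + g x \<in> C" "s *\<^sub>R g a - g x \<in> C"
      by (simp_all add: linear_add linear_diff linear_cmul g(1))
    have "(s *\<^sub>R g a + g x) - (s *\<^sub>R g a - g x) = 2 *\<^sub>R g x" by (simp add: scaleR_2)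
    then have "2 * norm (g x) \<le> norm (s *\<^sub>R g a + g x) + norm (s *\<^sub>R g a - g x)"
      by (metis norm_scaleR abs_numeral norm_triangle_ineq4)
    then have "\<kappa> * (2 * norm (g x)) \<le> \<kappa> * (norm (s *\<^sub>R g a + g x) + norm (s *\<^sub>R g a - g x))"
      using \<kappa>(1) by simp
    also have "\<dots> \<le> 2 * s * ip (g a) e"
      using \<kappa>(2)[OF mem(1)] \<kappa>(2)[OF mem(2)]
      by (simp add: distrib_left add_left diff_left scaleR_left)
    finally have "\<kappa> * norm (g x) \<le> norm x * ip (g a) e / \<epsilon>" by (simp add: s_def)
    then show "norm (g x) \<le> 1 / (\<epsilon> * \<kappa>) * ip (g a) e * norm x"
      using \<epsilon>(1) \<kappa>(1) by (simp add: field_simps)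
  qed
qed

section \<open>The automorphism group, its adjoints and its limits\<close>

lemma aut_linear: "aut g \<Longrightarrow> linear g" and aut_bij: "aut g \<Longrightarrow> bij g"
  and aut_image: "aut g \<Longrightarrow> g ` C = C"
  by (simp_all add: cone_automorphism_def)

lemma aut_inj: "aut g \<Longrightarrow> inj g"
  by (simp add: aut_bij bij_is_inj)

lemma aut_mem: "aut g \<Longrightarrow> x \<in> C \<Longrightarrow> g x \<in> C"
  using aut_image by blast

lemma aut_mem_iff: "aut g \<Longrightarrow> g x \<in> C \<longleftrightarrow> x \<in> C"
  by (metis aut_image aut_inj inj_image_mem_iff)

lemma autI:
  assumes "linear g" "\<And>x. g (h x) = x" "\<And>x. h (g x) = x" "\<And>x. x \<in> C \<Longrightarrow> g x \<in> C" "\<And>x. x \<in> C \<Longrightarrow> h x \<in> C"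
  shows "aut g"
  unfolding cone_automorphism_def
proof (intro conjI assms)
  show "bij g" by (rule o_bij[of h]) (auto simp: assms)
  show "g ` C = C" using assms(2,4,5) by (auto simp: image_iff) metis
qed

lemma aut_inv_f [simp]: "aut g \<Longrightarrow> inv g (g x) = x"
  by (simp add: aut_inj)

lemma aut_f_inv [simp]: "aut g \<Longrightarrow> g (inv g x) = x"
  using aut_bij bij_is_surj surj_f_inv_f by metis

lemma aut_inv: assumes "aut g" shows "aut (inv g)"
proof (rule autI[where h = g])
  show "linear (inv g)" using inj_linear_imp_inv_linear[OF aut_linear aut_inj] assms by blast
  show "inv g x \<in> C" if "x \<in> C" for x using that aut_mem_iff[OF assms, of "inv g x"] assms by simp
qed (use assms in \<open>auto intro: aut_mem\<close>)

lemma aut_id: "aut (\<lambda>x. x)"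
  by (rule autI[where h = "\<lambda>x. x"]) (auto intro: linear_id[unfolded id_def])

lemma aut_comp: assumes "aut f" "aut g" shows "aut (\<lambda>x. f (g x))"
  by (rule autI[where h = "\<lambda>x. inv g (inv f x)"])
    (use assms linear_compose[OF aut_linear aut_linear] in \<open>auto simp: o_def aut_mem aut_inv\<close>)

lemma aut_scale: assumes "aut g" "0 < c" shows "aut (\<lambda>x. c *\<^sub>R g x)"
proof (rule autI[where h = "\<lambda>x. inv g (x /\<^sub>R c)"])
  show "linear (\<lambda>x. c *\<^sub>R g x)" using aut_linear[OF assms(1)] by (rule linear_compose_scale_right)
  show "c *\<^sub>R g x \<in> C" "inv g (x /\<^sub>R c) \<in> C" if "x \<in> C" for x
    using that assms by (simp_all add: aut_mem scale_mem aut_inv)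
qed (use assms in simp_all)

text \<open>Here self-duality enters: \<open>adj g x\<close> pairs with \<open>y\<close> as
  \<open>x\<close> pairs with \<open>g y\<close>.\<close>

lemma aut_adj_mem: "aut g \<Longrightarrow> x \<in> C \<Longrightarrow> adj g x \<in> C"
  by (rule memI) (simp add: adj' aut_linear aut_mem ip_nonneg)

lemma adj_inv: assumes "aut g"
  shows "adj (inv g) (adj g x) = x" "adj g (adj (inv g) x) = x"
  by (rule eqI, simp add: adj[symmetric] aut_linear aut_inv assms)+

lemma aut_adj: assumes "aut g" shows "aut (adj g)"
  by (rule autI[where h = "adj (inv g)"])
    (use assms in \<open>auto simp: adj_inv aut_adj_mem aut_inv linear_adj aut_linear\<close>)

lemma inv_adj: assumes "aut g" shows "inv (adj g) = adj (inv g)"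
  by (rule inv_equality) (simp_all add: adj_inv assms)

lemma aut_interior: assumes "aut g" "x \<in> interior C" shows "g x \<in> interior C"
proof -
  have "g ` interior C = interior (g ` C)"
    using interior_injective_linear_image[OF aut_linear aut_inj] assms(1) by metis
  then show ?thesis using assms(2) aut_image[OF assms(1)] by auto
qed

lemma aut_transitive:
  assumes "x \<in> interior C" "y \<in> interior C" obtains g where "aut g" "g x = y"
  using homogeneous assms unfolding homogeneous_cone_def by blast

lemma aut_limit:
  assumes "\<And>k. aut (g k)" "\<And>x. (\<lambda>k. g k x) \<longlonglongrightarrow> h x" "linear h" "inj h"
  shows "aut h"
proof -
  have surj: "surj h" using assms linear_injective_imp_surjective by blast
  have int: "x \<in> C" if "h x \<in> interior C" for x
  proof -
    have "\<forall>\<^sub>F k in sequentially. g k x \<in> interior C"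
      using topological_tendstoD[OF assms(2) open_interior that] .
    then obtain k where "g k x \<in> interior C" by (meson eventually_happens' sequentially_bot)
    then show ?thesis using aut_mem_iff[OF assms(1)] interior_mem by blast
  qed
  have inv_mem: "x \<in> C" if "h x \<in> C" for x
  proof -
    obtain e' where e': "h e' \<in> interior C" using surj interior_nonempty by (metis ex_in_conv surjD)
    have "x + inverse (real (Suc k)) *\<^sub>R e' \<in> C" for k
      by (rule int) (use that e' in \<open>simp add: linear_add linear_cmul assms(3) interior_add interior_scale\<close>)
    moreover have "(\<lambda>k. x + inverse (real (Suc k)) *\<^sub>R e') \<longlonglongrightarrow> x + 0 *\<^sub>R e'"
      by (intro tendsto_add tendsto_const tendsto_scaleR LIMSEQ_inverse_real_of_nat)
    ultimately have "x + 0 *\<^sub>R e' \<in> C" by (rule closed_sequentially[OF closed])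
    then show ?thesis by simp
  qed
  show ?thesis
  proof (rule autI[where h = "inv h"])
    show "h x \<in> C" if "x \<in> C" for x
      by (rule closed_sequentially[OF closed aut_mem[OF assms(1) that] assms(2)])
    show "inv h x \<in> C" if "x \<in> C" for x
      using inv_mem[of "inv h x"] that by (simp add: surj_f_inv_f[OF surj])
  qed (use assms surj in \<open>auto simp: surj_f_inv_f\<close>)
qed

text \<open>
  A top eigenvector \<open>z\<close> of \<open>L\<close> lies in a smallest order interval \<open>[-se, se]\<close>, which \<open>L\<close> maps into
  \<open>[-sce, sce]\<close>; so the eigenvalue of \<open>z\<close> is at most \<open>c\<close>.
\<close>

lemma self_adjoint_le:
  assumes L: "aut L" "\<And>x y. ip (L x) y = ip x (L y)" and e: "e \<in> interior C" and le: "c *\<^sub>R e - L e \<in> C"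
  shows "ip (L x) x \<le> c * ip x x"
proof -
  note lin = aut_linear[OF L(1)]
  obtain k where k: "k > 0" "\<And>x. k * (norm x)\<^sup>2 \<le> ip x x" by (rule self_ge_norm) blast
  let ?S = "{x. ip x x = 1}"
  have cont: "continuous_on UNIV (\<lambda>x. ip (f x) x)" if "linear f" for f
    using that by (intro continuous_on continuous_on_id linear_continuous_on) (simp add: linear_linear)
  have "compact ?S"
    unfolding compact_eq_bounded_closed
  proof
    have "norm x \<le> 1 + 1 / k" if "x \<in> ?S" for x
    proof (rule ccontr)
      assume "\<not> norm x \<le> 1 + 1 / k"
      then have *: "1 + 1 / k < norm x" by simp
      then have "k * (1 + 1 / k) < k * norm x" using k(1) by (rule mult_strict_left_mono)
      then have "1 < k * norm x" using k(1) by (simp add: distrib_left)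
      moreover have "0 < 1 / k" using k(1) by simp
      with * have "1 < norm x" by linarith
      ultimately have "1 * 1 < (k * norm x) * norm x" by (intro mult_strict_mono) auto
      then show False using k(2)[of x] that by (simp add: power2_eq_square mult.assoc)
    qed
    then show "bounded ?S" unfolding bounded_iff by blast
    have "closed ((\<lambda>x. ip x x) -` {1})"
      using cont[OF linear_id[unfolded id_def]] by (intro closed_vimage) (auto simp: continuous_on_eq_continuous_at)
    then show "closed ?S" by (simp add: vimage_def)
  qed
  moreover have "?S \<noteq> {}"
  proof -
    have "ip (e /\<^sub>R sqrt (ip e e)) (e /\<^sub>R sqrt (ip e e)) = 1"
      using self_pos[OF interior_nonzero[OF e]] interior_nonzero[OF e]
      by (simp add: scaleR_left scaleR_right field_simps)
    then show ?thesis by blast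
  qed
  ultimately obtain z where z: "ip z z = 1" "\<And>y. ip y y = 1 \<Longrightarrow> ip (L y) y \<le> ip (L z) z"
    using continuous_attains_sup[of ?S "\<lambda>x. ip (L x) x"] cont[OF lin] continuous_on_subset by blast
  define \<mu> where "\<mu> = ip (L z) z"
  have Rayleigh: "ip (L y) y \<le> \<mu> * ip y y" for y
  proof (cases "y = 0")
    case False
    note pos = self_pos[OF False]
    have "ip (y /\<^sub>R sqrt (ip y y)) (y /\<^sub>R sqrt (ip y y)) = 1"
      using pos False by (simp add: scaleR_left scaleR_right field_simps)
    then have "ip (L (y /\<^sub>R sqrt (ip y y))) (y /\<^sub>R sqrt (ip y y)) \<le> \<mu>" unfolding \<mu>_def by (rule z)
    then show ?thesis using pos
      by (simp add: scaleR_left scaleR_right linear_cmul[OF lin] field_simps)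
  qed (simp add: zero_left zero_right linear_0 lin)
  have "L z = \<mu> *\<^sub>R z"
  proof (rule eqI)
    fix y
    define d where "d = \<mu> * ip z y - ip (L z) y"
    define q where "q = \<mu> * ip y y - ip (L y) y"
    have "0 \<le> 2 * t * d + q" for t
    proof -
      have "ip y z = ip z y" "ip (L y) z = ip (L z) y" using commute L(2) by metis+
      then have "\<mu> * ip (t *\<^sub>R z + y) (t *\<^sub>R z + y) - ip (L (t *\<^sub>R z + y)) (t *\<^sub>R z + y) = 2 * t * d + q"
        by (simp add: d_def q_def add_left add_right scaleR_left scaleR_right linear_add linear_cmul lin z(1) \<mu>_def[symmetric] algebra_simps)
      then show ?thesis using Rayleigh[of "t *\<^sub>R z + y"] by linarith
    qed
    \<comment> \<open>If \<open>d\<close> were nonzero, this value of \<open>t\<close> would make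
      \<open>2 * t * d + q\<close> equal to -1.\<close>
    from this[of "- (q + 1) / (2 * d)"] have "d = 0" by (cases "d = 0") (auto simp: field_simps)
    then show "ip y (L z) = ip y (\<mu> *\<^sub>R z)" by (simp add: d_def scaleR_right commute[of y])
  qed
  have "0 < ip (L e) e" using interior_pos[OF e] aut_interior[OF L(1) e] interior_nonzero interior_mem by blast
  moreover have "0 \<le> ip (c *\<^sub>R e - L e) e" by (rule ip_nonneg[OF le interior_mem[OF e]])
  ultimately have "0 < c * ip e e" by (simp add: diff_left scaleR_left)
  then have c: "0 < c" using self_nonneg[of e] by (simp add: zero_less_mult_iff)
  have "\<mu> \<le> c"
  proof (cases "\<mu> > 0")
    case True
    let ?T = "{s. s *\<^sub>R e + z \<in> C \<and> s *\<^sub>R e - z \<in> C}"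
    have T0: "0 \<le> s" if "s \<in> ?T" for s
    proof -
      have "(s *\<^sub>R e + z) + (s *\<^sub>R e - z) \<in> C" using that by (blast intro: add_mem)
      moreover have "(s *\<^sub>R e + z) + (s *\<^sub>R e - z) = (2 * s) *\<^sub>R e"
        unfolding mult_2 scaleR_add_left by simp
      ultimately have "(2 * s) *\<^sub>R e \<in> C" by simp
      from ip_nonneg[OF this interior_mem[OF e]] show ?thesis
        using self_pos[OF interior_nonzero[OF e]] by (simp add: scaleR_left zero_le_mult_iff)
    qed
    obtain \<epsilon> where "\<epsilon> > 0" "\<And>x s. norm x \<le> \<epsilon> * s \<Longrightarrow> s *\<^sub>R e + x \<in> C"
      "\<And>x s. norm x \<le> \<epsilon> * s \<Longrightarrow> s *\<^sub>R e - x \<in> C" using absorb[OF e] by metis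
    then have "norm z / \<epsilon> \<in> ?T" by auto
    moreover have "closed ?T"
    proof -
      have "?T = (\<lambda>s. s *\<^sub>R e + z) -` C \<inter> (\<lambda>s. s *\<^sub>R e - z) -` C" by auto
      then show ?thesis by (auto intro!: closed_Int closed_vimage closed continuous_intros)
    qed
    moreover have bdd: "bdd_below ?T" using T0 by (meson bdd_belowI)
    ultimately have inf: "Inf ?T \<in> ?T" by (intro closed_contains_Inf) auto
    let ?s = "Inf ?T"
    have "?s \<noteq> 0"
    proof
      assume "?s = 0"
      with inf have "z \<in> C" "- z \<in> C" by auto
      then show False using pointedD z(1) by (metis zero_left zero_neq_one)
    qed
    with T0[OF inf] have s: "?s > 0" by simp
    \<comment> \<open>Adding the third element to each of the first two replaces \<open>L e\<close>
      by \<open>c *\<^sub>R e\<close>. Division by \<open>\<mu>\<close> then puts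
      \<open>?s * c / \<mu>\<close> into \<open>?T\<close>, to be compared with the least element
      \<open>?s\<close>.\<close>
    have "L (?s *\<^sub>R e + z) \<in> C" "L (?s *\<^sub>R e - z) \<in> C" "?s *\<^sub>R (c *\<^sub>R e - L e) \<in> C"
      using inf s by (auto intro!: aut_mem[OF L(1)] scale_mem[OF _ le])
    from add_mem[OF this(1,3)] add_mem[OF this(2,3)]
    have "(?s * c) *\<^sub>R e + \<mu> *\<^sub>R z \<in> C" "(?s * c) *\<^sub>R e - \<mu> *\<^sub>R z \<in> C"
      by (simp_all add: linear_add linear_diff linear_cmul lin \<open>L z = \<mu> *\<^sub>R z\<close> algebra_simps)
    then have "(1 / \<mu>) *\<^sub>R ((?s * c) *\<^sub>R e + \<mu> *\<^sub>R z) \<in> C" "(1 / \<mu>) *\<^sub>R ((?s * c) *\<^sub>R e - \<mu> *\<^sub>R z) \<in> C"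
      using True by (auto intro!: scale_mem)
    then have "?s * c / \<mu> \<in> ?T" using True by (simp add: algebra_simps)
    then have "?s \<le> ?s * c / \<mu>" by (rule cInf_lower[OF _ bdd])
    then show ?thesis using True s by (simp add: field_simps)
  qed (use c in simp)
  then have "\<mu> * ip x x \<le> c * ip x x" by (intro mult_right_mono self_nonneg)
  with Rayleigh[of x] show ?thesis by linarith
qed

text \<open>The order bounds at the single point \<open>e\<close> bound the quadratic forms of
  \<open>L\<close> and of \<open>inv L\<close> by \<open>self_adjoint_le\<close>; Cauchy-Schwarz
  turns the bound on the inverse into a lower bound for \<open>L\<close>. Polarization then passes
  from the quadratic form of \<open>L - id\<close> to its operator norm.\<close>

lemma near_id:
  assumes g: "aut g" and d: "d > 0" and e: "e \<in> interior C" and \<delta>: "0 < \<delta>" "\<delta> < 1"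
    and upper: "(1 + \<delta>) *\<^sub>R e - d *\<^sub>R g (adj g e) \<in> C" and lower: "d *\<^sub>R g (adj g e) - (1 - \<delta>) *\<^sub>R e \<in> C"
  shows "ip (d *\<^sub>R g (adj g x) - x) (d *\<^sub>R g (adj g x) - x) \<le> \<delta>\<^sup>2 * ip x x"
proof -
  define L where "L = (\<lambda>x. d *\<^sub>R g (adj g x))"
  note glin = aut_linear[OF g]
  have L: "aut L" unfolding L_def by (rule aut_scale[OF aut_comp[OF g aut_adj[OF g]] d])
  note lin = aut_linear[OF L]
  have B: "ip (L x) y = d * ip (adj g x) (adj g y)" for x y
    by (simp add: L_def scaleR_left adj glin)
  have sa: "ip (L x) y = ip x (L y)" for x y
    using B commute by metis
  have up: "ip (L x) x \<le> (1 + \<delta>) * ip x x" for x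
    using self_adjoint_le[OF L sa e] upper by (simp add: L_def)
  have sai: "ip (inv L x) y = ip x (inv L y)" for x y
    using sa[of "inv L x" "inv L y"] L by simp
  have "inv L ((1 / (1 - \<delta>)) *\<^sub>R (L e - (1 - \<delta>) *\<^sub>R e)) \<in> C"
    using lower \<delta> by (intro aut_mem[OF aut_inv[OF L]] scale_mem) (auto simp: L_def)
  then have "(1 / (1 - \<delta>)) *\<^sub>R e - inv L e \<in> C"
    using \<delta> L by (simp add: linear_cmul linear_diff aut_linear aut_inv scaleR_diff_right)
  from self_adjoint_le[OF aut_inv[OF L] sai e this]
  have upi: "ip (inv L x) x \<le> 1 / (1 - \<delta>) * ip x x" for x .
  have low: "(1 - \<delta>) * ip x x \<le> ip (L x) x" for x
  proof (cases "x = 0")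
    case False
    define y where "y = inv L x"
    have y: "L y = x" using L by (simp add: y_def)
    have "ip x x = d * ip (adj g x) (adj g y)" using B[of x y] sa[of x y] y by simp
    then have "(ip x x)\<^sup>2 = d * d * (ip (adj g x) (adj g y))\<^sup>2" by (simp add: power2_eq_square)
    also have "\<dots> \<le> d * d * (ip (adj g x) (adj g x) * ip (adj g y) (adj g y))"
      by (intro mult_left_mono Cauchy_Schwarz) auto
    also have "\<dots> = ip (L x) x * ip (L y) y" by (simp add: B)
    also have "ip (L y) y = ip (inv L x) x" using y y_def commute by metis
    also have "ip (L x) x * ip (inv L x) x \<le> ip (L x) x * (1 / (1 - \<delta>) * ip x x)"
      using d by (intro mult_left_mono upi) (auto simp: B intro: mult_nonneg_nonneg self_nonneg)
    finally have "ip x x * ((1 - \<delta>) * ip x x) \<le> ip x x * ip (L x) x"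
      using \<delta> by (simp add: power2_eq_square field_simps)
    then show ?thesis using self_pos[OF False] by simp
  qed (simp add: zero_left zero_right)
  define D where "D x = L x - x" for x
  have q: "\<bar>ip (D x) x\<bar> \<le> \<delta> * ip x x" for x
    using up[of x] low[of x] by (simp add: D_def diff_left algebra_simps abs_le_iff)
  have D_add: "D (u + v) = D u + D v" and D_diff: "D (u - v) = D u - D v" for u v
    by (simp_all add: D_def linear_add linear_diff lin)
  \<comment> \<open>This scaling optimizes the polarization inequality
    \<open>4 * t * ?n \<le> 2 * \<delta> * (ip x x + t\<^sup>2 * ?n)\<close>.\<close>
  define t where "t = 1 / \<delta>"
  let ?n = "ip (D x) (D x)" and ?y = "t *\<^sub>R D x"
  have "ip (D ?y) x = ip (D x) ?y"
    unfolding D_def diff_left diff_right using sa commute by metis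
  then have "4 * (t * ?n) = ip (D (x + ?y)) (x + ?y) - ip (D (x - ?y)) (x - ?y)"
    by (simp add: D_add D_diff add_left add_right diff_left diff_right scaleR_right algebra_simps)
  also have "\<dots> \<le> \<delta> * ip (x + ?y) (x + ?y) + \<delta> * ip (x - ?y) (x - ?y)"
    using q[of "x + ?y"] q[of "x - ?y"] by linarith
  also have "\<dots> = 2 * \<delta> * (ip x x + t\<^sup>2 * ?n)"
    by (simp add: add_left add_right diff_left diff_right scaleR_left scaleR_right power2_eq_square algebra_simps)
  finally have "?n \<le> \<delta>\<^sup>2 * ip x x"
    using \<delta> by (simp add: t_def field_simps power2_eq_square)
  then show ?thesis by (simp add: D_def L_def)
qed

section \<open>Compactness for cone-preserving maps\<close>

lemma cone_maps_seq_compact: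
  fixes g :: "nat \<Rightarrow> real^'n \<Rightarrow> real^'n"
  assumes "\<And>k. linear (g k)" "\<And>k. g k ` C \<subseteq> C" "a \<in> interior C" "e \<in> interior C" "\<And>k. ip (g k a) e \<le> c"
  obtains r h B where "strict_mono r" "linear h" "\<And>x. (\<lambda>k. g (r k) x) \<longlonglongrightarrow> h x" "h ` C \<subseteq> C"
    "\<And>k x. norm (g k x) \<le> B * norm x"
proof -
  obtain K where K: "K > 0"
    "\<And>g (x :: real^'n). linear g \<Longrightarrow> g ` C \<subseteq> C \<Longrightarrow> norm (g x) \<le> K * ip (g a) e * norm x"
    using op_bound[OF assms(3,4)] by metis
  have B: "norm (g k x) \<le> K * c * norm x" for k x
  proof -
    have "norm (g k x) \<le> K * ip (g k a) e * norm x" by (intro K assms)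
    also have "\<dots> \<le> K * c * norm x" using assms(5) K(1) by (intro mult_right_mono mult_left_mono) auto
    finally show ?thesis .
  qed
  obtain r h where rh: "strict_mono r" "linear h" "\<And>x. (\<lambda>k. g (r k) x) \<longlonglongrightarrow> h x"
    by (rule linear_seq_compact[of g, OF assms(1) B]) (erule (1) that)
  have "h x \<in> C" if "x \<in> C" for x
    by (rule closed_sequentially[OF closed _ rh(3)]) (use assms(2) that in blast)
  then show ?thesis by (intro that[OF rh _ B]) blast
qed

text \<open>Bounding the inverse adjoints as well keeps the limit invertible: the limits
  \<open>h\<close> and \<open>f\<close> of the two sequences satisfy
  \<open>ip (h x) (f y) = ip x y\<close>, which forces \<open>h\<close> to be injective and
  \<open>f\<close> to be its inverse adjoint.\<close>

lemma aut_seq_compact: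
  fixes g :: "nat \<Rightarrow> real^'n \<Rightarrow> real^'n"
  assumes "\<And>k. aut (g k)" "a \<in> interior C" "b \<in> interior C" "e \<in> interior C"
    "\<And>k. ip (g k a) e \<le> c" "\<And>k. ip (adj (inv (g k)) b) e \<le> c'"
  obtains r h where "strict_mono r" "aut h" "\<And>x. (\<lambda>k. g (r k) x) \<longlonglongrightarrow> h x"
    "\<And>x. (\<lambda>k. adj (inv (g (r k))) x) \<longlonglongrightarrow> adj (inv h) x"
proof -
  have sub: "f ` C \<subseteq> C" if "aut f" for f using aut_image[OF that] by simp
  have aut_g': "aut (adj (inv (g k)))" for k by (intro aut_adj aut_inv assms)
  obtain r h where rh: "strict_mono r" "linear h" "\<And>x. (\<lambda>k. g (r k) x) \<longlonglongrightarrow> h x"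
    by (rule cone_maps_seq_compact[of g, OF aut_linear[OF assms(1)] sub[OF assms(1)] assms(2,4,5)]) (erule (1) that)
  obtain s f where sf: "strict_mono s" "linear f" "\<And>x. (\<lambda>k. adj (inv (g (r (s k)))) x) \<longlonglongrightarrow> f x"
    by (rule cone_maps_seq_compact[of "\<lambda>k. adj (inv (g (r k)))", OF aut_linear[OF aut_g'] sub[OF aut_g'] assms(3,4,6)])
      (erule (1) that)
  have gh: "(\<lambda>k. g (r (s k)) x) \<longlonglongrightarrow> h x" for x
    using LIMSEQ_subseq_LIMSEQ[OF rh(3) sf(1)] by (simp add: o_def)
  have "ip (g k x) (adj (inv (g k)) y) = ip x y" for k x y
    using assms(1) by (simp add: adj[symmetric] aut_linear aut_inv)
  then have hf: "ip (h x) (f y) = ip x y" for x y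
    using tendsto[OF gh[of x] sf(3)[of y]] by (simp add: tendsto_const_iff)
  have "inj h"
    unfolding linear_injective_0[OF rh(2)] by (metis hf self_eq_0_iff zero_left)
  then have h: "aut h" using aut_limit[OF assms(1) rh(3,2)] by blast
  have "f y = adj (inv h) y" for y
  proof (rule eqI)
    show "ip x (f y) = ip x (adj (inv h) y)" for x
      using hf[of "inv h x" y] h by (simp add: adj[symmetric] aut_linear aut_inv)
  qed
  then show ?thesis
    using that[of "r \<circ> s" h] rh(1) sf h gh by (simp add: strict_mono_o)
qed

subsection \<open>Extremal vectors\<close>

text \<open>Generators of extreme rays in order-theoretic form: the order interval from 0 to
  \<open>v\<close> contains only multiples of \<open>v\<close>. Automorphisms visibly preserve this,
  and \<open>rank_one_limit\<close> applies it directly.\<close>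

definition extremal :: "real^'n \<Rightarrow> bool" where
  "extremal v \<longleftrightarrow> v \<in> C \<and> v \<noteq> 0 \<and> (\<forall>y\<in>C. v - y \<in> C \<longrightarrow> (\<exists>\<rho>. y = \<rho> *\<^sub>R v))"

lemma extremal_aut: assumes "aut g" "extremal v" shows "extremal (g v)"
  unfolding extremal_def
proof (intro conjI ballI impI)
  note lin = aut_linear[OF assms(1)]
  show "g v \<in> C" "g v \<noteq> 0"
    using assms aut_inj[OF assms(1)] by (auto simp: extremal_def aut_mem linear_injective_0[OF lin])
  fix y assume y: "y \<in> C" "g v - y \<in> C"
  have "inv g y \<in> C" using y assms(1) by (simp add: aut_inv aut_mem)
  moreover have "inv g (g v - y) \<in> C" using y assms(1) by (simp add: aut_inv aut_mem)
  then have "v - inv g y \<in> C" using assms(1) by (simp add: linear_diff aut_linear aut_inv)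
  ultimately obtain \<rho> where "inv g y = \<rho> *\<^sub>R v" using assms(2) by (auto simp: extremal_def)
  then have "y = \<rho> *\<^sub>R g v" using assms(1) by (metis aut_f_inv lin linear_cmul)
  then show "\<exists>\<rho>. y = \<rho> *\<^sub>R g v" ..
qed

text \<open>\<open>v\<close> is the midpoint of \<open>2 *\<^sub>R y\<close> and
  \<open>2 *\<^sub>R (v - y)\<close>, so the face property puts \<open>2 *\<^sub>R y\<close> on the
  ray unless the two endpoints coincide.\<close>

lemma extreme_ray_imp_extremal:
  assumes "extreme_ray_of R C" "v \<in> R" "v \<noteq> 0"
  shows "extremal v"
proof -
  obtain p where p: "R = conic hull {p}" "R face_of C" using assms(1) by (auto simp: extreme_ray_of_def)
  obtain c where c: "v = c *\<^sub>R p" "0 \<le> c" using assms(2) p(1) by (auto simp: conic_hull_explicit)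
  have "c \<noteq> 0" using c assms(3) by auto
  have "v \<in> C" using p(2) assms(2) face_of_imp_subset by blast
  moreover have "\<exists>\<rho>. y = \<rho> *\<^sub>R v" if y: "y \<in> C" "v - y \<in> C" for y
  proof (cases "2 *\<^sub>R y = 2 *\<^sub>R (v - y)")
    case True
    then have "y = v - y" by simp
    then have "v = 2 *\<^sub>R y" by (simp add: scaleR_2 eq_diff_eq)
    then have "y = (1/2) *\<^sub>R v" by simp
    then show ?thesis ..
  next
    case False
    have "v \<in> open_segment (2 *\<^sub>R y) (2 *\<^sub>R (v - y))"
      using False unfolding in_segment
      by (intro conjI exI[of _ "1/2"]) (auto simp: algebra_simps)
    then have "2 *\<^sub>R y \<in> R"
      using face_ofD[OF p(2) _ _ _ assms(2)] y by (meson scale_mem zero_le_numeral)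
    then obtain t where "2 *\<^sub>R y = t *\<^sub>R p" using p(1) by (auto simp: conic_hull_explicit)
    from arg_cong[OF this, of "scaleR (1/2)"] have "y = (1/2) *\<^sub>R (t *\<^sub>R p)" by simp
    then have "y = (t / (2 * c)) *\<^sub>R v" using c(1) \<open>c \<noteq> 0\<close> by simp
    then show ?thesis ..
  qed
  ultimately show ?thesis using assms(3) by (simp add: extremal_def)
qed

text \<open>Guarantees that the \<open>LEAST\<close> in \<open>caratheodory_number\<close> is
  attained. The slice \<open>S\<close> is a compact base of the cone, its extreme points generate
  extreme rays, and Krein-Milman with Caratheodory's theorem bounds the number of summands.\<close>

lemma ex_sum_extreme_rays:
  "\<exists>k. \<forall>x\<in>C. \<exists>vs. length vs \<le> k \<and> (\<forall>v\<in>set vs. \<exists>R. extreme_ray_of R C \<and> v \<in> R) \<and> x = sum_list vs"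
proof -
  obtain e where e: "e \<in> interior C" using interior_nonempty by blast
  obtain \<kappa> where \<kappa>: "\<kappa> > 0" "\<And>x. x \<in> C \<Longrightarrow> \<kappa> * norm x \<le> ip x e"
    using ip_interior_lower[OF e] by metis
  define S where "S = {x \<in> C. ip x e = 1}"
  have "compact S"
    unfolding compact_eq_bounded_closed
  proof
    have "norm x \<le> 1 / \<kappa>" if "x \<in> S" for x
      using \<kappa>(2)[of x] \<kappa>(1) that by (simp add: S_def field_simps)
    then show "bounded S" unfolding bounded_iff by blast
    have "S = C \<inter> (\<lambda>x. ip x e) -` {1}" by (auto simp: S_def)
    moreover have "closed ((\<lambda>x. ip x e) -` {1})"
      by (intro closed_vimage continuous_on continuous_on_id continuous_on_const) auto
    ultimately show "closed S" using closed by (simp add: closed_Int)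
  qed
  moreover have "convex S"
    using convex unfolding S_def convex_def by (auto simp: add_left scaleR_left)
  ultimately have KM: "S = convex hull {x. x extreme_point_of S}"
    by (rule Krein_Milman_Minkowski)
  have ray: "extreme_ray_of (conic hull {p}) C" if p: "p extreme_point_of S" for p
    unfolding extreme_ray_of_def
  proof
    have pS: "p \<in> C" "ip p e = 1" using p by (auto simp: extreme_point_of_def S_def)
    then have "p \<noteq> 0" by (auto simp: zero_left)
    then show "\<exists>x. x \<noteq> 0 \<and> conic hull {p} = conic hull {x}" by blast
    have mult: "a \<in> conic hull {p}" if "a = t *\<^sub>R p" "0 \<le> t" for a t
      using that by (auto simp: conic_hull_explicit)
    show "conic hull {p} face_of C"
      unfolding face_of_def
    proof (intro conjI ballI impI)
      show "conic hull {p} \<subseteq> C" using pS by (auto simp: conic_hull_explicit intro: scale_mem)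
      show "convex (conic hull {p})" by (simp add: convex_conic_hull)
      have *: "a \<in> conic hull {p}" if ab: "a \<in> C" "b \<in> C" and x: "x \<in> conic hull {p}" "x = (1 - u) *\<^sub>R a + u *\<^sub>R b"
        "0 < u" "u < 1" for a b x u
      \<comment> \<open>A zero endpoint cannot be normalized onto the slice.\<close>
      proof (cases "a = 0 \<or> b = 0")
        case True
        show ?thesis
        proof (cases "a = 0")
          case True then show ?thesis by (intro mult[of a 0]) auto
        next
          case False
          with True have "b = 0" by simp
          obtain t where t: "x = t *\<^sub>R p" "0 \<le> t" using x(1) by (auto simp: conic_hull_explicit)
          have "a = (1 / (1 - u)) *\<^sub>R x" using x \<open>b = 0\<close> by simp
          with t x(4) show ?thesis by (intro mult[of a "t / (1 - u)"]) auto
        qed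
      next
        case False
        obtain t where t: "x = t *\<^sub>R p" "0 \<le> t" using x(1) by (auto simp: conic_hull_explicit)
        define \<alpha> \<beta> where "\<alpha> = ip a e" and "\<beta> = ip b e"
        have pos: "\<alpha> > 0" "\<beta> > 0" using False ab interior_pos[OF e] by (auto simp: \<alpha>_def \<beta>_def)
        have tab: "t = (1 - u) * \<alpha> + u * \<beta>"
          using arg_cong[OF t(1), of "\<lambda>x. ip x e"] x(2) pS(2)
          by (simp add: \<alpha>_def \<beta>_def add_left scaleR_left)
        then have tpos: "t > 0" using pos x by (simp add: add_pos_pos)
        define a' b' where "a' = a /\<^sub>R \<alpha>" and "b' = b /\<^sub>R \<beta>"
        have "a' \<in> S" "b' \<in> S"
          using ab pos by (auto simp: S_def a'_def b'_def scaleR_left \<alpha>_def[symmetric] \<beta>_def[symmetric] intro!: scale_mem)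
        \<comment> \<open>Normalizing \<open>a\<close> and \<open>b\<close> onto the slice changes
          the weights \<open>1 - u\<close> and \<open>u\<close> into \<open>1 - w\<close> and
          \<open>w\<close>, so \<open>p\<close> becomes a convex combination of slice
          points.\<close>
        define w where "w = u * \<beta> / t"
        have "u * \<beta> < t" using pos x(4) by (simp add: tab)
        then have w: "0 < w" "w < 1" using tpos pos x by (auto simp: w_def)
        have w1: "1 - w = (1 - u) * \<alpha> / t" using tab tpos by (simp add: w_def field_simps)
        have "p = (1 / t) *\<^sub>R ((1 - u) *\<^sub>R a + u *\<^sub>R b)" using t tpos x(2) by simp
        also have "\<dots> = ((1 - u) * \<alpha> / t) *\<^sub>R a' + (u * \<beta> / t) *\<^sub>R b'"
        proof -
          have "a = \<alpha> *\<^sub>R a'" "b = \<beta> *\<^sub>R b'" using pos by (auto simp: a'_def b'_def)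
          then show ?thesis by (simp add: scaleR_add_right)
        qed
        finally have pab: "p = (1 - w) *\<^sub>R a' + w *\<^sub>R b'"
          unfolding w1 by (simp only: w_def)
        have "a' = p"
        proof (cases "a' = b'")
          case False
          then have "p \<in> open_segment a' b'" using w pab by (auto simp: in_segment)
          then show ?thesis using p \<open>a' \<in> S\<close> \<open>b' \<in> S\<close> by (auto simp: extreme_point_of_def)
        qed (use pab in \<open>simp add: algebra_simps\<close>)
        then have "a = \<alpha> *\<^sub>R p" using pos by (auto simp: a'_def)
        then show ?thesis using pos by (intro mult) auto
      qed
      fix a b x assume ab: "a \<in> C" "b \<in> C" and x: "x \<in> conic hull {p}" "x \<in> open_segment a b"
      then obtain u where u: "0 < u" "u < 1" "x = (1 - u) *\<^sub>R a + u *\<^sub>R b" by (auto simp: in_segment)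
      show "a \<in> conic hull {p}" using *[OF ab x(1) u(3,1,2)] .
      show "b \<in> conic hull {p}" using *[OF ab(2,1) x(1), of "1 - u"] u by (simp add: add.commute)
    qed
  qed
  have "\<exists>vs. length vs \<le> DIM(real^'n) + 1 \<and> (\<forall>v\<in>set vs. \<exists>R. extreme_ray_of R C \<and> v \<in> R) \<and> x = sum_list vs"
    if x: "x \<in> C" for x
  proof (cases "x = 0")
    case True
    then show ?thesis by (intro exI[of _ "[]"]) auto
  next
    case False
    define \<xi> where "\<xi> = ip x e"
    have \<xi>: "\<xi> > 0" using False x interior_pos[OF e] by (simp add: \<xi>_def)
    then have "x /\<^sub>R \<xi> \<in> S" using x by (auto simp: S_def scaleR_left \<xi>_def[symmetric] intro: scale_mem)
    then have "x /\<^sub>R \<xi> \<in> convex hull {x. x extreme_point_of S}" using KM by simp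
    then obtain T where T: "finite T" "T \<subseteq> {x. x extreme_point_of S}" "card T \<le> DIM(real^'n) + 1" "x /\<^sub>R \<xi> \<in> convex hull T"
      unfolding caratheodory[of "{x. x extreme_point_of S}"] by blast
    obtain u where u: "\<forall>p\<in>T. 0 \<le> u p" "(\<Sum>p\<in>T. u p *\<^sub>R p) = x /\<^sub>R \<xi>"
      using T(4) convex_hull_finite[OF T(1)] by auto
    obtain ps where ps: "set ps = T" "distinct ps" using T(1) finite_distinct_list by blast
    let ?vs = "map (\<lambda>p. (\<xi> * u p) *\<^sub>R p) ps"
    have "x = (\<Sum>p\<in>T. (\<xi> * u p) *\<^sub>R p)"
      using arg_cong[OF u(2), of "scaleR \<xi>"] \<xi> by (simp add: scaleR_sum_right)
    then have "x = sum_list ?vs" using ps sum_list_distinct_conv_sum_set by metis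
    moreover have "length ?vs \<le> DIM(real^'n) + 1" using T(3) ps distinct_card by fastforce
    moreover have "\<exists>R. extreme_ray_of R C \<and> v \<in> R" if v: "v \<in> set ?vs" for v
    proof -
      obtain p where p: "p \<in> T" "v = (\<xi> * u p) *\<^sub>R p" using v ps by auto
      have "v \<in> conic hull {p}" using p u \<xi> by (auto simp: conic_hull_explicit)
      with ray p T(2) show ?thesis by blast
    qed
    ultimately show ?thesis by blast
  qed
  then show ?thesis by blast
qed

text \<open>A ray contains its apex, hence the alternative \<open>v = 0\<close>.\<close>

lemma caratheodory_decomposition:
  assumes "x \<in> C"
  obtains vs where "length vs \<le> caratheodory_number C" "\<And>v. v \<in> set vs \<Longrightarrow> v = 0 \<or> extremal v" "x = sum_list vs"
proof -
  have "\<exists>vs. length vs \<le> caratheodory_number C \<and> (\<forall>v\<in>set vs. \<exists>R. extreme_ray_of R C \<and> v \<in> R) \<and> x = sum_list vs"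
    using LeastI_ex[OF ex_sum_extreme_rays] assms unfolding caratheodory_number_def by blast
  then show ?thesis using that extreme_ray_imp_extremal by metis
qed

end

section \<open>An equivariant vector field on the interior\<close>

definition bump :: "real \<Rightarrow> real" where "bump s = (max 0 (1 - s))\<^sup>2"

text \<open>Minus the derivative of \<open>bump\<close>.\<close>

definition bump_deriv :: "real \<Rightarrow> real" where "bump_deriv s = 2 * max 0 (1 - s)"

text \<open>A primitive of \<open>- bump\<close>, so that \<open>potential\<close> below has
  gradient \<open>- moment\<close>.\<close>

definition bump_int :: "real \<Rightarrow> real" where "bump_int s = (max 0 (1 - s)) ^ 3 / 3"

text \<open>The tangent inequality of a convex function whose derivative is \<open>- bump\<close>;
  when both arguments are below 1 it reduces to
  \<open>(u - v)\<^sup>2 * (u + 2 * v) \<ge> 0\<close>.\<close>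

lemma bump_int_convex: "bump_int b + bump b * (b - a) \<le> bump_int a"
proof (cases "b < 1")
  case False
  then show ?thesis by (simp add: bump_def bump_int_def)
next
  case True
  define v where "v = 1 - b"
  have v: "v > 0" "b = 1 - v" using True by (auto simp: v_def)
  show ?thesis
  proof (cases "a < 1")
    case True
    define u where "u = 1 - a"
    have u: "u > 0" "a = 1 - u" using True by (auto simp: u_def)
    have "0 \<le> (u - v)\<^sup>2 * (u + 2 * v)" using u v by simp
    also have "\<dots> = u ^ 3 - 3 * v\<^sup>2 * u + 2 * v ^ 3" by (simp add: power2_eq_square power3_eq_cube algebra_simps)
    finally have "v ^ 3 / 3 + v\<^sup>2 * (u - v) \<le> u ^ 3 / 3"
      by (simp add: power2_eq_square power3_eq_cube algebra_simps)
    moreover have "bump_int b = v ^ 3 / 3" "bump b = v\<^sup>2" "bump_int a = u ^ 3 / 3" "b - a = u - v"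
      using u v by (simp_all add: bump_def bump_int_def)
    ultimately show ?thesis by simp
  next
    case False
    have "v\<^sup>2 * (1 - a) \<le> 0" using False by (simp add: mult_nonneg_nonpos)
    moreover have "0 < v ^ 3" using v by simp
    moreover have "bump_int b + bump b * (b - a) = v\<^sup>2 * (1 - a) - 2 / 3 * v ^ 3"
    proof -
      have "bump_int b = v ^ 3 / 3" "bump b = v\<^sup>2" "b - a = (1 - a) - v"
        using v by (simp_all add: bump_def bump_int_def)
      then show ?thesis by (simp add: power2_eq_square power3_eq_cube right_diff_distrib)
    qed
    moreover have "bump_int a = 0" using False by (simp add: bump_int_def)
    ultimately show ?thesis by linarith
  qed
qed

lemma bump_taylor: "\<bar>bump (s + d) - bump s + bump_deriv s * d\<bar> \<le> d\<^sup>2"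
proof -
  define p where "p = 1 - s"
  have p: "bump (s + d) = (max 0 (p - d))\<^sup>2" "bump s = (max 0 p)\<^sup>2" "bump_deriv s = 2 * max 0 p"
    by (simp_all add: bump_def bump_deriv_def p_def algebra_simps)
  consider "p \<le> 0" "p - d \<le> 0" | "p \<le> 0" "p - d > 0" | "p > 0" "p - d \<ge> 0" | "p > 0" "p - d < 0"
    by linarith
  then show ?thesis
  proof cases
    case 1
    then show ?thesis by (simp add: p)
  next
    case 2
    then have "(p - d)\<^sup>2 \<le> (- d)\<^sup>2" by (intro power_mono) auto
    with 2 show ?thesis by (simp add: p)
  next
    case 3
    then have "bump (s + d) - bump s + bump_deriv s * d = d\<^sup>2"
      unfolding p by (simp add: power2_eq_square algebra_simps)
    then show ?thesis by simp
  next
    case 4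
    have "0 \<le> (d - p)\<^sup>2" by simp
    moreover have "0 \<le> p * (2 * d - p)" using 4 by (intro mult_nonneg_nonneg) auto
    moreover have "bump (s + d) - bump s + bump_deriv s * d = p * (2 * d - p)"
      unfolding p using 4 by (simp add: power2_eq_square algebra_simps)
    moreover have "p * (2 * d - p) = d\<^sup>2 - (d - p)\<^sup>2"
      by (simp add: power2_eq_square algebra_simps)
    ultimately show ?thesis by linarith
  qed
qed

section \<open>Weighted integrals over the cone\<close>

context self_dual_homogeneous_cone begin

definition cone_integral :: "(real \<Rightarrow> real) \<Rightarrow> real^'n \<Rightarrow> (real^'n \<Rightarrow> 'b::euclidean_space) \<Rightarrow> 'b" where
  "cone_integral \<psi> x F = (LINT z|lborel. indicat_real C z *\<^sub>R (\<psi> (ip x z) *\<^sub>R F z))"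

definition moment :: "real^'n \<Rightarrow> real^'n" where
  "moment x = cone_integral bump x (\<lambda>z. z)"

text \<open>Minus the derivative of \<open>moment\<close> at \<open>x\<close> in the direction
  \<open>w\<close>; see \<open>moment_taylor\<close>.\<close>

definition moment_deriv :: "real^'n \<Rightarrow> real^'n \<Rightarrow> real^'n" where
  "moment_deriv x w = cone_integral bump_deriv x (\<lambda>z. ip w z *\<^sub>R z)"

definition potential :: "real^'n \<Rightarrow> real" where
  "potential x = cone_integral bump_int x (\<lambda>z. 1)"

lemma continuous_bump: "continuous_on UNIV bump" "continuous_on UNIV bump_deriv" "continuous_on UNIV bump_int"
  unfolding bump_def[abs_def] bump_deriv_def[abs_def] bump_int_def[abs_def] by (intro continuous_intros; simp)+

lemma bump_eq_0: "s \<ge> 1 \<Longrightarrow> bump s = 0" "s \<ge> 1 \<Longrightarrow> bump_deriv s = 0" "s \<ge> 1 \<Longrightarrow> bump_int s = 0"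
  by (simp_all add: bump_def bump_deriv_def bump_int_def)

lemma continuous_ip: "continuous_on S (\<lambda>z. ip x z)"
  by (intro continuous_on continuous_on_const continuous_on_id)

lemma compact_slice:
  assumes "x \<in> interior C" shows "compact {z \<in> C. ip x z \<le> c}"
proof -
  obtain \<kappa> where \<kappa>: "\<kappa> > 0" "\<And>z. z \<in> C \<Longrightarrow> \<kappa> * norm z \<le> ip z x"
    using ip_interior_lower[OF assms] by metis
  have "norm z \<le> c / \<kappa>" if "z \<in> {z \<in> C. ip x z \<le> c}" for z
    using \<kappa>(2)[of z] \<kappa>(1) that commute[of x z] by (simp add: field_simps)
  then have "bounded {z \<in> C. ip x z \<le> c}" unfolding bounded_iff by blast
  moreover have "{z \<in> C. ip x z \<le> c} = C \<inter> (\<lambda>z. ip x z) -` {..c}" by auto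
  then have "closed {z \<in> C. ip x z \<le> c}"
    using closed by (simp add: closed_Int closed_vimage continuous_ip)
  ultimately show ?thesis by (simp add: compact_eq_bounded_closed)
qed

text \<open>The integrand vanishes outside the slice \<open>ip x z \<le> 1\<close>, which is compact
  because \<open>x\<close> is interior.\<close>

lemma cone_integrable:
  fixes F :: "real^'n \<Rightarrow> 'b::euclidean_space"
  assumes x: "x \<in> interior C" and \<psi>: "continuous_on UNIV \<psi>" "\<And>s. s \<ge> 1 \<Longrightarrow> \<psi> s = 0"
    and F: "continuous_on UNIV F"
  shows "integrable lborel (\<lambda>z. indicat_real C z *\<^sub>R (\<psi> (ip x z) *\<^sub>R F z))"
proof -
  let ?K = "{z \<in> C. ip x z \<le> 1}"
  have "continuous_on ?K (\<lambda>z. \<psi> (ip x z) *\<^sub>R F z)"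
    using F continuous_on_compose2[OF \<psi>(1) continuous_ip[of _ x]]
    by (intro continuous_intros) (auto intro: continuous_on_subset)
  then have "integrable lborel (\<lambda>z. indicat_real ?K z *\<^sub>R (\<psi> (ip x z) *\<^sub>R F z))"
    using compact_slice[OF x] by (rule borel_integrable_compact[rotated])
  also have "(\<lambda>z. indicat_real ?K z *\<^sub>R (\<psi> (ip x z) *\<^sub>R F z)) = (\<lambda>z. indicat_real C z *\<^sub>R (\<psi> (ip x z) *\<^sub>R F z))"
  proof (rule ext)
    fix z
    show "indicat_real ?K z *\<^sub>R (\<psi> (ip x z) *\<^sub>R F z) = indicat_real C z *\<^sub>R (\<psi> (ip x z) *\<^sub>R F z)"
      using \<psi>(2)[of "ip x z"] by (cases "ip x z \<le> 1") (auto simp: indicator_def)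
  qed
  finally show ?thesis .
qed

text \<open>Substitute \<open>adj (inv g) z\<close> for \<open>z\<close>: this map preserves
  \<open>C\<close> and turns the argument \<open>ip (g x) z\<close> of the profile into
  \<open>ip x z\<close>.\<close>

lemma cone_integral_aut:
  fixes F :: "real^'n \<Rightarrow> 'b::euclidean_space"
  assumes g: "aut g" and \<psi>: "continuous_on UNIV \<psi>" and F: "continuous_on UNIV F"
  shows "cone_integral \<psi> (g x) F = vol_factor (adj (inv g)) *\<^sub>R cone_integral \<psi> x (\<lambda>z. F (adj (inv g) z))"
proof -
  let ?g = "adj (inv g)" and ?f = "\<lambda>z. indicat_real C z *\<^sub>R (\<psi> (ip (g x) z) *\<^sub>R F z)"
  have g': "aut ?g" by (intro aut_adj aut_inv g)
  have [measurable]: "F \<in> borel_measurable borel" "(\<lambda>z. \<psi> (ip (g x) z)) \<in> borel_measurable borel" "C \<in> sets borel"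
    using F continuous_on_compose2[OF \<psi> continuous_ip[of UNIV "g x"]] closed
    by (auto intro: borel_measurable_continuous_onI)
  have "?f \<in> borel_measurable borel" by measurable
  then have "(LINT z|lborel. ?f z) = vol_factor ?g *\<^sub>R (LINT z|lborel. ?f (?g z))"
    by (rule integral_vol_factor[OF aut_linear[OF g'] aut_inj[OF g']])
  moreover have "ip (g x) (?g z) = ip x z" for z
    using g by (simp add: adj[symmetric] aut_linear aut_inv)
  moreover have "indicat_real C (?g z) = indicat_real C z" for z
    using aut_mem_iff[OF g'] by (simp add: indicator_def)
  ultimately show ?thesis by (simp add: cone_integral_def)
qed

lemma potential_aut: "aut g \<Longrightarrow> potential (g x) = vol_factor (adj (inv g)) * potential x"
  unfolding potential_def by (subst cone_integral_aut) (auto simp: continuous_bump)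

lemma moment_integrable: "x \<in> interior C \<Longrightarrow> integrable lborel (\<lambda>z. indicat_real C z *\<^sub>R (bump (ip x z) *\<^sub>R z))"
  by (intro cone_integrable continuous_bump bump_eq_0 continuous_on_id)

lemma moment_deriv_integrable:
  "x \<in> interior C \<Longrightarrow> integrable lborel (\<lambda>z. indicat_real C z *\<^sub>R (bump_deriv (ip x z) *\<^sub>R (ip w z *\<^sub>R z)))"
  by (intro cone_integrable continuous_bump bump_eq_0 continuous_on_scaleR continuous_ip continuous_on_id)

lemma potential_integrable: "x \<in> interior C \<Longrightarrow> integrable lborel (\<lambda>z. indicat_real C z *\<^sub>R (bump_int (ip x z) *\<^sub>R (1::real)))"
  by (intro cone_integrable continuous_bump bump_eq_0 continuous_on_const)

lemma moment_aut:
  assumes g: "aut g" and x: "x \<in> interior C"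
  shows "moment (g x) = vol_factor (adj (inv g)) *\<^sub>R adj (inv g) (moment x)"
proof -
  have lin: "bounded_linear (adj (inv g))"
    using linear_adj[OF aut_linear[OF aut_inv[OF g]]] by (simp add: linear_linear)
  have "adj (inv g) (moment x) = (LINT z|lborel. adj (inv g) (indicat_real C z *\<^sub>R (bump (ip x z) *\<^sub>R z)))"
    unfolding moment_def cone_integral_def
    by (rule integral_bounded_linear[OF lin moment_integrable[OF x], symmetric])
  also have "\<dots> = cone_integral bump x (\<lambda>z. adj (inv g) z)"
    unfolding cone_integral_def using lin by (simp add: linear_simps)
  finally show ?thesis
    unfolding moment_def
    by (subst cone_integral_aut[OF g continuous_bump(1) continuous_on_id]) simp
qed

lemma ip_moment:
  assumes "x \<in> interior C"
  shows "ip (moment x) y = (LINT z|lborel. indicat_real C z * (bump (ip x z) * ip z y))"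
    "integrable lborel (\<lambda>z. indicat_real C z * (bump (ip x z) * ip z y))"
proof -
  note bl = bounded_linear_left[of y]
  show "ip (moment x) y = (LINT z|lborel. indicat_real C z * (bump (ip x z) * ip z y))"
    unfolding moment_def cone_integral_def
    by (subst integral_bounded_linear[OF bl moment_integrable[OF assms], symmetric]) (simp add: scaleR_left mult.assoc)
  show "integrable lborel (\<lambda>z. indicat_real C z * (bump (ip x z) * ip z y))"
    using integrable_bounded_linear[OF bl moment_integrable[OF assms]] by (simp add: scaleR_left mult.assoc)
qed

text \<open>Integrating \<open>bump_int_convex\<close> over the cone shows that
  \<open>- moment y\<close> is a subgradient of \<open>potential\<close> at
  \<open>y\<close>.\<close>

lemma potential_convex:
  assumes x: "x \<in> interior C" and y: "y \<in> interior C"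
  shows "potential y + ip (moment y) (y - x) \<le> potential x"
proof -
  have "potential y + ip (moment y) (y - x) =
    (LINT z|lborel. indicat_real C z * bump_int (ip y z) + indicat_real C z * (bump (ip y z) * ip z (y - x)))"
    unfolding potential_def cone_integral_def ip_moment(1)[OF y]
    using potential_integrable[OF y] ip_moment(2)[OF y] by simp
  also have "\<dots> \<le> (LINT z|lborel. indicat_real C z * bump_int (ip x z))"
  proof (rule integral_mono)
    show "integrable lborel (\<lambda>z. indicat_real C z * bump_int (ip y z) + indicat_real C z * (bump (ip y z) * ip z (y - x)))"
      using potential_integrable[OF y] ip_moment(2)[OF y] by simp
    show "integrable lborel (\<lambda>z. indicat_real C z * bump_int (ip x z))"
      using potential_integrable[OF x] by simp
    fix z
    have "ip z (y - x) = ip y z - ip x z" using commute[of z] by (simp add: diff_right)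
    then show "indicat_real C z * bump_int (ip y z) + indicat_real C z * (bump (ip y z) * ip z (y - x))
        \<le> indicat_real C z * bump_int (ip x z)"
      using bump_int_convex[of "ip y z" "ip x z"] by (simp add: indicator_def)
  qed
  finally show ?thesis by (simp add: potential_def cone_integral_def)
qed

text \<open>The integrand is positive on the nonempty open set \<open>U\<close>, so the integral of
  this nonnegative function cannot vanish.\<close>

lemma potential_pos: assumes x: "x \<in> interior C" shows "0 < potential x"
proof -
  let ?f = "\<lambda>z. indicat_real C z * bump_int (ip x z)"
  have int: "integrable lborel ?f" using potential_integrable[OF x] by simp
  have nonneg: "0 \<le> ?f z" for z by (simp add: bump_int_def)
  have "integral\<^sup>L lborel ?f \<noteq> 0"
  proof
    assume "integral\<^sup>L lborel ?f = 0"
    then have "AE z in lborel. ?f z = 0"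
      using integral_nonneg_eq_0_iff_AE[OF int] nonneg by simp
    define U where "U = interior C \<inter> (\<lambda>z. ip x z) -` {..<1}"
    have "open U" unfolding U_def by (intro open_Int open_interior open_vimage continuous_ip) auto
    moreover have "U \<noteq> {}"
    proof -
      have "1 / (2 * ip x x) > 0" using self_pos[OF interior_nonzero[OF x]] by simp
      then have "(1 / (2 * ip x x)) *\<^sub>R x \<in> U"
        using interior_nonzero[OF x] by (auto simp: U_def scaleR_right intro: interior_scale[OF x])
      then show ?thesis by blast
    qed
    ultimately have "\<not> negligible U" by (rule open_not_negligible)
    moreover have "?f z \<noteq> 0" if "z \<in> U" for z
      using that interior_mem by (auto simp: U_def bump_int_def)
    with \<open>AE z in lborel. ?f z = 0\<close> have "AE z in lborel. z \<notin> U" by (auto elim: AE_mp)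
    then have "U \<in> null_sets lborel"
      using \<open>open U\<close> by (subst (asm) AE_iff_null_sets[symmetric]) auto
    then have "negligible U"
      unfolding negligible_iff_null_sets using null_sets_completionI by blast
    ultimately show False by blast
  qed
  moreover have "0 \<le> integral\<^sup>L lborel ?f" using nonneg by (intro integral_nonneg_AE) auto
  ultimately show ?thesis by (simp add: potential_def cone_integral_def)
qed

lemma linear_moment_deriv: assumes "x \<in> interior C" shows "linear (moment_deriv x)"
proof (rule linearI)
  fix u v :: "real^'n" and c :: real
  note int = moment_deriv_integrable[OF assms]
  have "moment_deriv x (u + v) =
    (LINT z|lborel. indicat_real C z *\<^sub>R (bump_deriv (ip x z) *\<^sub>R (ip u z *\<^sub>R z)) + indicat_real C z *\<^sub>R (bump_deriv (ip x z) *\<^sub>R (ip v z *\<^sub>R z)))"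
    unfolding moment_deriv_def cone_integral_def
    by (intro Bochner_Integration.integral_cong) (auto simp: add_left algebra_simps)
  then show "moment_deriv x (u + v) = moment_deriv x u + moment_deriv x v"
    unfolding moment_deriv_def cone_integral_def using int by simp
  have "moment_deriv x (c *\<^sub>R u) =
    (LINT z|lborel. c *\<^sub>R (indicat_real C z *\<^sub>R (bump_deriv (ip x z) *\<^sub>R (ip u z *\<^sub>R z))))"
    unfolding moment_deriv_def cone_integral_def
    by (intro Bochner_Integration.integral_cong) (auto simp: scaleR_left)
  also have "\<dots> = c *\<^sub>R moment_deriv x u"
    unfolding moment_deriv_def cone_integral_def by (rule Bochner_Integration.integral_scaleR_right)
  finally show "moment_deriv x (c *\<^sub>R u) = c *\<^sub>R moment_deriv x u" .
qed

text \<open>The pairing is the integral of a square against a nonnegative weight. It later makes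
  \<open>w + moment_deriv e w\<close> an injective function of \<open>w\<close>.\<close>

lemma moment_deriv_nonneg: assumes "x \<in> interior C" shows "0 \<le> ip (moment_deriv x w) w"
proof -
  have "ip (moment_deriv x w) w =
    (LINT z|lborel. ip (indicat_real C z *\<^sub>R (bump_deriv (ip x z) *\<^sub>R (ip w z *\<^sub>R z))) w)"
    unfolding moment_deriv_def cone_integral_def
    by (rule integral_bounded_linear[OF bounded_linear_left moment_deriv_integrable[OF assms], symmetric])
  also have "\<dots> = (LINT z|lborel. indicat_real C z * (bump_deriv (ip x z) * (ip w z)\<^sup>2))"
    by (intro Bochner_Integration.integral_cong)
      (simp_all add: scaleR_left power2_eq_square commute[of _ w] scaleR_right)
  also have "\<dots> \<ge> 0"
    by (intro integral_nonneg_AE AE_I2) (simp add: bump_deriv_def)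
  finally show ?thesis .
qed

lemma moment_taylor:
  assumes x: "x \<in> interior C"
  obtains B t0 where "t0 > 0" "B \<ge> 0"
    "\<And>t. 0 < t \<Longrightarrow> t < t0 \<Longrightarrow> x + t *\<^sub>R w \<in> interior C"
    "\<And>t. 0 < t \<Longrightarrow> t < t0 \<Longrightarrow> norm ((moment (x + t *\<^sub>R w) - moment x) /\<^sub>R t + moment_deriv x w) \<le> t * B"
proof -
  obtain \<epsilon> where \<epsilon>: "\<epsilon> > 0" "\<And>x' s. norm x' \<le> \<epsilon> * s \<Longrightarrow> s *\<^sub>R x + x' \<in> C"
    using absorb[OF x] by metis
  \<comment> \<open>For \<open>t < t0\<close> the point \<open>x + t *\<^sub>R w\<close> dominates
    half of \<open>x\<close>.\<close>
  define t0 where "t0 = \<epsilon> / (2 * (norm w + 1))"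
  have t0: "t0 > 0" using \<epsilon>(1) by (simp add: t0_def add_nonneg_pos)
  \<comment> \<open>Outside this slice \<open>ip x z > 2\<close>, hence
    \<open>ip (x + t *\<^sub>R w) z > 1\<close> and all three profiles vanish. So one integrable
    function serves for all small \<open>t\<close>.\<close>
  let ?K = "{z \<in> C. ip x z \<le> 2}"
  let ?b = "\<lambda>z. indicat_real ?K z *\<^sub>R ((ip w z)\<^sup>2 * norm z)"
  define B where "B = (LINT z|lborel. ?b z)"
  have b: "integrable lborel ?b"
    by (intro borel_integrable_compact compact_slice x continuous_intros continuous_ip)
  have half: "(x + t *\<^sub>R w) - (1/2) *\<^sub>R x \<in> C" if t: "0 < t" "t < t0" for t
  proof -
    have "t * norm w \<le> t0 * (norm w + 1)" using t by (intro mult_mono) auto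
    also have "\<dots> = \<epsilon> * (1/2)"
    proof -
      have "norm w + 1 \<noteq> 0" using norm_ge_zero[of w] by linarith
      then have "t0 * (2 * (norm w + 1)) = \<epsilon>" unfolding t0_def by (intro nonzero_eq_divide_eq[THEN iffD1]) auto
      then show ?thesis by (simp add: algebra_simps)
    qed
    finally have "(1/2) *\<^sub>R x + t *\<^sub>R w \<in> C" using t by (intro \<epsilon>(2)) simp
    moreover have "(x + t *\<^sub>R w) - (1/2) *\<^sub>R x = (1/2) *\<^sub>R x + t *\<^sub>R w"
    proof -
      have "x - (1/2) *\<^sub>R x = (1/2) *\<^sub>R x" using scaleR_left_diff_distrib[of 1 "1/2" x] by simp
      moreover have "(x + t *\<^sub>R w) - (1/2) *\<^sub>R x = (x - (1/2) *\<^sub>R x) + t *\<^sub>R w" by (simp add: algebra_simps)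
      ultimately show ?thesis by simp
    qed
    ultimately show ?thesis by (simp only:)
  qed
  show ?thesis
  proof (rule that[OF t0, of B])
    show "B \<ge> 0" unfolding B_def by (intro integral_nonneg_AE) auto
    fix t assume t: "0 < t" "t < t0"
    let ?y = "x + t *\<^sub>R w"
    show y: "?y \<in> interior C" using interior_ge[OF x _ half[OF t]] by simp
    let ?p = "\<lambda>z. indicat_real C z *\<^sub>R (bump (ip ?y z) *\<^sub>R z)"
    let ?q = "\<lambda>z. indicat_real C z *\<^sub>R (bump (ip x z) *\<^sub>R z)"
    let ?r = "\<lambda>z. indicat_real C z *\<^sub>R (bump_deriv (ip x z) *\<^sub>R (ip w z *\<^sub>R z))"
    note int = moment_integrable[OF y] moment_integrable[OF x] moment_deriv_integrable[OF x, of w]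
    have eq: "(moment ?y - moment x) /\<^sub>R t + moment_deriv x w = (LINT z|lborel. (?p z - ?q z) /\<^sub>R t + ?r z)"
      unfolding moment_def moment_deriv_def cone_integral_def using int by simp
    have "norm (LINT z|lborel. (?p z - ?q z) /\<^sub>R t + ?r z) \<le> (LINT z|lborel. t * ?b z)"
    proof (rule Bochner_Integration.integral_norm_bound_integral)
      show "integrable lborel (\<lambda>z. (?p z - ?q z) /\<^sub>R t + ?r z)" using int by simp
      show "integrable lborel (\<lambda>z. t * ?b z)" using b by simp
      fix z :: "real^'n"
      show "norm ((?p z - ?q z) /\<^sub>R t + ?r z) \<le> t * ?b z"
      proof (cases "z \<in> C")
        case zC: True
        define s where "s = ip x z"
        define d where "d = t * ip w z"
        have ipy: "ip ?y z = s + d" by (simp add: s_def d_def add_left scaleR_left)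
        have "(?p z - ?q z) /\<^sub>R t + ?r z = ((bump (s + d) - bump s) / t + bump_deriv s * ip w z) *\<^sub>R z"
          using zC by (simp add: ipy s_def[symmetric] algebra_simps divide_inverse)
        also have "(bump (s + d) - bump s) / t + bump_deriv s * ip w z = (bump (s + d) - bump s + bump_deriv s * d) / t"
          using t by (simp add: d_def field_simps)
        finally have eq: "norm ((?p z - ?q z) /\<^sub>R t + ?r z) = \<bar>bump (s + d) - bump s + bump_deriv s * d\<bar> / t * norm z"
          using t by simp
        show ?thesis
        proof (cases "s \<le> 2")
          case True
          have "\<bar>bump (s + d) - bump s + bump_deriv s * d\<bar> / t * norm z \<le> d\<^sup>2 / t * norm z"
            using t by (intro mult_right_mono divide_right_mono bump_taylor) auto
          also have "\<dots> = t * ?b z" using t zC True by (simp add: d_def s_def power2_eq_square)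
          finally show ?thesis unfolding eq .
        next
          case False
          have "0 \<le> ip (?y - (1/2) *\<^sub>R x) z" by (rule ip_nonneg[OF half[OF t] zC])
          then have "s + d \<ge> s / 2" by (simp only: diff_left ipy scaleR_left s_def[symmetric]) simp
          then have "bump (s + d) = 0" "bump s = 0" "bump_deriv s = 0" using False by (auto intro: bump_eq_0)
          then show ?thesis unfolding eq using t by (simp add: indicator_def)
        qed
      qed simp
    qed
    also have "\<dots> = t * B" unfolding B_def by (rule integral_mult_right_zero)
    finally show "norm ((moment ?y - moment x) /\<^sub>R t + moment_deriv x w) \<le> t * B" unfolding eq .
  qed
qed

lemma moment_limits:
  assumes x: "x \<in> interior C" and t: "\<And>k. 0 < t k" "t \<longlonglongrightarrow> 0"
  shows "(\<lambda>k. (moment (x + t k *\<^sub>R w) - moment x) /\<^sub>R t k) \<longlonglongrightarrow> - moment_deriv x w"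
    and "(\<lambda>k. moment (x + t k *\<^sub>R w)) \<longlonglongrightarrow> moment x"
    and "\<forall>\<^sub>F k in sequentially. x + t k *\<^sub>R w \<in> interior C"
proof -
  obtain B t0 where B: "t0 > 0" "\<And>t. 0 < t \<Longrightarrow> t < t0 \<Longrightarrow> x + t *\<^sub>R w \<in> interior C"
    "\<And>t. 0 < t \<Longrightarrow> t < t0 \<Longrightarrow> norm ((moment (x + t *\<^sub>R w) - moment x) /\<^sub>R t + moment_deriv x w) \<le> t * B"
    using moment_taylor[OF x] by metis
  have small: "\<forall>\<^sub>F k in sequentially. t k < t0" using order_tendstoD(2)[OF t(2) B(1)] .
  show "\<forall>\<^sub>F k in sequentially. x + t k *\<^sub>R w \<in> interior C"
    using small by eventually_elim (rule B(2)[OF t(1)])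
  have "(\<lambda>k. (moment (x + t k *\<^sub>R w) - moment x) /\<^sub>R t k - - moment_deriv x w) \<longlonglongrightarrow> 0"
  proof (rule Lim_null_comparison)
    show "\<forall>\<^sub>F k in sequentially. norm ((moment (x + t k *\<^sub>R w) - moment x) /\<^sub>R t k - - moment_deriv x w) \<le> t k * B"
      using small by eventually_elim (use B(3)[OF t(1)] in simp)
    show "(\<lambda>k. t k * B) \<longlonglongrightarrow> 0" using tendsto_mult_right[OF t(2), of B] by simp
  qed
  then show lim: "(\<lambda>k. (moment (x + t k *\<^sub>R w) - moment x) /\<^sub>R t k) \<longlonglongrightarrow> - moment_deriv x w"
    by (simp only: LIM_zero_iff)
  have "(\<lambda>k. t k *\<^sub>R ((moment (x + t k *\<^sub>R w) - moment x) /\<^sub>R t k) + moment x) \<longlonglongrightarrow> 0 *\<^sub>R - moment_deriv x w + moment x"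
    by (intro tendsto_add tendsto_scaleR t(2) lim tendsto_const)
  moreover have "t k *\<^sub>R ((moment (x + t k *\<^sub>R w) - moment x) /\<^sub>R t k) + moment x = moment (x + t k *\<^sub>R w)" for k
    using t(1)[of k] by simp
  ultimately show "(\<lambda>k. moment (x + t k *\<^sub>R w)) \<longlonglongrightarrow> moment x" by simp
qed

lemma vol_factor_adj_inv:
  assumes "aut g" shows "vol_factor (adj (inv g)) = 1 / vol_factor (adj g)" "vol_factor (adj g) > 0"
proof -
  have lin: "linear (adj g)" "linear (adj (inv g))"
    using assms by (simp_all add: linear_adj aut_linear aut_inv)
  have "adj g \<circ> adj (inv g) = (\<lambda>x. x)" using assms by (simp add: fun_eq_iff adj_inv)
  then have prod: "vol_factor (adj g) * vol_factor (adj (inv g)) = 1"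
    using vol_factor_comp[OF lin] vol_factor_id by metis
  have "vol_factor (adj g) \<ge> 0" by (simp add: vol_factor_def)
  with prod show "vol_factor (adj g) > 0" by (cases "vol_factor (adj g) = 0") auto
  then show "vol_factor (adj (inv g)) = 1 / vol_factor (adj g)" using prod by (simp add: field_simps)
qed

text \<open>By transitivity, minimizing \<open>ip y y / 2 + potential y\<close> over the interior
  amounts to minimizing over automorphisms, where compactness is available. The minimizer is a
  critical point, and this says \<open>moment e = e\<close>.\<close>

lemma ex_moment_fixpoint: obtains e where "e \<in> interior C" "moment e = e"
proof -
  obtain a where a: "a \<in> interior C" using interior_nonempty by blast
  define \<Phi> where "\<Phi> = potential a"
  have \<Phi>: "\<Phi> > 0" using potential_pos[OF a] by (simp add: \<Phi>_def)
  \<comment> \<open>On automorphisms the second term is \<open>potential (g a)\<close>; written with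
    \<open>vol_factor\<close> it passes to limits of automorphisms with nonzero volume
    factor.\<close>
  define J where "J g = ip (g a) (g a) / 2 + \<Phi> / vol_factor (adj g)" for g
  have J: "J g = ip (g a) (g a) / 2 + potential (g a)" if "aut g" for g
    using that by (simp add: J_def potential_aut vol_factor_adj_inv(1) \<Phi>_def)
  have nonneg: "0 \<le> ip (g a) (g a) / 2" "0 < \<Phi> / vol_factor (adj g)" if "aut g" for g
    using \<Phi> vol_factor_adj_inv(2)[OF that] by (auto simp: self_nonneg)
  have "\<exists>g l. (\<forall>k. aut (g k)) \<and> (\<lambda>k. J (g k)) \<longlonglongrightarrow> l \<and> (\<forall>k. J (g k) < l + 1) \<and> (\<forall>f. aut f \<longrightarrow> l \<le> J f)"
  proof (rule minimizing_sequence[of "{g. aut g}" J])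
    show "{g. aut g} \<noteq> {}" using aut_id by blast
    show "0 \<le> J g" if "g \<in> {g. aut g}" for g using nonneg[of g] that by (simp add: J_def)
    fix g l assume "\<And>k. g k \<in> {g. aut g}" "(\<lambda>k. J (g k)) \<longlonglongrightarrow> l" "\<And>k. J (g k) < l + 1"
      "\<And>f. f \<in> {g. aut g} \<Longrightarrow> l \<le> J f"
    then show ?thesis by (intro exI[of _ g] exI[of _ l]) auto
  qed
  then obtain g l where g: "\<And>k. aut (g k)" and gl: "(\<lambda>k. J (g k)) \<longlonglongrightarrow> l" "\<And>k. J (g k) < l + 1"
    "\<And>f. aut f \<Longrightarrow> l \<le> J f" by blast
  have sub: "g k ` C \<subseteq> C" for k using aut_image[OF g] by simp
  have bound: "ip (g k a) a \<le> 1 + 2 * (l + 1) * ip a a" for k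
  proof -
    have "(ip (g k a) a)\<^sup>2 \<le> ip (g k a) (g k a) * ip a a" by (rule Cauchy_Schwarz)
    also have "\<dots> \<le> 2 * (l + 1) * ip a a"
      using gl(2)[of k] nonneg(2)[OF g, of k] by (intro mult_right_mono self_nonneg) (simp add: J_def)
    finally have "(ip (g k a) a)\<^sup>2 \<le> 2 * (l + 1) * ip a a" .
    \<comment> \<open>This square bounds a number by its own square plus 1/4, which removes the
      square from the bound.\<close>
    moreover have "0 \<le> (ip (g k a) a - 1/2)\<^sup>2" by simp
    ultimately show ?thesis by (simp add: power2_diff) (simp add: power2_eq_square)
  qed
  obtain r h where rh: "strict_mono r" "linear h" "\<And>x. (\<lambda>k. g (r k) x) \<longlonglongrightarrow> h x"
    by (rule cone_maps_seq_compact[of g, OF aut_linear[OF g] sub a a bound]) (erule (1) that)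
  have vol: "(\<lambda>k. vol_factor (adj (g (r k)))) \<longlonglongrightarrow> vol_factor (adj h)"
    by (intro tendsto_vol_factor tendsto_adj aut_linear g rh)
  \<comment> \<open>The second term of \<open>J\<close> blows up as the volume factor tends to 0, so
    the limit map cannot be singular.\<close>
  have "\<Phi> / (l + 1) \<le> vol_factor (adj (g (r k)))" for k
  proof -
    have "\<Phi> / vol_factor (adj (g (r k))) < l + 1"
      using gl(2)[of "r k"] nonneg(1)[OF g, of "r k"] by (simp add: J_def)
    moreover have "l + 1 > 0" using calculation nonneg(2)[OF g, of "r k"] by linarith
    ultimately show ?thesis using vol_factor_adj_inv(2)[OF g, of "r k"] by (simp add: field_simps)
  qed
  then have "\<Phi> / (l + 1) \<le> vol_factor (adj h)" by (intro LIMSEQ_le_const[OF vol]) blast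
  moreover have "\<Phi> / (l + 1) > 0"
    using gl(2)[of 0] nonneg[OF g, of 0] \<Phi> by (simp add: J_def)
  ultimately have hpos: "vol_factor (adj h) \<noteq> 0" by linarith
  then have "inj (adj h)" using vol_factor_eq_0_iff[OF linear_adj[OF rh(2)]] by blast
  then have surj: "surj (adj h)" using linear_adj[OF rh(2)] linear_injective_imp_surjective by blast
  have "inj h"
    unfolding linear_injective_0[OF rh(2)]
  proof (intro allI impI)
    fix x assume "h x = 0"
    then have "ip x (adj h y) = 0" for y by (simp add: adj[OF rh(2), symmetric] zero_left)
    then have "ip x x = 0" using surj by (metis surjD)
    then show "x = 0" by simp
  qed
  then have h: "aut h" using aut_limit[OF g rh(3,2)] by blast
  have "(\<lambda>k. J (g (r k))) \<longlonglongrightarrow> J h"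
    unfolding J_def by (intro tendsto_add tendsto_divide tendsto tendsto_const rh(3) vol hpos) auto
  moreover have "(\<lambda>k. J (g (r k))) \<longlonglongrightarrow> l"
    using LIMSEQ_subseq_LIMSEQ[OF gl(1) rh(1)] by (simp add: o_def)
  ultimately have "J h = l" by (rule LIMSEQ_unique)
  define e where "e = h a"
  have e: "e \<in> interior C" unfolding e_def by (rule aut_interior[OF h a])
  have min: "ip e e / 2 + potential e \<le> ip y y / 2 + potential y" if y: "y \<in> interior C" for y
  proof -
    obtain f where f: "aut f" "f a = y" using aut_transitive[OF a y] by blast
    with gl(3)[of f] \<open>J h = l\<close> show ?thesis by (simp add: J h e_def)
  qed
  \<comment> \<open>Minimality at \<open>e\<close> is combined with the subgradient inequality at
    the moved point, so \<open>potential\<close> itself is never differentiated. Using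
    \<open>w\<close> and \<open>- w\<close> gives equality.\<close>
  have le: "ip (moment e) w \<le> ip e w" for w
  proof -
    define t where "t k = inverse (real (Suc k))" for k
    have t: "\<And>k. 0 < t k" "t \<longlonglongrightarrow> 0" using LIMSEQ_inverse_real_of_nat by (simp_all add: t_def[abs_def])
    note lim = moment_limits[OF e t, of w]
    have "\<forall>\<^sub>F k in sequentially. ip (moment (e + t k *\<^sub>R w)) w \<le> ip e w + t k * (ip w w / 2)"
      using lim(3)
    proof eventually_elim
      fix k assume y: "e + t k *\<^sub>R w \<in> interior C"
      let ?y = "e + t k *\<^sub>R w"
      have "potential ?y + t k * ip (moment ?y) w \<le> potential e"
        using potential_convex[OF e y] by (simp add: scaleR_right)
      moreover have "ip ?y ?y = ip e e + 2 * (t k * ip e w) + t k * (t k * ip w w)"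
        using commute[of w e] by (simp add: add_left add_right scaleR_left scaleR_right distrib_left)
      moreover have "t k * (ip e w + t k * (ip w w / 2)) = t k * ip e w + t k * (t k * ip w w) / 2"
        by (simp add: distrib_left)
      ultimately have "t k * ip (moment ?y) w \<le> t k * (ip e w + t k * (ip w w / 2))"
        using min[OF y] by linarith
      then show "ip (moment ?y) w \<le> ip e w + t k * (ip w w / 2)" using t(1)[of k] by simp
    qed
    moreover have "(\<lambda>k. ip (moment (e + t k *\<^sub>R w)) w) \<longlonglongrightarrow> ip (moment e) w"
      by (intro tendsto lim(2) tendsto_const)
    moreover have "(\<lambda>k. ip e w + t k * (ip w w / 2)) \<longlonglongrightarrow> ip e w + 0 * (ip w w / 2)"
      by (intro tendsto_add tendsto_mult tendsto_const t(2))
    ultimately show ?thesis using tendsto_le[OF sequentially_bot] by fastforce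
  qed
  have "moment e = e"
  proof (rule eqI)
    fix w
    have "ip (moment e) w = ip e w" using le[of w] le[of "- w"] by (simp add: minus_right)
    then show "ip w (moment e) = ip w e" using commute by metis
  qed
  with e show ?thesis by (rule that)
qed

text \<open>
  The limits \<open>X\<close> are the self-adjoint elements of the Lie algebra of the automorphism group; the
  condition says that they move \<open>e\<close> in every direction.
\<close>

definition tangent_full :: "real^'n \<Rightarrow> bool" where
  "tangent_full e \<longleftrightarrow> (\<forall>u. \<exists>P X t. (\<forall>k. aut (P k) \<and> adj (P k) = P k \<and> 0 < t k) \<and> t \<longlonglongrightarrow> 0 \<and>
     (\<forall>x. (\<lambda>k. (P k x - x) /\<^sub>R t k) \<longlonglongrightarrow> X x) \<and> X e = u)"

section \<open>Stabilizer and tangent directions at the fixed point\<close>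

lemma moment_fixpoint_stabilizer:
  assumes e: "e \<in> interior C" "moment e = e" and k: "aut k" "k e = e"
  shows "k (adj k x) = x"
proof -
  let ?c = "vol_factor (adj (inv k))"
  have inv_e: "inv k e = e" using k by (metis aut_inv_f)
  have eq: "e = ?c *\<^sub>R adj (inv k) e" using moment_aut[OF k(1) e(1)] e(2) k(2) by simp
  \<comment> \<open>Pairing the equivariance relation with \<open>e\<close> forces the volume factor
    to be 1, so \<open>adj k\<close> fixes \<open>e\<close> too. Then \<open>near_id\<close> applies
    to \<open>k\<close> composed with \<open>adj k\<close> for every \<open>\<delta>\<close> between
    0 and 1.\<close>
  have "ip e e = ?c * ip e e"
  proof -
    have "ip e e = ?c * ip (adj (inv k) e) e"
      using arg_cong[OF eq, of "\<lambda>x. ip x e"] by (simp only: scaleR_left real_scaleR_def)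
    then show ?thesis by (simp add: adj' aut_linear aut_inv k(1) inv_e)
  qed
  then have "?c = 1" using interior_nonzero[OF e(1)] by simp
  with eq have "adj (inv k) e = e" by simp
  then have "adj k e = e" using adj_inv(2)[OF k(1), of e] by simp
  then have fix_e: "1 *\<^sub>R k (adj k e) = e" using k(2) by simp
  have small: "ip (k (adj k x) - x) (k (adj k x) - x) \<le> \<delta>\<^sup>2 * ip x x" if "0 < \<delta>" "\<delta> < 1" for \<delta>
    using near_id[OF k(1) zero_less_one e(1) that, of x] unfolding fix_e
    using that interior_mem[OF e(1)] by (simp add: algebra_simps scale_mem)
  let ?n = "ip (k (adj k x) - x) (k (adj k x) - x)"
  have "(\<lambda>m. (inverse (real (Suc (Suc m))))\<^sup>2 * ip x x) \<longlonglongrightarrow> 0\<^sup>2 * ip x x"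
    by (intro tendsto_mult tendsto_power tendsto_const LIMSEQ_Suc[OF LIMSEQ_inverse_real_of_nat])
  moreover have "?n \<le> (inverse (real (Suc (Suc m))))\<^sup>2 * ip x x" for m
    by (rule small) (simp_all add: field_simps)
  ultimately have "?n \<le> 0\<^sup>2 * ip x x" by (intro LIMSEQ_le_const) auto
  then have "?n = 0" using self_nonneg[of "k (adj k x) - x"] by simp
  then show ?thesis by simp
qed

text \<open>Solve \<open>w + moment_deriv e w = u\<close>. The self-adjoint map \<open>P\<close>
  sends \<open>moment y\<close> to \<open>y\<close> for \<open>y = e + t *\<^sub>R w\<close>, and
  \<open>moment y\<close> is about \<open>e - t *\<^sub>R moment_deriv e w\<close>, so
  \<open>P\<close> moves \<open>e\<close> by about \<open>t *\<^sub>R u\<close>. By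
  \<open>near_id\<close> the difference quotients of \<open>P\<close> are bounded and have a
  convergent subsequence.\<close>

lemma moment_fixpoint_tangent_full:
  assumes e: "e \<in> interior C" "moment e = e"
  shows "tangent_full e"
  unfolding tangent_full_def
proof
  fix u
  let ?M = "moment_deriv e"
  have lin: "linear (\<lambda>w. w + ?M w)"
    using linear_compose_add[OF linear_id linear_moment_deriv[OF e(1)]] by (simp add: id_def)
  have "inj (\<lambda>w. w + ?M w)"
    unfolding linear_injective_0[OF lin]
  proof (intro allI impI)
    fix w assume "w + ?M w = 0"
    then have "ip w w + ip (?M w) w = 0" by (metis add_left zero_left)
    then have "ip w w = 0" using moment_deriv_nonneg[OF e(1), of w] self_nonneg[of w] by linarith
    then show "w = 0" by simp
  qed
  then obtain w where w: "w + ?M w = u" using linear_injective_imp_surjective[OF lin] by (metis surjD)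
  obtain B t0 where t0: "t0 > 0" and B: "B \<ge> 0"
    and yint: "\<And>t. 0 < t \<Longrightarrow> t < t0 \<Longrightarrow> e + t *\<^sub>R w \<in> interior C"
    and taylor: "\<And>t. 0 < t \<Longrightarrow> t < t0 \<Longrightarrow> norm ((moment (e + t *\<^sub>R w) - moment e) /\<^sub>R t + ?M w) \<le> t * B"
    by (rule moment_taylor[OF e(1)]) blast
  obtain \<epsilon> where \<epsilon>: "\<epsilon> > 0" "\<And>x s. norm x \<le> \<epsilon> * s \<Longrightarrow> s *\<^sub>R e + x \<in> C" "\<And>x s. norm x \<le> \<epsilon> * s \<Longrightarrow> s *\<^sub>R e - x \<in> C"
    using absorb[OF e(1)] by metis
  \<comment> \<open>\<open>c1\<close> bounds the difference quotients of \<open>moment\<close>;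
    \<open>c2\<close> makes both \<open>y\<close> and \<open>moment y\<close> lie between
    \<open>(1 - s) *\<^sub>R e\<close> and \<open>(1 + s) *\<^sub>R e\<close> for
    \<open>s = t * c2\<close>.\<close>
  define c1 where "c1 = norm (?M w) + t0 * B"
  have "c1 \<ge> 0" using t0 B by (simp add: c1_def)
  define c2 where "c2 = (norm w + c1) / \<epsilon> + 1"
  have c2: "c2 > 0" using \<epsilon>(1) \<open>c1 \<ge> 0\<close> by (simp add: c2_def add_nonneg_pos)
  have \<epsilon>c2: "norm w \<le> \<epsilon> * c2" "c1 \<le> \<epsilon> * c2"
  proof -
    have "\<epsilon> * c2 = norm w + c1 + \<epsilon>" unfolding c2_def using \<epsilon>(1) by (simp add: field_simps)
    then show "norm w \<le> \<epsilon> * c2" "c1 \<le> \<epsilon> * c2" using \<epsilon>(1) \<open>c1 \<ge> 0\<close> norm_ge_zero[of w] by linarith+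
  qed
  \<comment> \<open>Then \<open>s < 1/5\<close>, so \<open>4 * s\<close> is an admissible
    \<open>\<delta>\<close> for \<open>near_id\<close>.\<close>
  define t1 where "t1 = min t0 (1 / (5 * c2))"
  have t1: "t1 > 0" "t1 \<le> t0" "t1 \<le> 1 / (5 * c2)" using t0 c2 by (auto simp: t1_def)
  have comb: "(1 / a) *\<^sub>R (b *\<^sub>R x - a *\<^sub>R y) + (c - b / a) *\<^sub>R x = c *\<^sub>R x - y"
    "(1 / a) *\<^sub>R (a *\<^sub>R y - b *\<^sub>R x) + (b / a - c) *\<^sub>R x = y - c *\<^sub>R x"
    if "a \<noteq> 0" for a b c :: real and x y :: "real^'n"
    using that by (simp_all add: scaleR_diff_right scaleR_diff_left)
  have step: "\<exists>P. aut P \<and> adj P = P \<and> P (moment (e + t *\<^sub>R w)) = e + t *\<^sub>R w \<and>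
      (\<forall>x. ip (P x - x) (P x - x) \<le> (4 * (t * c2))\<^sup>2 * ip x x)" if t: "0 < t" "t < t1" for t
  proof -
    have tt: "t < t0" using t t1 by simp
    let ?y = "e + t *\<^sub>R w"
    define s where "s = t * c2"
    have s: "0 < s" using t c2 by (simp add: s_def)
    have "s < 1 / (5 * c2) * c2" unfolding s_def using t t1 c2 by (intro mult_strict_right_mono) auto
    then have s5: "s < 1 / 5" using c2 by simp
    note y = yint[OF t(1) tt]
    have ny: "norm (t *\<^sub>R w) \<le> \<epsilon> * s"
      using mult_left_mono[OF \<epsilon>c2(1), of t] t by (simp add: s_def mult_ac)
    have "norm ((moment ?y - e) /\<^sub>R t) \<le> norm ((moment ?y - e) /\<^sub>R t + ?M w) + norm (?M w)"
      by (metis add_diff_cancel norm_triangle_ineq4)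
    also have "\<dots> \<le> t * B + norm (?M w)" using taylor[OF t(1) tt] e(2) by simp
    also have "\<dots> \<le> c1" using tt B by (simp add: c1_def mult_right_mono)
    finally have "t * norm ((moment ?y - e) /\<^sub>R t) \<le> t * c1" using t by (intro mult_left_mono) auto
    moreover have "t * norm ((moment ?y - e) /\<^sub>R t) = norm (moment ?y - e)"
      using t by (simp only: norm_scaleR) simp
    ultimately have "norm (moment ?y - e) \<le> t * c1" by (simp only:)
    also have "\<dots> \<le> t * (\<epsilon> * c2)" using \<epsilon>c2(2) t by (intro mult_left_mono) auto
    finally have nm: "norm (moment ?y - e) \<le> \<epsilon> * s" by (simp add: s_def mult_ac)
    have y_up: "(1 + s) *\<^sub>R e - ?y \<in> C" and y_low: "?y - (1 - s) *\<^sub>R e \<in> C"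
      using \<epsilon>(3)[OF ny] \<epsilon>(2)[OF ny] by (simp_all add: algebra_simps)
    have m_up: "(1 + s) *\<^sub>R e - moment ?y \<in> C" and m_low: "moment ?y - (1 - s) *\<^sub>R e \<in> C"
      using \<epsilon>(3)[OF nm] \<epsilon>(2)[OF nm] by (simp_all add: algebra_simps)
    obtain g where g: "aut g" "g e = ?y" using aut_transitive[OF e(1) y] by blast
    define d where "d = vol_factor (adj g)"
    have d: "d > 0" "vol_factor (adj (inv g)) = 1 / d" using vol_factor_adj_inv[OF g(1)] by (simp_all add: d_def)
    define P where "P = (\<lambda>x. d *\<^sub>R g (adj g x))"
    have P: "aut P" unfolding P_def by (rule aut_scale[OF aut_comp[OF g(1) aut_adj[OF g(1)]] d(1)])
    note Plin = aut_linear[OF P]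
    have "adj P = P"
    proof
      show "adj P x = P x" for x
        by (rule adj_unique[OF _ Plin])
          (simp add: P_def scaleR_left scaleR_right adj[OF aut_linear[OF g(1)]] adj'[OF aut_linear[OF g(1)], symmetric])
    qed
    have "moment ?y = (1 / d) *\<^sub>R adj (inv g) e" using moment_aut[OF g(1) e(1)] g(2) e(2) d by simp
    then have Pm: "P (moment ?y) = ?y"
      using d(1) g by (simp add: P_def linear_cmul aut_linear aut_adj adj_inv)
    have "P (moment ?y - (1 - s) *\<^sub>R e) \<in> C" "P ((1 + s) *\<^sub>R e - moment ?y) \<in> C"
      using aut_mem[OF P] m_up m_low by blast+
    then have "?y - (1 - s) *\<^sub>R P e \<in> C" "(1 + s) *\<^sub>R P e - ?y \<in> C"
      by (simp_all only: linear_diff[OF Plin] linear_cmul[OF Plin] Pm)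
    \<comment> \<open>Eliminating \<open>y\<close> between the bounds for
      \<open>P (moment y)\<close> and for \<open>y\<close> itself leaves bounds on
      \<open>P e\<close>.\<close>
    from add_mem[OF this(1) y_up] add_mem[OF this(2) y_low]
    have "(1 + s) *\<^sub>R e - (1 - s) *\<^sub>R P e \<in> C" "(1 + s) *\<^sub>R P e - (1 - s) *\<^sub>R e \<in> C"
      by (simp_all add: algebra_simps)
    note mem = this
    have "4 * s * s \<le> 2 * s" using s s5 by simp
    then have "1 + s \<le> (1 + 4 * s) * (1 - s)" "(1 - 4 * s) * (1 + s) \<le> 1 - s"
      using s by (simp_all add: algebra_simps)
    then have "(1 + s) / (1 - s) \<le> 1 + 4 * s" "1 - 4 * s \<le> (1 - s) / (1 + s)"
      using pos_divide_le_eq[of "1 - s" "1 + s" "1 + 4 * s"] pos_le_divide_eq[of "1 + s" "1 - 4 * s" "1 - s"] s s5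
      by linarith+
    then have "(1 / (1 - s)) *\<^sub>R ((1 + s) *\<^sub>R e - (1 - s) *\<^sub>R P e) + (1 + 4 * s - (1 + s) / (1 - s)) *\<^sub>R e \<in> C"
      and "(1 / (1 + s)) *\<^sub>R ((1 + s) *\<^sub>R P e - (1 - s) *\<^sub>R e) + ((1 - s) / (1 + s) - (1 - 4 * s)) *\<^sub>R e \<in> C"
      using s s5
      by (auto intro!: add_mem[OF scale_mem[OF _ mem(1)] scale_mem[OF _ interior_mem[OF e(1)]]]
          add_mem[OF scale_mem[OF _ mem(2)] scale_mem[OF _ interior_mem[OF e(1)]]])
    moreover have "(1 / (1 - s)) *\<^sub>R ((1 + s) *\<^sub>R e - (1 - s) *\<^sub>R P e) + (1 + 4 * s - (1 + s) / (1 - s)) *\<^sub>R e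
        = (1 + 4 * s) *\<^sub>R e - P e"
      by (rule comb(1)) (use s5 in simp)
    moreover have "(1 / (1 + s)) *\<^sub>R ((1 + s) *\<^sub>R P e - (1 - s) *\<^sub>R e) + ((1 - s) / (1 + s) - (1 - 4 * s)) *\<^sub>R e
        = P e - (1 - 4 * s) *\<^sub>R e"
      by (rule comb(2)) (use s in simp)
    ultimately have "ip (P x - x) (P x - x) \<le> (4 * s)\<^sup>2 * ip x x" for x
      using near_id[OF g(1) d(1) e(1), of "4 * s" x] s s5 by (simp add: P_def)
    then show ?thesis using P \<open>adj P = P\<close> Pm s_def by blast
  qed
  define t where "t k = t1 / 2 * inverse (real (Suc k))" for k
  have t: "0 < t k" "t k < t1" for k
  proof -
    show "0 < t k" using t1 by (simp add: t_def)
    have "t k \<le> t1 / 2 * 1" unfolding t_def using t1 by (intro mult_left_mono) (auto simp: field_simps)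
    then show "t k < t1" using t1 by simp
  qed
  have t_lim: "t \<longlonglongrightarrow> 0"
    unfolding t_def[abs_def] using tendsto_mult_right_zero[OF LIMSEQ_inverse_real_of_nat] by blast
  define y where "y k = e + t k *\<^sub>R w" for k
  have "\<forall>k. \<exists>P. aut P \<and> adj P = P \<and> P (moment (y k)) = y k \<and>
      (\<forall>x. ip (P x - x) (P x - x) \<le> (4 * (t k * c2))\<^sup>2 * ip x x)"
    unfolding y_def using step t by blast
  then obtain P where P: "\<And>k. aut (P k)" "\<And>k. adj (P k) = P k" "\<And>k. P k (moment (y k)) = y k"
    "\<And>k x. ip (P k x - x) (P k x - x) \<le> (4 * (t k * c2))\<^sup>2 * ip x x" by metis
  define Q where "Q k x = (P k x - x) /\<^sub>R t k" for k x
  have Qlin: "linear (Q k)" for k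
    by (rule linearI) (simp_all add: Q_def linear_add linear_cmul aut_linear[OF P(1)] algebra_simps)
  obtain c where c: "c > 0" "\<And>x. c * (norm x)\<^sup>2 \<le> ip x x" by (rule self_ge_norm) blast
  obtain K where K: "K > 0" "\<And>x y. norm (ip x y) \<le> norm x * norm y * K" using pos_bounded by blast
  have Qbd: "norm (Q k x) \<le> sqrt ((4 * c2)\<^sup>2 * K / c) * norm x" for k x
  proof -
    have "ip (Q k x) (Q k x) = ip (P k x - x) (P k x - x) / (t k)\<^sup>2"
      by (simp add: Q_def scaleR_left scaleR_right power2_eq_square divide_inverse mult_ac)
    also have "\<dots> \<le> (4 * (t k * c2))\<^sup>2 * ip x x / (t k)\<^sup>2" by (intro divide_right_mono P) auto
    also have "\<dots> = (4 * c2)\<^sup>2 * ip x x" using t(1)[of k] by (simp add: power_mult_distrib)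
    also have "\<dots> \<le> (4 * c2)\<^sup>2 * (K * (norm x)\<^sup>2)"
      using K(2)[of x x] by (intro mult_left_mono) (auto simp: power2_eq_square mult_ac)
    finally have "c * (norm (Q k x))\<^sup>2 \<le> (4 * c2)\<^sup>2 * (K * (norm x)\<^sup>2)" using c(2)[of "Q k x"] by linarith
    then have "(norm (Q k x))\<^sup>2 \<le> (4 * c2)\<^sup>2 * K / c * (norm x)\<^sup>2" using c(1) by (simp add: field_simps)
    then have "sqrt ((norm (Q k x))\<^sup>2) \<le> sqrt ((4 * c2)\<^sup>2 * K / c * (norm x)\<^sup>2)" by (rule real_sqrt_le_mono)
    then show ?thesis by (simp only: real_sqrt_mult real_sqrt_abs abs_norm_cancel)
  qed
  obtain r X where rX: "strict_mono r" "linear X" "\<And>x. (\<lambda>k. Q (r k) x) \<longlonglongrightarrow> X x"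
    by (rule linear_seq_compact[of Q, OF Qlin Qbd]) (erule (1) that)
  have t_r: "(\<lambda>k. t (r k)) \<longlonglongrightarrow> 0" using LIMSEQ_subseq_LIMSEQ[OF t_lim rX(1)] by (simp add: o_def)
  note lim = moment_limits[OF e(1) t(1) t_r, of w]
  have "(\<lambda>k. Q (r k) (moment (y (r k)))) \<longlonglongrightarrow> X e"
    using lim(2) e(2) by (intro tendsto_linear_seq[of "\<lambda>k. Q (r k)", OF Qlin Qbd rX(3)]) (simp add: y_def)
  \<comment> \<open>\<open>P k\<close> is known exactly at \<open>moment (y k)\<close>, and this
    point tends to \<open>e\<close>; the uniform bound on \<open>Q\<close> lets the limit
    \<open>X e\<close> be read off there.\<close>
  moreover have "Q k (moment (y k)) = w - (moment (y k) - moment e) /\<^sub>R t k" for k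
  proof -
    have "y k - moment (y k) = t k *\<^sub>R w - (moment (y k) - e)" by (simp add: y_def)
    then have "Q k (moment (y k)) = (t k *\<^sub>R w - (moment (y k) - e)) /\<^sub>R t k"
      by (simp only: Q_def P(3))
    also have "\<dots> = w - (moment (y k) - e) /\<^sub>R t k"
      using t(1)[of k] by (subst scaleR_diff_right) simp
    finally show ?thesis by (simp only: e(2))
  qed
  moreover have "(\<lambda>k. w - (moment (y (r k)) - moment e) /\<^sub>R t (r k)) \<longlonglongrightarrow> w - - ?M w"
    unfolding y_def by (intro tendsto_diff tendsto_const lim(1))
  ultimately have "X e = w - - ?M w" using LIMSEQ_unique by simp
  then have "X e = u" using w by simp
  then show "\<exists>P X t. (\<forall>k. aut (P k) \<and> adj (P k) = P k \<and> 0 < t k) \<and> t \<longlonglongrightarrow> 0 \<and>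
     (\<forall>x. (\<lambda>k. (P k x - x) /\<^sub>R t k) \<longlonglongrightarrow> X x) \<and> X e = u"
    using P(1,2) t(1) t_r rX(3) unfolding Q_def
    by (intro exI[of _ "\<lambda>k. P (r k)"] exI[of _ X] exI[of _ "\<lambda>k. t (r k)"]) blast
qed

section \<open>Optimal automorphisms\<close>

text \<open>The conditions on \<open>a0\<close> and \<open>b0\<close> make the objective control
  operator norms, so a minimizer \<open>h\<close> exists. If the hulls of the active points were
  disjoint, a separating direction \<open>u\<close> would be a direction in which a self-adjoint
  perturbation of \<open>h\<close> lowers the objective.\<close>

lemma minimax_automorphism:
  assumes e: "e \<in> interior C" "tangent_full e"
    and A: "finite A" "A \<noteq> {}" "A \<subseteq> C" and B: "finite B" "B \<noteq> {}" "B \<subseteq> C"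
    and a0: "a0 \<in> interior C" "\<And>y c. y \<in> C \<Longrightarrow> (\<And>a. a \<in> A \<Longrightarrow> ip a y \<le> c) \<Longrightarrow> ip a0 y \<le> KA * c"
    and b0: "b0 \<in> interior C" "\<And>y c. y \<in> C \<Longrightarrow> (\<And>b. b \<in> B \<Longrightarrow> ip b y \<le> c) \<Longrightarrow> ip b0 y \<le> KB * c"
  obtains g z where "aut g" "z \<in> convex hull (g ` A)" "z \<in> convex hull (adj (inv g) ` B)"
    "\<And>a. a \<in> A \<Longrightarrow> ip (g a) e \<le> ip z e" "\<And>b. b \<in> B \<Longrightarrow> ip (adj (inv g) b) e \<le> ip z e"
proof -
  define fA fB f where "fA g = Max ((\<lambda>a. ip (g a) e) ` A)" and "fB g = Max ((\<lambda>b. ip (adj (inv g) b) e) ` B)"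
    and "f g = fA g + fB g" for g
  have fA_ge: "ip (g a) e \<le> fA g" if "a \<in> A" for g a using A that by (simp add: fA_def)
  have fB_ge: "ip (adj (inv g) b) e \<le> fB g" if "b \<in> B" for g b using B that by (simp add: fB_def)
  have fA_ex: "\<exists>a\<in>A. fA g = ip (g a) e" for g
  proof -
    have "fA g \<in> (\<lambda>a. ip (g a) e) ` A" unfolding fA_def by (intro Max_in) (use A in auto)
    then show ?thesis by blast
  qed
  have fB_ex: "\<exists>b\<in>B. fB g = ip (adj (inv g) b) e" for g
  proof -
    have "fB g \<in> (\<lambda>b. ip (adj (inv g) b) e) ` B" unfolding fB_def by (intro Max_in) (use B in auto)
    then show ?thesis by blast
  qed
  have fA_nonneg: "0 \<le> fA g" if "aut g" for g
    using fA_ex[of g] A(3) ip_nonneg[OF aut_mem[OF that] interior_mem[OF e(1)]] by auto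
  have fB_nonneg: "0 \<le> fB g" if "aut g" for g
    using fB_ex[of g] B(3) ip_nonneg[OF aut_adj_mem[OF aut_inv[OF that]] interior_mem[OF e(1)]] by auto
  have "\<exists>g l. (\<forall>k. aut (g k)) \<and> (\<lambda>k. f (g k)) \<longlonglongrightarrow> l \<and> (\<forall>k. f (g k) < l + 1) \<and> (\<forall>g'. aut g' \<longrightarrow> l \<le> f g')"
  proof (rule minimizing_sequence[of "{g. aut g}" f])
    show "{g. aut g} \<noteq> {}" using aut_id by blast
    show "0 \<le> f g" if "g \<in> {g. aut g}" for g using fA_nonneg fB_nonneg that by (simp add: f_def)
    fix g l assume "\<And>k. g k \<in> {g. aut g}" "(\<lambda>k. f (g k)) \<longlonglongrightarrow> l" "\<And>k. f (g k) < l + 1"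
      "\<And>g'. g' \<in> {g. aut g} \<Longrightarrow> l \<le> f g'"
    then show ?thesis by (intro exI[of _ g] exI[of _ l]) auto
  qed
  then obtain g l where g: "\<And>k. aut (g k)" and gl: "(\<lambda>k. f (g k)) \<longlonglongrightarrow> l" "\<And>k. f (g k) < l + 1"
    "\<And>g'. aut g' \<Longrightarrow> l \<le> f g'" by blast
  \<comment> \<open>Moving \<open>g k\<close> to the other side, the condition on \<open>a0\<close>
    applies to \<open>y = adj (g k) e\<close>.\<close>
  have bound_a: "ip (g k a0) e \<le> KA * (l + 1)" for k
  proof -
    have "ip a0 (adj (g k) e) \<le> KA * (l + 1)"
    proof (rule a0(2))
      show "adj (g k) e \<in> C" by (intro aut_adj_mem g interior_mem e)
      show "ip a (adj (g k) e) \<le> l + 1" if "a \<in> A" for a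
        using fA_ge[OF that, of "g k"] fB_nonneg[OF g, of k] gl(2)[of k]
        by (simp add: f_def adj[symmetric] aut_linear g)
    qed
    then show ?thesis by (simp add: adj[symmetric] aut_linear g)
  qed
  have bound_b: "ip (adj (inv (g k)) b0) e \<le> KB * (l + 1)" for k
  proof -
    have "ip b0 (inv (g k) e) \<le> KB * (l + 1)"
    proof (rule b0(2))
      show "inv (g k) e \<in> C" by (rule aut_mem[OF aut_inv[OF g] interior_mem[OF e(1)]])
      show "ip b (inv (g k) e) \<le> l + 1" if "b \<in> B" for b
        using fB_ge[OF that, of "g k"] fA_nonneg[OF g, of k] gl(2)[of k]
        by (simp add: f_def adj' aut_linear aut_inv g)
    qed
    then show ?thesis by (simp add: adj' aut_linear aut_inv g)
  qed
  obtain r h where rh: "strict_mono r" "aut h" "\<And>x. (\<lambda>k. g (r k) x) \<longlonglongrightarrow> h x"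
    "\<And>x. (\<lambda>k. adj (inv (g (r k))) x) \<longlonglongrightarrow> adj (inv h) x"
    by (rule aut_seq_compact[of g, OF g a0(1) b0(1) e(1) bound_a bound_b]) (erule (1) that)
  have "ip (h a) e + ip (adj (inv h) b) e \<le> l" if ab: "a \<in> A" "b \<in> B" for a b
  proof (rule LIMSEQ_le)
    show "(\<lambda>k. ip (g (r k) a) e + ip (adj (inv (g (r k))) b) e) \<longlonglongrightarrow> ip (h a) e + ip (adj (inv h) b) e"
      by (intro tendsto_add tendsto rh tendsto_const)
    show "(\<lambda>k. f (g (r k))) \<longlonglongrightarrow> l" using LIMSEQ_subseq_LIMSEQ[OF gl(1) rh(1)] by (simp add: o_def)
    show "\<exists>N. \<forall>n\<ge>N. ip (g (r n) a) e + ip (adj (inv (g (r n))) b) e \<le> f (g (r n))"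
      unfolding f_def using fA_ge[OF ab(1)] fB_ge[OF ab(2)] by (intro exI allI impI add_mono) auto
  qed
  then have fh: "fA h + fB h \<le> l" using fA_ex[of h] fB_ex[of h] by metis
  define MA MB where "MA = fA h" and "MB = fB h"
  \<comment> \<open>The active points, at which the two maxima are attained.\<close>
  define A' B' where "A' = {a \<in> h ` A. ip a e = MA}" and "B' = {b \<in> adj (inv h) ` B. ip b e = MB}"
  have A': "finite A'" "A' \<noteq> {}" using A(1) fA_ex[of h] by (auto simp: A'_def MA_def)
  have B': "finite B'" "B' \<noteq> {}" using B(1) fB_ex[of h] by (auto simp: B'_def MB_def)
  have hull_A: "ip z e = MA" if "z \<in> convex hull A'" for z
  proof -
    have "convex {x. ip x e = MA}" unfolding convex_def
      by (auto simp: add_left scaleR_left simp flip: distrib_right)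
    then have "convex hull A' \<subseteq> {x. ip x e = MA}" by (intro hull_minimal) (auto simp: A'_def)
    then show ?thesis using that by blast
  qed
  have hull_B: "ip z e = MB" if "z \<in> convex hull B'" for z
  proof -
    have "convex {x. ip x e = MB}" unfolding convex_def
      by (auto simp: add_left scaleR_left simp flip: distrib_right)
    then have "convex hull B' \<subseteq> {x. ip x e = MB}" by (intro hull_minimal) (auto simp: B'_def)
    then show ?thesis using that by blast
  qed
  have "convex hull A' \<inter> convex hull B' \<noteq> {}"
  proof
    assume disj: "convex hull A' \<inter> convex hull B' = {}"
    have "compact (convex hull A')" "compact (convex hull B')"
      using A' B' by (auto intro!: finite_imp_compact_convex_hull)
    then obtain n c where nc: "\<And>x. x \<in> convex hull A' \<Longrightarrow> n \<bullet> x < c" "\<And>x. x \<in> convex hull B' \<Longrightarrow> n \<bullet> x > c"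
      using separating_hyperplane_closed_compact[of "convex hull A'" "convex hull B'"] disj B'(2)
      by (metis compact_imp_closed convex_convex_hull convex_hull_eq_empty)
    obtain u where u: "\<And>x. ip u x = n \<bullet> x"
      using Riesz[of "\<lambda>x. n \<bullet> x"] bounded_linear.linear[OF bounded_linear_inner_right] by blast
    have uA: "ip a u < c" if "a \<in> A'" for a
      using nc(1)[OF hull_inc[OF that]] u[of a] commute[of a u] by simp
    have uB: "ip b u > c" if "b \<in> B'" for b
      using nc(2)[OF hull_inc[OF that]] u[of b] commute[of b u] by simp
    obtain P X t where P: "\<And>k. aut (P k)" "\<And>k. adj (P k) = P k" and t: "\<And>k. 0 < t k" "t \<longlonglongrightarrow> 0"
      and X: "\<And>x. (\<lambda>k. (P k x - x) /\<^sub>R t k) \<longlonglongrightarrow> X x" and Xe: "X e = u"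
      using e(2)[unfolded tangent_full_def, rule_format, of u] by blast
    define q where "q k = (P k e - e) /\<^sub>R t k" for k
    have q: "q \<longlonglongrightarrow> u" using X[of e] Xe by (simp add: q_def[abs_def])
    have Pe: "P k e = e + t k *\<^sub>R q k" for k using t(1)[of k] by (simp add: q_def)
    have P_lim: "(\<lambda>k. P k x) \<longlonglongrightarrow> x" for x
    proof -
      have "(\<lambda>k. t k *\<^sub>R ((P k x - x) /\<^sub>R t k) + x) \<longlonglongrightarrow> 0 *\<^sub>R X x + x"
        by (intro tendsto_add tendsto_scaleR t(2) X tendsto_const)
      moreover have "t k *\<^sub>R ((P k x - x) /\<^sub>R t k) + x = P k x" for k using t(1)[of k] by simp
      ultimately show ?thesis by simp
    qed
    \<comment> \<open>The first-order displacement of \<open>inv (P k) e\<close>, taken with the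
      opposite sign.\<close>
    define q' where "q' k = inv (P k) (q k)" for k
    have inv_Pe: "inv (P k) e = e - t k *\<^sub>R q' k" for k
    proof -
      have "inv (P k) (P k e) = inv (P k) e + t k *\<^sub>R q' k"
        unfolding Pe q'_def by (simp add: linear_add linear_cmul aut_linear aut_inv P(1))
      then show ?thesis using P(1) by (simp add: algebra_simps)
    qed
    have q': "q' \<longlonglongrightarrow> u"
    proof -
      obtain K where K: "K > 0"
        "\<And>g (x :: real^'n). linear g \<Longrightarrow> g ` C \<subseteq> C \<Longrightarrow> norm (g x) \<le> K * ip (g e) e * norm x"
        using op_bound[OF e(1,1)] by metis
      have "(\<lambda>k. P k e - (1/2) *\<^sub>R e) \<longlonglongrightarrow> e - (1/2) *\<^sub>R e" by (intro tendsto_diff P_lim tendsto_const)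
      moreover have "e - (1/2) *\<^sub>R e = (1/2) *\<^sub>R e"
        using scaleR_left_diff_distrib[of 1 "1/2" e] by simp
      then have "e - (1/2) *\<^sub>R e \<in> interior C"
        using interior_scale[OF e(1), of "1/2"] by (simp only:)
      ultimately have "\<forall>\<^sub>F k in sequentially. P k e - (1/2) *\<^sub>R e \<in> interior C"
        by (intro topological_tendstoD[OF _ open_interior])
      \<comment> \<open>Once \<open>P k e\<close> dominates half of \<open>e\<close>,
        \<open>inv (P k) e\<close> is dominated by twice \<open>e\<close>, and
        \<open>op_bound\<close> bounds the inverses uniformly.\<close>
      then have "\<forall>\<^sub>F k in sequentially. norm (q' k - u) \<le> K * (2 * ip e e) * norm (q k - P k u)"
      proof eventually_elim
        fix k assume "P k e - (1/2) *\<^sub>R e \<in> interior C"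
        then have "inv (P k) (P k e - (1/2) *\<^sub>R e) \<in> C" by (intro aut_mem[OF aut_inv[OF P(1)]] interior_mem)
        then have "e - (1/2) *\<^sub>R inv (P k) e \<in> C"
          using P(1) by (simp add: linear_diff linear_cmul aut_linear aut_inv)
        from ip_nonneg[OF this interior_mem[OF e(1)]] have "ip (inv (P k) e) e \<le> 2 * ip e e"
          by (simp add: diff_left scaleR_left)
        then have "K * ip (inv (P k) e) e * norm (q k - P k u) \<le> K * (2 * ip e e) * norm (q k - P k u)"
          using K(1) by (intro mult_right_mono mult_left_mono) auto
        moreover have "q' k - u = inv (P k) (q k - P k u)"
          unfolding q'_def using P(1) by (simp add: linear_diff aut_linear aut_inv)
        moreover have "inv (P k) ` C \<subseteq> C" using aut_image[OF aut_inv[OF P(1)]] by simp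
        ultimately show "norm (q' k - u) \<le> K * (2 * ip e e) * norm (q k - P k u)"
          using K(2)[OF aut_linear[OF aut_inv[OF P(1)]], of k "q k - P k u"] by simp
      qed
      moreover have "(\<lambda>k. K * (2 * ip e e) * norm (q k - P k u)) \<longlonglongrightarrow> 0"
        using tendsto_mult_left[OF tendsto_norm[OF tendsto_diff[OF q P_lim[of u]]], of "K * (2 * ip e e)"] by simp
      ultimately have "(\<lambda>k. q' k - u) \<longlonglongrightarrow> 0" by (rule Lim_null_comparison)
      then show ?thesis by (simp add: LIM_zero_iff)
    qed
    have evA: "\<forall>\<^sub>F k in sequentially. ip a (P k e) < MA + t k * c" if a: "a \<in> h ` A" for a
    proof (cases "ip a e = MA")
      case True
      have "(\<lambda>k. ip a (q k)) \<longlonglongrightarrow> ip a u" by (intro tendsto tendsto_const q)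
      moreover have "ip a u < c" using uA a True by (simp add: A'_def)
      ultimately have "\<forall>\<^sub>F k in sequentially. ip a (q k) < c" by (rule order_tendstoD)
      then show ?thesis
        by eventually_elim (use t True in \<open>simp add: Pe add_right scaleR_right\<close>)
    next
      case False
      have "ip a e < MA" using a False fA_ge[of _ h] by (force simp: MA_def)
      moreover have "(\<lambda>k. MA + t k * c - ip a (P k e)) \<longlonglongrightarrow> MA + 0 * c - ip a e"
        by (intro tendsto_diff tendsto_add tendsto_mult tendsto_const t(2) tendsto P_lim)
      ultimately have "\<forall>\<^sub>F k in sequentially. 0 < MA + t k * c - ip a (P k e)"
        by (intro order_tendstoD(1)) auto
      then show ?thesis by eventually_elim simp
    qed
    have evB: "\<forall>\<^sub>F k in sequentially. ip b (inv (P k) e) < MB - t k * c" if b: "b \<in> adj (inv h) ` B" for b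
    proof (cases "ip b e = MB")
      case True
      have "(\<lambda>k. ip b (q' k)) \<longlonglongrightarrow> ip b u" by (intro tendsto tendsto_const q')
      moreover have "c < ip b u" using uB b True by (simp add: B'_def)
      ultimately have "\<forall>\<^sub>F k in sequentially. c < ip b (q' k)" by (rule order_tendstoD)
      then show ?thesis
        by eventually_elim (use t True in \<open>simp add: inv_Pe diff_right scaleR_right\<close>)
    next
      case False
      have "ip b e < MB" using b False fB_ge[of _ h] by (force simp: MB_def)
      moreover have "(\<lambda>k. MB - t k * c - ip b (e - t k *\<^sub>R q' k)) \<longlonglongrightarrow> MB - 0 * c - ip b (e - 0 *\<^sub>R u)"
        by (intro tendsto_diff tendsto_mult tendsto_const t(2) tendsto tendsto_scaleR q')
      ultimately have "\<forall>\<^sub>F k in sequentially. 0 < MB - t k * c - ip b (e - t k *\<^sub>R q' k)"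
        by (intro order_tendstoD(1)) auto
      then show ?thesis by eventually_elim (simp add: inv_Pe)
    qed
    have "\<forall>\<^sub>F k in sequentially. (\<forall>a\<in>h ` A. ip a (P k e) < MA + t k * c) \<and>
        (\<forall>b\<in>adj (inv h) ` B. ip b (inv (P k) e) < MB - t k * c)"
      using A(1) B(1) evA evB by (intro eventually_conj eventually_ball_finite) auto
    from eventually_happens'[OF sequentially_bot this] obtain k
      where k: "\<And>a. a \<in> A \<Longrightarrow> ip (h a) (P k e) < MA + t k * c"
        "\<And>b. b \<in> B \<Longrightarrow> ip (adj (inv h) b) (inv (P k) e) < MB - t k * c"
      by blast
    \<comment> \<open>Self-adjointness moves \<open>P k\<close> onto \<open>e\<close>. The first
      maximum becomes less than \<open>MA + t k * c\<close> and the second less than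
      \<open>MB - t k * c\<close>, so their sum falls below \<open>l\<close>.\<close>
    define g' where "g' = (\<lambda>x. P k (h x))"
    have g': "aut g'" unfolding g'_def by (rule aut_comp[OF P(1) rh(2)])
    have inv_g': "inv g' x = inv h (inv (P k) x)" for x
      using P(1)[of k] rh(2) by (metis aut_inv_f[OF g'] aut_f_inv g'_def)
    have "ip (g' a) e < MA + t k * c" if "a \<in> A" for a
      using k(1)[OF that] adj[OF aut_linear[OF P(1)], of k "h a" e] P(2) by (simp add: g'_def)
    then have 1: "fA g' < MA + t k * c" using fA_ex[of g'] by auto
    have "ip (adj (inv g') b) e < MB - t k * c" if "b \<in> B" for b
    proof -
      have "ip (adj (inv g') b) e = ip b (inv h (inv (P k) e))"
        by (simp add: adj' aut_linear aut_inv g' inv_g')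
      also have "\<dots> = ip (adj (inv h) b) (inv (P k) e)" by (simp add: adj' aut_linear aut_inv rh(2))
      finally show ?thesis using k(2)[OF that] by simp
    qed
    then have 2: "fB g' < MB - t k * c" using fB_ex[of g'] by auto
    have "f g' < l" using 1 2 fh by (simp add: f_def MA_def MB_def)
    with gl(3)[OF g'] show False by simp
  qed
  then obtain z where z: "z \<in> convex hull A'" "z \<in> convex hull B'" by blast
  show ?thesis
  proof (rule that[OF rh(2), of z])
    show "z \<in> convex hull (h ` A)" using z(1) hull_mono[of A' "h ` A"] by (auto simp: A'_def)
    show "z \<in> convex hull (adj (inv h) ` B)" using z(2) hull_mono[of B' "adj (inv h) ` B"] by (auto simp: B'_def)
    show "ip (h a) e \<le> ip z e" if "a \<in> A" for a using hull_A[OF z(1)] fA_ge[OF that] by (simp add: MA_def)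
    show "ip (adj (inv h) b) e \<le> ip z e" if "b \<in> B" for b using hull_B[OF z(2)] fB_ge[OF that] by (simp add: MB_def)
  qed
qed

text \<open>For singletons the hulls are points, so \<open>g x = adj (inv g) s\<close>, and
  \<open>adj g\<close> composed with \<open>g\<close> is the required map.\<close>

lemma self_adjoint_transitive:
  assumes e: "e \<in> interior C" "tangent_full e" and xs: "x \<in> interior C" "s \<in> interior C"
  obtains L where "aut L" "adj L = L" "L x = s"
proof -
  obtain g z where g: "aut g" "z \<in> convex hull (g ` {x})" "z \<in> convex hull (adj (inv g) ` {s})"
    by (rule minimax_automorphism[OF e, of "{x}" "{s}" x 1 s 1]) (use xs interior_mem in auto)
  then have "g x = adj (inv g) s" by simp
  then have "adj g (g x) = s" by (simp add: adj_inv(2)[OF g(1)])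
  moreover have L: "aut (\<lambda>x. adj g (g x))" by (rule aut_comp[OF aut_adj[OF g(1)] g(1)])
  moreover have "adj (\<lambda>x. adj g (g x)) = (\<lambda>x. adj g (g x))"
    by (rule ext, rule adj_unique[OF _ aut_linear[OF L]])
      (simp add: adj'[OF aut_linear[OF g(1)]] adj[OF aut_linear[OF g(1)], symmetric])
  ultimately show ?thesis by (rule that[rotated -1])
qed

lemma ip_extremal_pos: "extremal v \<Longrightarrow> e \<in> interior C \<Longrightarrow> 0 < ip v e"
  using interior_pos by (auto simp: extremal_def)

lemma extremal_eqI:
  assumes "\<And>v. extremal v \<Longrightarrow> ip v x = ip v y" shows "x = y"
proof -
  have *: "ip w x = ip w y" if w: "w \<in> C" for w
  proof -
    obtain vs where vs: "\<And>v. v \<in> set vs \<Longrightarrow> v = 0 \<or> extremal v" "w = sum_list vs"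
      using caratheodory_decomposition[OF w] by metis
    have "(\<Sum>v\<leftarrow>vs. ip v x) = (\<Sum>v\<leftarrow>vs. ip v y)"
      by (rule arg_cong[of _ _ sum_list], rule map_cong[OF refl]) (use vs(1) assms zero_left in metis)
    then show ?thesis by (simp add: vs(2) sum_list_left)
  qed
  show ?thesis
  proof (rule eqI)
    fix w
    obtain w' w'' where "w' \<in> C" "w'' \<in> C" "w = w' - w''" by (rule diff_mem_C)
    then show "ip w x = ip w y" using * by (simp add: diff_left)
  qed
qed

end

section \<open>Rank-one limits and the trace vector\<close>

locale based_cone = self_dual_homogeneous_cone ip C
  for ip :: "real^'n \<Rightarrow> real^'n \<Rightarrow> real" and C +
  fixes b :: "real^'n"
  assumes base: "b \<in> interior C" and stabilizer: "\<And>k x. aut k \<Longrightarrow> k b = b \<Longrightarrow> k (adj k x) = x"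
    and base_tangent: "tangent_full b"
begin

text \<open>The limit \<open>h\<close> is self-adjoint, preserves \<open>C\<close> and maps
  \<open>b\<close> to \<open>v\<close>. Each \<open>x\<close> in \<open>C\<close> lies below a
  multiple of \<open>b\<close>, so \<open>h x\<close> lies below a multiple of \<open>v\<close> and
  is itself one by extremality; self-adjointness determines the factor.\<close>

lemma rank_one_limit:
  fixes L :: "nat \<Rightarrow> real^'n \<Rightarrow> real^'n"
  assumes v: "extremal v" and L: "\<And>k. aut (L k)" "\<And>k. adj (L k) = L k" and lim: "(\<lambda>k. L k b) \<longlonglongrightarrow> v"
  obtains r B where "strict_mono r" "\<And>x. (\<lambda>k. L (r k) x) \<longlonglongrightarrow> (ip v x / ip v b) *\<^sub>R v" "\<And>k x. norm (L k x) \<le> B * norm x"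
proof -
  have "(\<lambda>k. ip (L k b) b) \<longlonglongrightarrow> ip v b" by (intro tendsto lim tendsto_const)
  then obtain c where "\<And>k. norm (ip (L k b) b) \<le> c"
    using Bseq_def convergentI convergent_imp_Bseq by metis
  then have c: "ip (L k b) b \<le> c" for k by (metis abs_le_iff real_norm_def)
  have sub: "L k ` C \<subseteq> C" for k using aut_image[OF L(1)] by simp
  obtain r h B where rh: "strict_mono r" "linear h" "\<And>x. (\<lambda>k. L (r k) x) \<longlonglongrightarrow> h x" "h ` C \<subseteq> C"
    "\<And>k x. norm (L k x) \<le> B * norm x"
    by (rule cone_maps_seq_compact[of L, OF aut_linear[OF L(1)] sub base base c]) (erule (1) that)
  have hb: "h b = v"
    using LIMSEQ_unique[OF rh(3)[of b]] LIMSEQ_subseq_LIMSEQ[OF lim rh(1)] by (simp add: o_def)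
  have sa: "ip (h x) y = ip x (h y)" for x y
  proof (rule LIMSEQ_unique)
    show "(\<lambda>k. ip (L (r k) x) y) \<longlonglongrightarrow> ip (h x) y" by (intro tendsto rh tendsto_const)
    have "ip (L (r k) x) y = ip x (L (r k) y)" for k using adj[OF aut_linear[OF L(1)]] L(2) by metis
    then show "(\<lambda>k. ip (L (r k) x) y) \<longlonglongrightarrow> ip x (h y)" by (simp only:) (intro tendsto rh tendsto_const)
  qed
  have pos: "ip v b > 0" by (rule ip_extremal_pos[OF v base])
  have on_C: "h x = (ip v x / ip v b) *\<^sub>R v" if x: "x \<in> C" for x
  proof -
    obtain \<epsilon> where \<epsilon>: "\<epsilon> > 0" "\<And>x s. norm x \<le> \<epsilon> * s \<Longrightarrow> s *\<^sub>R b - x \<in> C" using absorb[OF base] by metis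
    define s where "s = norm x / \<epsilon> + 1"
    have s: "s > 0" using \<epsilon>(1) by (simp add: s_def add_nonneg_pos)
    have "s *\<^sub>R b - x \<in> C" using \<epsilon>(1) by (intro \<epsilon>(2)) (simp add: s_def distrib_left)
    then have "h (s *\<^sub>R b - x) \<in> C" "h x \<in> C" using rh(4) x by blast+
    then have "(1 / s) *\<^sub>R (s *\<^sub>R v - h x) \<in> C" "(1 / s) *\<^sub>R h x \<in> C"
      using s scale_mem[of "1 / s"] by (simp_all only: linear_diff[OF rh(2)] linear_cmul[OF rh(2)] hb) simp_all
    moreover have "(1 / s) *\<^sub>R (s *\<^sub>R v - h x) = v - (1 / s) *\<^sub>R h x"
      using s by (simp add: scaleR_diff_right)
    ultimately have "v - (1 / s) *\<^sub>R h x \<in> C" "(1 / s) *\<^sub>R h x \<in> C"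
      by (simp_all only:)
    then obtain \<rho> where "(1 / s) *\<^sub>R h x = \<rho> *\<^sub>R v" using v unfolding extremal_def by blast
    from arg_cong[OF this, of "scaleR s"] have hx: "h x = (s * \<rho>) *\<^sub>R v" using s by simp
    have "s * \<rho> * ip v b = ip v x" using sa[of x b] hx hb commute[of x v] by (simp add: scaleR_left)
    then have "s * \<rho> = ip v x / ip v b" using pos by (simp add: field_simps)
    with hx show ?thesis by simp
  qed
  have "h x = (ip v x / ip v b) *\<^sub>R v" for x
  proof -
    obtain x' x'' where x: "x' \<in> C" "x'' \<in> C" "x = x' - x''" by (rule diff_mem_C)
    then show ?thesis
      by (simp add: linear_diff[OF rh(2)] on_C diff_right diff_divide_distrib scaleR_diff_left)
  qed
  then show ?thesis using that[OF rh(1) _ rh(5)] rh(3) by simp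
qed

text \<open>Invariant under nonzero scaling of \<open>v\<close>, hence a quantity attached to the
  ray.\<close>

definition ray_weight :: "real^'n \<Rightarrow> real" where
  "ray_weight v = ip v v / (ip v b)\<^sup>2"

lemma approx_base: "v \<in> C \<Longrightarrow> v + inverse (real (Suc k)) *\<^sub>R b \<in> interior C"
  by (rule interior_add[OF interior_scale[OF base]]) auto

lemma approx_base_lim: "(\<lambda>k. v + inverse (real (Suc k)) *\<^sub>R b) \<longlonglongrightarrow> v"
proof -
  have "(\<lambda>k. v + inverse (real (Suc k)) *\<^sub>R b) \<longlonglongrightarrow> v + 0 *\<^sub>R b"
    by (intro tendsto_add tendsto_const tendsto_scaleR LIMSEQ_inverse_real_of_nat)
  then show ?thesis by simp
qed

lemma ex_self_adjoint_seq:
  assumes "\<And>k. w k \<in> interior C"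
  obtains L where "\<And>k::nat. aut (L k)" "\<And>k. adj (L k) = L k" "\<And>k. L k b = w k"
proof -
  have "\<exists>L. aut L \<and> adj L = L \<and> L b = w k" for k
    using self_adjoint_transitive[OF base base_tangent base assms] by metis
  then show ?thesis using that by metis
qed

text \<open>
  With \<open>L\<close> and \<open>L'\<close> self-adjoint, \<open>Lb = w\<close> and \<open>L'b = gw\<close>, the map \<open>(L')\<^sup>-\<^sup>1 g L\<close> fixes \<open>b\<close>, hence is
  orthogonal, and \<open>g L\<^sup>2 g* = (L')\<^sup>2\<close>. The invariance follows by letting \<open>w\<close> tend to \<open>v\<close>.
\<close>

lemma ray_weight_aut:
  assumes g: "aut g" and v: "extremal v"
  shows "ray_weight (g v) = ray_weight v"
proof -
  note gv = extremal_aut[OF g v]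
  have vC: "v \<in> C" using v by (simp add: extremal_def)
  let ?w = "\<lambda>k. v + inverse (real (Suc k)) *\<^sub>R b"
  obtain L where L: "\<And>k::nat. aut (L k)" "\<And>k. adj (L k) = L k" "\<And>k. L k b = ?w k"
    by (rule ex_self_adjoint_seq[of ?w, OF approx_base[OF vC]]) blast
  obtain L' where L': "\<And>k::nat. aut (L' k)" "\<And>k. adj (L' k) = L' k" "\<And>k. L' k b = g (?w k)"
    by (rule ex_self_adjoint_seq[of "\<lambda>k. g (?w k)", OF aut_interior[OF g approx_base[OF vC]]]) blast
  have square: "g (L k (L k (adj g y))) = L' k (L' k y)" for k y
  proof -
    define h where "h = (\<lambda>x. inv (L' k) (g (L k x)))"
    have h: "aut h" unfolding h_def by (rule aut_comp[OF aut_inv[OF L'(1)] aut_comp[OF g L(1)]])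
    have "h b = b" using L(3) L'(3) L'(1) by (metis aut_inv_f h_def)
    have inv_sa: "adj (inv (L' k)) = inv (L' k)" using inv_adj[OF L'(1)] L'(2) by metis
    have adj_h: "adj h x = L k (adj g (inv (L' k) x))" for x
    proof (rule adj_unique[OF _ aut_linear[OF h]])
      fix z
      have "ip (h z) x = ip (g (L k z)) (inv (L' k) x)"
        using adj[OF aut_linear[OF aut_inv[OF L'(1)]]] inv_sa by (metis h_def)
      also have "\<dots> = ip (L k z) (adj g (inv (L' k) x))" by (rule adj[OF aut_linear[OF g]])
      also have "\<dots> = ip z (L k (adj g (inv (L' k) x)))" using adj[OF aut_linear[OF L(1)]] L(2) by metis
      finally show "ip (h z) x = ip z (L k (adj g (inv (L' k) x)))" .
    qed
    have "h (adj h (L' k y)) = L' k y" by (rule stabilizer[OF h \<open>h b = b\<close>])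
    then have "inv (L' k) (g (L k (L k (adj g y)))) = L' k y" using L'(1) unfolding adj_h by (simp add: h_def)
    then show ?thesis using L'(1) by (metis aut_f_inv)
  qed
  have limL: "(\<lambda>k. L k b) \<longlonglongrightarrow> v" unfolding L(3) by (rule approx_base_lim)
  have gcont: "(\<lambda>k. g (x k)) \<longlonglongrightarrow> g y" if "x \<longlonglongrightarrow> y" for x :: "nat \<Rightarrow> real^'n" and y
    using bounded_linear.tendsto[OF _ that] aut_linear[OF g] by (simp add: linear_linear)
  obtain r B where r: "strict_mono r" "\<And>x. (\<lambda>k. L (r k) x) \<longlonglongrightarrow> (ip v x / ip v b) *\<^sub>R v" "\<And>k x. norm (L k x) \<le> B * norm x"
    by (rule rank_one_limit[of v L, OF v L(1,2) limL]) (rule that)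
  have limL': "(\<lambda>k. L' (r k) b) \<longlonglongrightarrow> g v"
    unfolding L'(3) using LIMSEQ_subseq_LIMSEQ[OF gcont[OF approx_base_lim] r(1)] by (simp add: o_def)
  \<comment> \<open>A further subsequence makes \<open>L\<close> and \<open>L'\<close> converge
    simultaneously.\<close>
  obtain s B' where s: "strict_mono s" "\<And>x. (\<lambda>k. L' (r (s k)) x) \<longlonglongrightarrow> (ip (g v) x / ip (g v) b) *\<^sub>R g v"
    "\<And>k x. norm (L' (r k) x) \<le> B' * norm x"
    by (rule rank_one_limit[of "g v" "\<lambda>k. L' (r k)", OF gv L'(1,2) limL']) (rule that)
  have rs: "(\<lambda>k. L (r (s k)) x) \<longlonglongrightarrow> (ip v x / ip v b) *\<^sub>R v" for x
    using LIMSEQ_subseq_LIMSEQ[OF r(2) s(1)] by (simp add: o_def)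
  \<comment> \<open>Evaluating \<open>square\<close> at \<open>b\<close> and passing to the limit on
    both sides compares two multiples of \<open>g v\<close>.\<close>
  define y where "y = adj g b"
  have "(\<lambda>k. L (r (s k)) (L (r (s k)) y)) \<longlonglongrightarrow> (ip v ((ip v y / ip v b) *\<^sub>R v) / ip v b) *\<^sub>R v"
    by (rule tendsto_linear_seq[of "\<lambda>k. L (r (s k))", OF aut_linear[OF L(1)] r(3) rs rs])
  then have "(\<lambda>k. g (L (r (s k)) (L (r (s k)) y))) \<longlonglongrightarrow> g ((ip v ((ip v y / ip v b) *\<^sub>R v) / ip v b) *\<^sub>R v)"
    by (rule gcont)
  moreover have "(\<lambda>k. L' (r (s k)) (L' (r (s k)) b)) \<longlonglongrightarrow>
      (ip (g v) ((ip (g v) b / ip (g v) b) *\<^sub>R g v) / ip (g v) b) *\<^sub>R g v"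
    by (rule tendsto_linear_seq[of "\<lambda>k. L' (r (s k))", OF aut_linear[OF L'(1)] s(3) s(2) s(2)])
  ultimately have "g ((ip v ((ip v y / ip v b) *\<^sub>R v) / ip v b) *\<^sub>R v)
      = (ip (g v) ((ip (g v) b / ip (g v) b) *\<^sub>R g v) / ip (g v) b) *\<^sub>R g v"
    unfolding y_def square by (rule LIMSEQ_unique)
  moreover have "ip v y = ip (g v) b" by (simp add: y_def adj aut_linear g)
  ultimately have "(ip (g v) b / ip v b * ip v v / ip v b) *\<^sub>R g v = (ip (g v) (g v) / ip (g v) b) *\<^sub>R g v"
    using ip_extremal_pos[OF gv base] by (simp add: linear_cmul aut_linear g scaleR_right)
  moreover have "g v \<noteq> 0" using gv by (simp add: extremal_def)
  ultimately have "ip (g v) b / ip v b * ip v v / ip v b = ip (g v) (g v) / ip (g v) b"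
    using scaleR_cancel_right by blast
  then show ?thesis
    unfolding ray_weight_def using ip_extremal_pos[OF gv base] ip_extremal_pos[OF v base]
    by (simp add: field_simps power2_eq_square)
qed

text \<open>Self-adjoint automorphisms collapsing onto the ray of \<open>v\<close> keep the weight
  of \<open>w\<close> constant and carry \<open>w\<close> to a multiple of \<open>v\<close>.
  Non-orthogonality makes this multiple nonzero, so the weight is continuous there.\<close>

lemma ray_weight_eq:
  assumes v: "extremal v" and w: "extremal w" and ne: "ip v w \<noteq> 0"
  shows "ray_weight v = ray_weight w"
proof -
  have vC: "v \<in> C" using v by (simp add: extremal_def)
  let ?w = "\<lambda>k. v + inverse (real (Suc k)) *\<^sub>R b"
  obtain L where L: "\<And>k::nat. aut (L k)" "\<And>k. adj (L k) = L k" "\<And>k. L k b = ?w k"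
    by (rule ex_self_adjoint_seq[of ?w, OF approx_base[OF vC]]) blast
  have limL: "(\<lambda>k. L k b) \<longlonglongrightarrow> v" unfolding L(3) by (rule approx_base_lim)
  obtain r B where r: "strict_mono r" "\<And>x. (\<lambda>k. L (r k) x) \<longlonglongrightarrow> (ip v x / ip v b) *\<^sub>R v" "\<And>k x. norm (L k x) \<le> B * norm x"
    by (rule rank_one_limit[of v L, OF v L(1,2) limL]) (rule that)
  define c where "c = ip v w / ip v b"
  have pos: "ip v b > 0" by (rule ip_extremal_pos[OF v base])
  have c: "c \<noteq> 0" using ne pos by (simp add: c_def)
  have lim: "(\<lambda>k. L (r k) w) \<longlonglongrightarrow> c *\<^sub>R v" unfolding c_def by (rule r(2))
  have "(\<lambda>k. ray_weight (L (r k) w)) \<longlonglongrightarrow> ray_weight (c *\<^sub>R v)"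
    unfolding ray_weight_def
    by (intro tendsto_divide tendsto_power tendsto tendsto_const lim) (use c pos in \<open>simp add: scaleR_left\<close>)
  moreover have "ray_weight (L (r k) w) = ray_weight w" for k by (rule ray_weight_aut[OF L(1) w])
  ultimately have "ray_weight w = ray_weight (c *\<^sub>R v)" by (simp add: LIMSEQ_const_iff)
  also have "\<dots> = ray_weight v" using c by (simp add: ray_weight_def scaleR_left scaleR_right power2_eq_square)
  finally show ?thesis ..
qed

lemma ray_weight_pos: "extremal v \<Longrightarrow> ray_weight v > 0"
  unfolding ray_weight_def using ip_extremal_pos[OF _ base, of v] self_pos[of v] by (simp add: extremal_def)

lemma sqrt_ray_weight: "extremal v \<Longrightarrow> sqrt (ray_weight v) * ip v b = sqrt (ip v v)"
  using ip_extremal_pos[OF _ base, of v] by (simp add: ray_weight_def real_sqrt_divide)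

text \<open>
  Rays of different weight are orthogonal, so rescaling every extremal summand by a function of its
  weight is a well-defined operation, although the decomposition into extremal vectors is not unique.
\<close>

lemma rescale_by_weight:
  fixes f :: "real \<Rightarrow> real"
  obtains y where "\<And>v. extremal v \<Longrightarrow> ip v y = f (ray_weight v) * ip v x"
proof -
  have on_C: "\<exists>y. \<forall>v. extremal v \<longrightarrow> ip v y = f (ray_weight v) * ip v x" if x: "x \<in> C" for x
  proof -
    obtain vs where vs: "\<And>v. v \<in> set vs \<Longrightarrow> v = 0 \<or> extremal v" "x = sum_list vs"
      using caratheodory_decomposition[OF x] by metis
    have "ip v (\<Sum>u\<leftarrow>vs. f (ray_weight u) *\<^sub>R u) = f (ray_weight v) * ip v x" if v: "extremal v" for v
    proof -
      have "f (ray_weight u) * ip v u = f (ray_weight v) * ip v u" if "u \<in> set vs" for u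
        using vs(1)[OF that] ray_weight_eq[OF v, of u] by (cases "ip v u = 0") (auto simp: zero_right)
      then have "(\<Sum>u\<leftarrow>vs. f (ray_weight u) * ip v u) = (\<Sum>u\<leftarrow>vs. f (ray_weight v) * ip v u)"
        by (intro arg_cong[of _ _ sum_list] map_cong) auto
      then show ?thesis
        by (simp add: vs(2) sum_list_right o_def scaleR_right sum_list_const_mult)
    qed
    then show ?thesis by blast
  qed
  obtain x' x'' where x: "x' \<in> C" "x'' \<in> C" "x = x' - x''" by (rule diff_mem_C)
  obtain y' y'' where "\<And>v. extremal v \<Longrightarrow> ip v y' = f (ray_weight v) * ip v x'"
    "\<And>v. extremal v \<Longrightarrow> ip v y'' = f (ray_weight v) * ip v x''"
    using on_C[OF x(1)] on_C[OF x(2)] by blast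
  then show ?thesis by (intro that[of "y' - y''"]) (simp add: x(3) diff_right right_diff_distrib)
qed

section \<open>The trace vector\<close>

lemma ex_trace_vector: obtains e where "\<And>v. extremal v \<Longrightarrow> ip v e = sqrt (ip v v)"
  using rescale_by_weight[of sqrt b] sqrt_ray_weight by metis

text \<open>Expand \<open>x\<close> into extremal vectors and apply Cauchy-Schwarz to each pair:
  \<open>ip u v\<close> is at most the product of the two norms, which is
  \<open>ip u e * ip v e\<close>. Summing over both indices gives the bound.\<close>

lemma trace_vector_ge:
  assumes e: "\<And>v. extremal v \<Longrightarrow> ip v e = sqrt (ip v v)" and x: "x \<in> C"
  shows "0 \<le> ip x e" "ip x x \<le> (ip x e)\<^sup>2"
proof -
  obtain vs where vs: "\<And>v. v \<in> set vs \<Longrightarrow> v = 0 \<or> extremal v" "x = sum_list vs"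
    using caratheodory_decomposition[OF x] by metis
  have ve: "ip v e = sqrt (ip v v)" if "v \<in> set vs" for v
    using vs(1)[OF that] e by (auto simp: zero_left)
  show "0 \<le> ip x e"
    unfolding vs(2) sum_list_left by (intro sum_list_nonneg) (use ve self_nonneg in auto)
  have uv: "ip u v \<le> ip u e * ip v e" if "u \<in> set vs" "v \<in> set vs" for u v
  proof -
    have "ip u v \<le> sqrt ((ip u v)\<^sup>2)" by simp
    also have "\<dots> \<le> sqrt (ip u u * ip v v)" by (intro real_sqrt_le_mono Cauchy_Schwarz)
    finally show ?thesis using that by (simp add: ve real_sqrt_mult)
  qed
  have ux: "ip u x \<le> ip u e * ip x e" if "u \<in> set vs" for u
  proof -
    have "ip u x = (\<Sum>v\<leftarrow>vs. ip u v)" by (simp add: vs(2) sum_list_right)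
    also have "\<dots> \<le> (\<Sum>v\<leftarrow>vs. ip u e * ip v e)" by (rule sum_list_mono) (rule uv[OF that])
    finally show ?thesis by (simp add: sum_list_const_mult vs(2) sum_list_left)
  qed
  have "ip x x = (\<Sum>u\<leftarrow>vs. ip u x)" using sum_list_left[of vs x] vs(2) by simp
  also have "\<dots> \<le> (\<Sum>u\<leftarrow>vs. ip u e * ip x e)" by (rule sum_list_mono) (rule ux)
  also have "\<dots> = (ip x e)\<^sup>2"
    using sum_list_left[of vs e] by (simp add: sum_list_mult_const vs(2) power2_eq_square)
  finally show "ip x x \<le> (ip x e)\<^sup>2" .
qed

lemma trace_vector_interior:
  assumes e: "\<And>v. extremal v \<Longrightarrow> ip v e = sqrt (ip v v)"
  shows "e \<in> interior C"
proof -
  obtain c where c: "c > 0" "\<And>x. c * (norm x)\<^sup>2 \<le> ip x x" by (rule self_ge_norm) blast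
  show ?thesis
  proof (rule interiorI)
    show "sqrt c > 0" using c by simp
    fix x assume x: "x \<in> C"
    have "c * (norm x)\<^sup>2 \<le> (ip x e)\<^sup>2" using c(2)[of x] trace_vector_ge(2)[of e x] e x by fastforce
    then have "sqrt (c * (norm x)\<^sup>2) \<le> sqrt ((ip x e)\<^sup>2)" by (rule real_sqrt_le_mono)
    then show "sqrt c * norm x \<le> ip x e" using trace_vector_ge(1)[of e x] e x by (simp add: real_sqrt_mult)
  qed
qed

text \<open>Decompose \<open>e\<close> itself. The other summands pair nonnegatively with
  \<open>v\<close>, so the square of the norm of \<open>v\<close> is at most \<open>ip v e\<close>,
  the norm itself; hence each \<open>ip v e\<close> is at most 1.\<close>

lemma trace_vector_norm:
  assumes e: "\<And>v. extremal v \<Longrightarrow> ip v e = sqrt (ip v v)"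
  shows "ip e e \<le> real (caratheodory_number C)"
proof -
  have eC: "e \<in> C" by (rule interior_mem[OF trace_vector_interior[OF e]])
  obtain vs where vs: "length vs \<le> caratheodory_number C" "\<And>v. v \<in> set vs \<Longrightarrow> v = 0 \<or> extremal v" "e = sum_list vs"
    by (rule caratheodory_decomposition[OF eC]) (rule that)
  have mem: "v \<in> C" if "v \<in> set vs" for v using vs(2)[OF that] zero_mem by (auto simp: extremal_def)
  have sum_mem: "sum_list us \<in> C" if "set us \<subseteq> C" for us
    using that by (induction us) (auto simp: zero_mem add_mem)
  have le1: "ip v e \<le> 1" if v: "v \<in> set vs" for v
  proof -
    have ve: "ip v e = sqrt (ip v v)" using vs(2)[OF v] e by (auto simp: zero_left)
    have "set (remove1 v vs) \<subseteq> C" using mem set_remove1_subset[of v vs] by auto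
    then have "0 \<le> ip v (sum_list (remove1 v vs))" by (intro ip_nonneg[OF mem[OF v]] sum_mem)
    moreover have "e = v + sum_list (remove1 v vs)"
      using sum_list_map_remove1[OF v, of "\<lambda>x. x"] vs(3) by simp
    from arg_cong[OF this, of "ip v"] have "ip v e = ip v v + ip v (sum_list (remove1 v vs))"
      by (simp only: add_right)
    ultimately have "ip v v \<le> ip v e" by simp
    then have "sqrt (ip v v) * sqrt (ip v v) \<le> sqrt (ip v v) * 1" using ve self_nonneg[of v] by simp
    moreover have "q \<le> 1" if "q * q \<le> q * 1" "0 \<le> q" for q :: real
      using that by (metis mult_le_cancel_left_pos order_le_less zero_le_one)
    ultimately have "sqrt (ip v v) \<le> 1" using self_nonneg[of v] real_sqrt_ge_zero by blast
    with ve show ?thesis by simp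
  qed
  have "ip e e = (\<Sum>v\<leftarrow>vs. ip v e)" using sum_list_left[of vs e] vs(3) by simp
  also have "\<dots> \<le> (\<Sum>v\<leftarrow>vs. 1)" by (rule sum_list_mono) (rule le1)
  also have "\<dots> = real (length vs)" by (simp add: sum_list_triv)
  finally show ?thesis using vs(1) by simp
qed

text \<open>Automorphisms preserve weights, so against an extremal \<open>v\<close> the motion of
  \<open>e\<close> is that of \<open>b\<close> multiplied by the square root of the weight of
  \<open>v\<close>. Asking \<open>b\<close> to move along the inversely rescaled \<open>u'\<close>
  makes \<open>e\<close> move along \<open>u\<close>.\<close>

lemma trace_vector_tangent_full:
  assumes e: "\<And>v. extremal v \<Longrightarrow> ip v e = sqrt (ip v v)"
  shows "tangent_full e"
  unfolding tangent_full_def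
proof
  fix u
  obtain u' where u': "\<And>v. extremal v \<Longrightarrow> ip v u' = 1 / sqrt (ray_weight v) * ip v u"
    by (rule rescale_by_weight[of "\<lambda>s. 1 / sqrt s" u]) blast
  obtain P X t where P: "\<And>k. aut (P k)" "\<And>k. adj (P k) = P k" and t: "\<And>k. 0 < t k" "t \<longlonglongrightarrow> 0"
    and X: "\<And>x. (\<lambda>k. (P k x - x) /\<^sub>R t k) \<longlonglongrightarrow> X x" and Xb: "X b = u'"
    using base_tangent[unfolded tangent_full_def, rule_format, of u'] by blast
  have "X e = u"
  proof (rule extremal_eqI)
    fix v assume v: "extremal v"
    let ?\<tau> = "sqrt (ray_weight v)"
    have \<tau>: "?\<tau> > 0" using ray_weight_pos[OF v] by simp
    have Pe: "ip v (P k e) = ?\<tau> * ip v (P k b)" for k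
    proof -
      have sa: "ip v (P k x) = ip (P k v) x" for x using adj[OF aut_linear[OF P(1)]] P(2) by metis
      note Pv = extremal_aut[OF P(1) v, of k]
      have "ip (P k v) e = sqrt (ip (P k v) (P k v))" by (rule e[OF Pv])
      also have "\<dots> = sqrt (ray_weight (P k v)) * ip (P k v) b" by (rule sqrt_ray_weight[OF Pv, symmetric])
      finally show ?thesis by (simp add: sa ray_weight_aut[OF P(1) v])
    qed
    have "ip v e = ?\<tau> * ip v b" using e[OF v] sqrt_ray_weight[OF v] by simp
    then have eq: "ip v ((P k e - e) /\<^sub>R t k) = ?\<tau> * ip v ((P k b - b) /\<^sub>R t k)" for k
      by (simp add: scaleR_right diff_right Pe algebra_simps)
    have "ip v (X e) = ?\<tau> * ip v (X b)"
    proof (rule LIMSEQ_unique)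
      show "(\<lambda>k. ip v ((P k e - e) /\<^sub>R t k)) \<longlonglongrightarrow> ip v (X e)" by (intro tendsto tendsto_const X)
      show "(\<lambda>k. ip v ((P k e - e) /\<^sub>R t k)) \<longlonglongrightarrow> ?\<tau> * ip v (X b)"
        unfolding eq by (intro tendsto_mult tendsto tendsto_const X)
    qed
    then show "ip v (X e) = ip v u" using u'[OF v] \<tau> by (simp add: Xb)
  qed
  then show "\<exists>P X t. (\<forall>k. aut (P k) \<and> adj (P k) = P k \<and> 0 < t k) \<and> t \<longlonglongrightarrow> 0 \<and>
     (\<forall>x. (\<lambda>k. (P k x - x) /\<^sub>R t k) \<longlonglongrightarrow> X x) \<and> X e = u"
    using P t X by blast
qed

text \<open>The factor is found by its value at \<open>b\<close>: choose a self-adjoint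
  \<open>L\<close> with \<open>L b = adj g b\<close>. Then \<open>inv L\<close> composed with
  \<open>adj g\<close> fixes \<open>b\<close>, hence is orthogonal, and this identity rearranges to
  the factorization.\<close>

lemma automorphism_polar:
  assumes g: "aut g"
  obtains L where "aut L" "adj L = L" "\<And>x. adj g (g x) = L (L x)"
proof -
  obtain L where L: "aut L" "adj L = L" "L b = adj g b"
    by (rule self_adjoint_transitive[OF base base_tangent base aut_interior[OF aut_adj[OF g] base]])
  define k where "k = (\<lambda>x. inv L (adj g x))"
  have k: "aut k" unfolding k_def by (rule aut_comp[OF aut_inv[OF L(1)] aut_adj[OF g]])
  have kb: "k b = b" using L by (metis aut_inv_f k_def)
  have inv_sa: "adj (inv L) = inv L" using inv_adj[OF L(1)] L(2) by metis
  have adj_k: "adj k x = g (inv L x)" for x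
  proof (rule adj_unique[OF _ aut_linear[OF k]])
    fix z
    have "ip (k z) x = ip (adj g z) (inv L x)"
      using adj[OF aut_linear[OF aut_inv[OF L(1)]]] inv_sa by (metis k_def)
    then show "ip (k z) x = ip z (g (inv L x))" by (simp add: adj' aut_linear g)
  qed
  have "adj g (g x) = L (L x)" for x
  proof -
    have "k (adj k (L x)) = L x" by (rule stabilizer[OF k kb])
    then have "inv L (adj g (g x)) = L x" using L(1) unfolding adj_k by (simp add: k_def)
    then show ?thesis using L(1) by (metis aut_f_inv)
  qed
  with L show ?thesis using that by blast
qed

text \<open>Since \<open>ip (g x) (adj (inv g) y) = ip x y\<close>, the bound
  \<open>\<Delta>\<close> passes to both convex hulls and gives
  \<open>ip z z \<le> \<Delta>\<close>. Pairing with the trace vector then converts the minimax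
  property into norm bounds.\<close>

theorem balanced_rescaling:
  assumes A: "finite A" "A \<noteq> {}" "A \<subseteq> C" and B: "finite B" "B \<noteq> {}" "B \<subseteq> C"
    and \<Delta>: "\<And>x y. x \<in> A \<Longrightarrow> y \<in> B \<Longrightarrow> ip x y \<le> \<Delta>"
    and a0: "a0 \<in> interior C" "\<And>y c. y \<in> C \<Longrightarrow> (\<And>a. a \<in> A \<Longrightarrow> ip a y \<le> c) \<Longrightarrow> ip a0 y \<le> KA * c"
    and b0: "b0 \<in> interior C" "\<And>y c. y \<in> C \<Longrightarrow> (\<And>b. b \<in> B \<Longrightarrow> ip b y \<le> c) \<Longrightarrow> ip b0 y \<le> KB * c"
  obtains L where "aut L" "adj L = L"
    "\<And>x. x \<in> A \<Longrightarrow> ip (L x) (L x) \<le> real (caratheodory_number C) * \<Delta>"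
    "\<And>y. y \<in> B \<Longrightarrow> ip (inv L y) (inv L y) \<le> real (caratheodory_number C) * \<Delta>"
proof -
  obtain e where e: "\<And>v. extremal v \<Longrightarrow> ip v e = sqrt (ip v v)" by (rule ex_trace_vector) blast
  obtain g z where g: "aut g" and z: "z \<in> convex hull (g ` A)" "z \<in> convex hull (adj (inv g) ` B)"
    and zA: "\<And>x. x \<in> A \<Longrightarrow> ip (g x) e \<le> ip z e" and zB: "\<And>y. y \<in> B \<Longrightarrow> ip (adj (inv g) y) e \<le> ip z e"
    by (rule minimax_automorphism[OF trace_vector_interior[OF e] trace_vector_tangent_full[OF e] A B a0 b0]) blast+
  have zz: "ip z z \<le> \<Delta>"
  proof -
    have conv: "convex {x. ip x y \<le> \<Delta>}" for y
    proof -
      have "{x. ip x y \<le> \<Delta>} = (\<lambda>x. ip x y) -` {..\<Delta>}" by auto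
      then show ?thesis using convex_linear_vimage[of "\<lambda>x. ip x y" "{..\<Delta>}"]
          bounded_linear.linear[OF bounded_linear_left, of y] by simp
    qed
    have 1: "ip z y \<le> \<Delta>" if "y \<in> adj (inv g) ` B" for y
    proof -
      have "g ` A \<subseteq> {x. ip x y \<le> \<Delta>}"
        using that \<Delta> g by (auto simp: adj[symmetric] aut_linear aut_inv)
      then have "convex hull (g ` A) \<subseteq> {x. ip x y \<le> \<Delta>}" by (intro hull_minimal conv)
      then show ?thesis using z(1) by blast
    qed
    then have "adj (inv g) ` B \<subseteq> {y. ip y z \<le> \<Delta>}" using commute[of z] by auto
    then have "convex hull (adj (inv g) ` B) \<subseteq> {y. ip y z \<le> \<Delta>}" by (intro hull_minimal conv)
    then show ?thesis using z(2) by blast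
  qed
  have "(ip z e)\<^sup>2 \<le> ip z z * ip e e" by (rule Cauchy_Schwarz)
  also have "\<dots> \<le> \<Delta> * real (caratheodory_number C)"
    using zz self_nonneg[of z] self_nonneg[of e] trace_vector_norm[OF e] by (intro mult_mono) auto
  finally have M: "(ip z e)\<^sup>2 \<le> real (caratheodory_number C) * \<Delta>" by (simp add: mult.commute)
  have bound: "ip x x \<le> real (caratheodory_number C) * \<Delta>" if x: "x \<in> C" "ip x e \<le> ip z e" for x
  proof -
    have "ip x x \<le> (ip x e)\<^sup>2" by (rule trace_vector_ge(2)[OF e x(1)])
    also have "\<dots> \<le> (ip z e)\<^sup>2" using x(2) trace_vector_ge(1)[OF e x(1)] by (intro power_mono)
    finally show ?thesis using M by simp
  qed
  obtain L where L: "aut L" "adj L = L" "\<And>x. adj g (g x) = L (L x)"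
    by (rule automorphism_polar[OF g]) blast
  have sa: "ip (L x) y = ip x (L y)" for x y using adj[OF aut_linear[OF L(1)]] L(2) by metis
  have LA: "ip (L x) (L x) = ip (g x) (g x)" for x
    using sa[of x "L x"] L(3)[of x] adj[OF aut_linear[OF g], of x "g x"] by simp
  have LB: "ip (inv L y) (inv L y) = ip (adj (inv g) y) (adj (inv g) y)" for y
  proof -
    \<comment> \<open>Inverting the factorization shows that \<open>inv g\<close> composed with
      \<open>adj (inv g)\<close> is the square of \<open>inv L\<close>.\<close>
    have "L (L (inv g (adj (inv g) y))) = y" using L(3)[symmetric] g by (simp add: adj_inv)
    then have "inv g (adj (inv g) y) = inv L (inv L y)" using L(1) by (metis aut_inv_f)
    then have "ip (adj (inv g) y) (adj (inv g) y) = ip y (inv L (inv L y))"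
      by (simp add: adj' aut_linear aut_inv g)
    also have "\<dots> = ip (inv L y) (inv L y)"
      using sa[of "inv L y" "inv L (inv L y)"] L(1) by simp
    finally show ?thesis ..
  qed
  show ?thesis
  proof (rule that[OF L(1,2)])
    show "ip (L x) (L x) \<le> real (caratheodory_number C) * \<Delta>" if "x \<in> A" for x
      unfolding LA using bound[OF aut_mem[OF g] zA[OF that]] A(3) that by blast
    show "ip (inv L y) (inv L y) \<le> real (caratheodory_number C) * \<Delta>" if "y \<in> B" for y
      unfolding LB using bound[OF aut_adj_mem[OF aut_inv[OF g]] zB[OF that]] B(3) that by blast
  qed
qed

end

section \<open>The rescaling theorem\<close>

text \<open>\<open>K\<close> is the total weight of one fixed representation, so it depends neither
  on \<open>y\<close> nor on \<open>c\<close>, as the compactness argument in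
  \<open>minimax_automorphism\<close> demands.\<close>

lemma conical_combination_bound:
  assumes "ip_space ip" "x \<in> conical_combinations S"
  obtains K where "\<And>y c. (\<And>s. s \<in> S \<Longrightarrow> ip s y \<le> c) \<Longrightarrow> ip x y \<le> K * c"
proof -
  interpret ip_space ip by (rule assms)
  obtain T w where T: "finite T" "T \<subseteq> S" "\<forall>s\<in>T. 0 \<le> w s" "x = (\<Sum>s\<in>T. w s *\<^sub>R s)"
    using assms(2) unfolding conical_combinations_def by blast
  show ?thesis
  proof (rule that[of "\<Sum>s\<in>T. w s"])
    fix y c assume "\<And>s. s \<in> S \<Longrightarrow> ip s y \<le> c"
    then have "(\<Sum>s\<in>T. w s * ip s y) \<le> (\<Sum>s\<in>T. w s * c)"
      using T by (intro sum_mono mult_left_mono) auto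
    then show "ip x y \<le> (\<Sum>s\<in>T. w s) * c"
      by (simp add: T(4) sum_left scaleR_left sum_distrib_right)
  qed
qed

theorem theorem6:
  fixes C A B :: "(real ^ 'n) set"
    and ip :: "real ^ 'n \<Rightarrow> real ^ 'n \<Rightarrow> real"
    and \<Delta> :: real
  assumes "symmetric_cone C"
    and "is_inner_product ip"
    and "dual_cone ip C = C"
    and "A \<subseteq> C" and "finite A"
    and "B \<subseteq> dual_cone ip C" and "finite B"
    and "\<forall>a\<in>A. \<forall>b\<in>B. ip a b \<le> \<Delta>"
    and "conical_combinations A \<inter> interior C \<noteq> {}"
    and "conical_combinations B \<inter> interior (dual_cone ip C) \<noteq> {}"
  shows "\<exists>L. cone_automorphism C L \<and> self_adjoint_wrt ip L \<and>
           (\<forall>a\<in>A. \<forall>b\<in>B.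
              ip (L a) (L a) \<le> real (caratheodory_number C) * \<Delta> \<and>
              ip (inv L b) (inv L b) \<le> real (caratheodory_number C) * \<Delta>)"
proof -
  interpret self_dual_homogeneous_cone ip C
    using assms(1-3) by unfold_locales (simp_all add: symmetric_cone_def)
  obtain b where b: "b \<in> interior C" "moment b = b" by (rule ex_moment_fixpoint)
  interpret based_cone ip C b
    using b moment_fixpoint_stabilizer[OF b] moment_fixpoint_tangent_full[OF b] by unfold_locales
  have ips: "ip_space ip" by (rule ip_space_axioms)
  obtain a0 where a0: "a0 \<in> conical_combinations A" "a0 \<in> interior C" using assms(9) by blast
  obtain b0 where b0: "b0 \<in> conical_combinations B" "b0 \<in> interior C" using assms(3,10) by auto
  \<comment> \<open>The only combination of the empty set is 0, which is not an interior
    point.\<close>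
  have nonempty: "S \<noteq> {}" if "x \<in> conical_combinations S" "x \<in> interior C" for S x
    using that interior_nonzero by (fastforce simp: conical_combinations_def)
  obtain KA where KA: "\<And>y c. (\<And>s. s \<in> A \<Longrightarrow> ip s y \<le> c) \<Longrightarrow> ip a0 y \<le> KA * c"
    by (rule conical_combination_bound[OF ips a0(1)]) blast
  obtain KB where KB: "\<And>y c. (\<And>s. s \<in> B \<Longrightarrow> ip s y \<le> c) \<Longrightarrow> ip b0 y \<le> KB * c"
    by (rule conical_combination_bound[OF ips b0(1)]) blast
  let ?bound = "real (caratheodory_number C) * \<Delta>"
  have "\<exists>L. aut L \<and> adj L = L \<and> (\<forall>x\<in>A. ip (L x) (L x) \<le> ?bound) \<and> (\<forall>y\<in>B. ip (inv L y) (inv L y) \<le> ?bound)"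
  proof (rule balanced_rescaling[of A B \<Delta> a0 KA b0 KB])
    show "A \<noteq> {}" "B \<noteq> {}" using nonempty[OF a0] nonempty[OF b0] .
    show "finite A" "A \<subseteq> C" "finite B" "a0 \<in> interior C" "b0 \<in> interior C" by fact+
    show "B \<subseteq> C" using assms(3,6) by simp
    show "ip x y \<le> \<Delta>" if "x \<in> A" "y \<in> B" for x y using assms(8) that by blast
    show "ip a0 y \<le> KA * c" if "\<And>a. a \<in> A \<Longrightarrow> ip a y \<le> c" for y c by (rule KA[OF that])
    show "ip b0 y \<le> KB * c" if "\<And>b. b \<in> B \<Longrightarrow> ip b y \<le> c" for y c by (rule KB[OF that])
    fix L assume "aut L" "adj L = L" "\<And>x. x \<in> A \<Longrightarrow> ip (L x) (L x) \<le> ?bound"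
      "\<And>y. y \<in> B \<Longrightarrow> ip (inv L y) (inv L y) \<le> ?bound"
    then show ?thesis by blast
  qed
  then obtain L where L: "aut L" "adj L = L" "\<forall>x\<in>A. ip (L x) (L x) \<le> ?bound"
    "\<forall>y\<in>B. ip (inv L y) (inv L y) \<le> ?bound"
    by blast
  have "self_adjoint_wrt ip L"
    unfolding self_adjoint_wrt_def using adj[OF aut_linear[OF L(1)]] L(2) by metis
  then show ?thesis using L by blast
qed

end
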